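(* There exists a constant $C_{bd}$, independent of the parameters $\lambda,R_i^{-1},\alpha_{p_i},\alpha_{ij}$ ($i,j=1,\dots,n$), the network scale $n$ and the mesh size $h$, such that for all $(\boldsymbol u_h;\boldsymbol v_h;\boldsymbol p_h)\in\boldsymbol U_h\times\boldsymbol V_h\times\boldsymbol P_h$ and all $(\boldsymbol w_h;\boldsymbol z_h;\boldsymbol q_h)\in\boldsymbol U_h\times\boldsymbol V_h\times\boldsymbol P_h$ $$|\mathcal A_h((\boldsymbol u_h;\boldsymbol v_h;\boldsymbol p_h),(\boldsymbol w_h;\boldsymbol z_h;\boldsymbol q_h))|\le C_{bd}(\|\boldsymbol u_h\|_{\boldsymbol U_h}+\|\boldsymbol v_h\|_{\boldsymbol V}+\|\boldsymbol p_h\|_{\boldsymbol P})(\|\boldsymbol w_h\|_{\boldsymbol U_h}+\|\boldsymbol z_h\|_{\boldsymbol V}+\|\boldsymbol q_h\|_{\boldsymbol P}).$$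
   Context: Domain and mesh: $\Omega\subset\mathbb R^d$, $d\in\{2,3\}$, is a bounded connected polygonal/polyhedral Lipschitz domain; $(\cdot,\cdot)$, $\|\cdot\|$ are the $L^2(\Omega)$ inner product and norm. $\mathcal T_h$ is a triangulation of $\Omega$ into simplices $K$ of mesh size $h$, from a shape-regular family; $\mathcal E_h$ is the set of all edges (faces if $d=3$), interior and boundary; $h_K,h_e$ are the diameters of $K$ and $e$. $\boldsymbol\epsilon(\boldsymbol u)=\frac12(\nabla\boldsymbol u+(\nabla\boldsymbol u)^T)$ (elementwise). Traces: on an interior $e=\partial K_1\cap\partial K_2$ with exterior unit normals $\boldsymbol n_1,\boldsymbol n_2$, $\{\boldsymbol\tau\}=\frac12(\boldsymbol\tau|_{K_1}\boldsymbol n_1-\boldsymbol\tau|_{K_2}\boldsymbol n_2)$ for tensors and $[\boldsymbol v]=\boldsymbol v|_{K_1}-\boldsymbol v|_{K_2}$ for vectors; on a boundary $e$ with outward normal $\boldsymbol n$, $\{\boldsymbol\tau\}=\boldsymbol\tau\boldsymbol n$ and $[\boldsymbol v]=\boldsymbol v$. On $e$ with unit normal $\boldsymbol n$, $\boldsymbol u_t=\boldsymbol u-(\boldsymbol u\cdot\boldsymbol n)\boldsymbol n$. Finite element spaces: fix $l\ge1$. The local spaces $\boldsymbol U(K)/\boldsymbol V_i(K)/Q_i(K)$ are $BDM_l(K)/RT_{l-1}(K)/P_{l-1}(K)$ or $BDFM_l(K)/RT_{l-1}(K)/P_{l-1}(K)$ (Brezzi–Douglas–Marini, Brezzi–Douglas–Fortin–Marini,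 Raviart–Thomas elements, polynomials of degree $\le l-1$), so that $\operatorname{div}\boldsymbol U(K)=\operatorname{div}\boldsymbol V_i(K)=Q_i(K)$. For $i=1,\dots,n$: $\boldsymbol U_h=\{\boldsymbol u\in H(\operatorname{div};\Omega):\boldsymbol u|_K\in\boldsymbol U(K)\ \forall K,\ \boldsymbol u\cdot\boldsymbol n=0\text{ on }\partial\Omega\}$, $\boldsymbol V_{i,h}=\{\boldsymbol v\in H(\operatorname{div};\Omega):\boldsymbol v|_K\in\boldsymbol V_i(K)\ \forall K,\ \boldsymbol v\cdot\boldsymbol n=0\text{ on }\partial\Omega\}$, $P_{i,h}=\{q\in L^2(\Omega):q|_K\in Q_i(K)\ \forall K,\ \int_\Omega q\,dx=0\}$; $\boldsymbol V_h=\boldsymbol V_{1,h}\times\dots\times\boldsymbol V_{n,h}$, $\boldsymbol P_h=P_{1,h}\times\dots\times P_{n,h}$. $\operatorname{Div}\boldsymbol v=(\operatorname{div}\boldsymbol v_1,\dots,\operatorname{div}\boldsymbol v_n)^T$. Parameters: $n\ge1$; constants $\lambda>0$; $R_i^{-1}>0$, $\alpha_{p_i}\ge0$; $\alpha_{ij}=\frac{\tau\beta_{ij}}{\alpha_i\alpha_j}\ge0$ ($i,j=1,\dots,n$) with $\tau>0$, $\alpha_i>0$, $\beta_{ij}=\beta_{ji}\ge0$ for $i\neq j$, $\beta_{ii}=\sum_{j\ne i}\beta_{ij}$; $\tilde\alpha_{ii}=-\alpha_{p_i}-\alpha_{ii}$; $R^{-1}=\max_iR_i^{-1}$, $\lambda_0=\max\{1,\lambda\}$.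 Matrices ($n\times n$): $\Lambda_1$ has diagonal entries $\alpha_{ii}$ and off-diagonal entries $-\alpha_{ij}$; $\Lambda_2=\operatorname{diag}(\alpha_{p_1},\dots,\alpha_{p_n})$; $\Lambda_3=R\,I$; $\Lambda_4$ has all entries $1/\lambda_0$; $\Lambda=\sum_{k=1}^4\Lambda_k$. Norms: $\|\boldsymbol u\|_{\boldsymbol U_h}^2=\|\boldsymbol u\|_{DG}^2+\lambda\|\operatorname{div}\boldsymbol u\|^2$ with $\|\boldsymbol u\|_{DG}^2=\sum_K\|\nabla\boldsymbol u\|_{0,K}^2+\sum_{e\in\mathcal E_h}h_e^{-1}\|[\boldsymbol u_t]\|_{0,e}^2+\sum_Kh_K^2|\boldsymbol u|_{2,K}^2$; $\|\boldsymbol v\|_{\boldsymbol V}^2=\sum_i(R_i^{-1}\boldsymbol v_i,\boldsymbol v_i)+(\Lambda^{-1}\operatorname{Div}\boldsymbol v,\operatorname{Div}\boldsymbol v)$; $\|\boldsymbol p\|_{\boldsymbol P}^2=(\Lambda\boldsymbol p,\boldsymbol p)$. Forms: $$a_h(\boldsymbol u,\boldsymbol w)=\sum_{K}\int_K\boldsymbol\epsilon(\boldsymbol u):\boldsymbol\epsilon(\boldsymbol w)\,dx-\sum_{e\in\mathcal E_h}\int_e\{\boldsymbol\epsilon(\boldsymbol u)\}\cdot[\boldsymbol w_t]\,ds-\sum_{e\in\mathcal E_h}\int_e\{\boldsymbol\epsilon(\boldsymbol w)\}\cdot[\boldsymbol u_t]\,ds+\sum_{e\in\mathcal E_h}\int_e\eta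 h_e^{-1}[\boldsymbol u_t]\cdot[\boldsymbol w_t]\,ds,$$ where $\eta$ is a stabilization parameter independent of $\lambda,R_i^{-1},\alpha_{p_i},\alpha_{ij},n,h$; $$\begin{aligned}\mathcal A_h((\boldsymbol u_h;\boldsymbol v_h;\boldsymbol p_h),(\boldsymbol w_h;\boldsymbol z_h;\boldsymbol q_h))=&a_h(\boldsymbol u_h,\boldsymbol w_h)+\lambda(\operatorname{div}\boldsymbol u_h,\operatorname{div}\boldsymbol w_h)-\sum_i(p_{i,h},\operatorname{div}\boldsymbol w_h)+\sum_i(R_i^{-1}\boldsymbol v_{i,h},\boldsymbol z_{i,h})-\sum_i(p_{i,h},\operatorname{div}\boldsymbol z_{i,h})\\&-\sum_i(\operatorname{div}\boldsymbol u_h,q_{i,h})-\sum_i(\operatorname{div}\boldsymbol v_{i,h},q_{i,h})+\sum_i\tilde\alpha_{ii}(p_{i,h},q_{i,h})+\sum_i\sum_{j\ne i}\alpha_{ij}(p_{j,h},q_{i,h}),\end{aligned}$$ all sums over $i,j$ from $1$ to $n$. *)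

theory Defs
  imports "HOL-Analysis.Analysis" "Jordan_Normal_Form.Gauss_Jordan_Elimination"
begin

no_notation vec_index (infixl "$" 100)
no_notation scalar_prod (infix "\<bullet>" 70)

text \<open>Near every boundary point the domain is the strict hypograph, in some direction \<open>\<nu>\<close>,
  of a Lipschitz function \<open>g\<close> of the coordinates orthogonal to \<open>\<nu>\<close>.\<close>

definition lipschitz_boundary :: "'a::euclidean_space set \<Rightarrow> bool" where
  "lipschitz_boundary \<Omega> \<longleftrightarrow>
     (\<forall>x\<in>frontier \<Omega>. \<exists>\<nu> N L (g :: 'a \<Rightarrow> real).
        norm \<nu> = 1 \<and> open N \<and> x \<in> N \<and> L-lipschitz_on UNIV g \<and>
        (\<forall>y\<in>N. y \<in> \<Omega> \<longleftrightarrow> y \<bullet> \<nu> < g (y - (y \<bullet> \<nu>) *\<^sub>R \<nu>)))"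

definition polyhedral_lipschitz_domain :: "'a::euclidean_space set \<Rightarrow> bool" where
  "polyhedral_lipschitz_domain \<Omega> \<longleftrightarrow>
     open \<Omega> \<and> \<Omega> \<noteq> {} \<and> connected \<Omega> \<and> bounded \<Omega> \<and> lipschitz_boundary \<Omega> \<and>
     (\<exists>\<P>. finite \<P> \<and> (\<forall>P\<in>\<P>. polytope P) \<and> closure \<Omega> = \<Union>\<P>)"

text \<open>The elements are closed and full-dimensional; the library predicate
  \<^const>\<open>triangulation\<close> makes the mesh conforming (no hanging nodes).\<close>

definition simplicial_mesh :: "'a::euclidean_space set \<Rightarrow> 'a set set \<Rightarrow> bool" where
  "simplicial_mesh \<Omega> \<T> \<longleftrightarrow>
     triangulation \<T> \<and> (\<forall>K\<in>\<T>. int DIM('a) simplex K) \<and> \<Union>\<T> = closure \<Omega>"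

definition inball_diameter :: "'a::euclidean_space set \<Rightarrow> real" where
  "inball_diameter K = Sup {2 * r | r. 0 \<le> r \<and> (\<exists>c. cball c r \<subseteq> K)}"

definition shape_regular :: "'a::euclidean_space set set set \<Rightarrow> bool" where
  "shape_regular \<TT> \<longleftrightarrow>
     (\<exists>\<sigma>. \<forall>\<T>\<in>\<TT>. \<forall>K\<in>\<T>. diameter K \<le> \<sigma> * inball_diameter K)"

definition facets :: "'a::euclidean_space set set \<Rightarrow> 'a set set" where
  "facets \<T> = {e. \<exists>K\<in>\<T>. e facet_of K}"

definition interior_facet :: "'a::euclidean_space set set \<Rightarrow> 'a set \<Rightarrow> bool" where
  "interior_facet \<T> e \<longleftrightarrow>
     (\<exists>K1\<in>\<T>. \<exists>K2\<in>\<T>. K1 \<noteq> K2 \<and> e facet_of K1 \<and> e facet_of K2)"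

text \<open>The two elements sharing an interior facet, in an arbitrary but fixed order. Averages and
  jumps change sign together when the order is swapped, so the forms and norms below do not
  depend on it. On a boundary facet only \<open>elem1\<close> is meaningful.\<close>

definition elem1 :: "'a::euclidean_space set set \<Rightarrow> 'a set \<Rightarrow> 'a set" where
  "elem1 \<T> e = (SOME K. K \<in> \<T> \<and> e facet_of K)"

definition elem2 :: "'a::euclidean_space set set \<Rightarrow> 'a set \<Rightarrow> 'a set" where
  "elem2 \<T> e = (SOME K. K \<in> \<T> \<and> e facet_of K \<and> K \<noteq> elem1 \<T> e)"

definition outer_normal :: "'a::euclidean_space set \<Rightarrow> 'a set \<Rightarrow> 'a" where
  "outer_normal K e = (THE n. norm n = 1 \<and> (\<forall>x\<in>e. \<forall>y\<in>K. n \<bullet> (y - x) \<le> 0))"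

definition l2_inner :: "'a::euclidean_space set \<Rightarrow> ('a \<Rightarrow> 'b::euclidean_space) \<Rightarrow> ('a \<Rightarrow> 'b) \<Rightarrow> real" where
  "l2_inner S f g = (LINT x:S|lebesgue. f x \<bullet> g x)"

definition square_integrable :: "'a::euclidean_space set \<Rightarrow> ('a \<Rightarrow> 'b::euclidean_space) \<Rightarrow> bool" where
  "square_integrable S f \<longleftrightarrow>
     f \<in> borel_measurable (lebesgue_on S) \<and> integrable (lebesgue_on S) (\<lambda>x. (norm (f x))\<^sup>2)"

text \<open>Surface integral over a flat facet: by Fubini, the \<open>(d-1)\<close>-dimensional measure of \<open>e\<close> is
  the \<open>d\<close>-dimensional measure of the right prism of height 1 over \<open>e\<close>; the integrand is
  extended constantly in the normal direction.\<close>

definition facet_prism :: "'a::euclidean_space set \<Rightarrow> 'a set" where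
  "facet_prism e = {x. closest_point (affine hull e) x \<in> e \<and>
                       dist x (closest_point (affine hull e) x) \<le> 1/2}"

definition facet_integral :: "'a::euclidean_space set \<Rightarrow> ('a \<Rightarrow> real) \<Rightarrow> real" where
  "facet_integral e f = (LINT x:facet_prism e|lebesgue. f (closest_point (affine hull e) x))"

text \<open>Value on the boundary of \<open>K\<close> of the restriction of \<open>f\<close> to \<open>K\<close>. Discrete functions are
  represented by functions that are polynomial in the interior of every element; their values on
  the mesh skeleton, a null set, are irrelevant.\<close>

definition elem_trace :: "'a::euclidean_space set \<Rightarrow> ('a \<Rightarrow> 'b::euclidean_space) \<Rightarrow> 'a \<Rightarrow> 'b" where
  "elem_trace K f x = Lim (at x within interior K) f"

definition avg :: "(real^'d) set set \<Rightarrow> (real^'d) set \<Rightarrow> (real^'d \<Rightarrow> real^'d^'d) \<Rightarrow> real^'d \<Rightarrow> real^'d" where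
  "avg \<T> e \<tau> x =
     (let K1 = elem1 \<T> e; K2 = elem2 \<T> e in
      if interior_facet \<T> e
      then (1/2) *\<^sub>R (elem_trace K1 \<tau> x *v outer_normal K1 e - elem_trace K2 \<tau> x *v outer_normal K2 e)
      else elem_trace K1 \<tau> x *v outer_normal K1 e)"

definition jump :: "'a::euclidean_space set set \<Rightarrow> 'a set \<Rightarrow> ('a \<Rightarrow> 'a) \<Rightarrow> 'a \<Rightarrow> 'a" where
  "jump \<T> e v x =
     (if interior_facet \<T> e
      then elem_trace (elem1 \<T> e) v x - elem_trace (elem2 \<T> e) v x
      else elem_trace (elem1 \<T> e) v x)"

definition tangential :: "'a::euclidean_space \<Rightarrow> 'a \<Rightarrow> 'a" where
  "tangential n v = v - (v \<bullet> n) *\<^sub>R n"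

definition tangential_jump :: "'a::euclidean_space set set \<Rightarrow> 'a set \<Rightarrow> ('a \<Rightarrow> 'a) \<Rightarrow> 'a \<Rightarrow> 'a" where
  "tangential_jump \<T> e u = jump \<T> e (\<lambda>x. tangential (outer_normal (elem1 \<T> e) e) (u x))"

definition grad :: "(real^'d \<Rightarrow> real^'d) \<Rightarrow> real^'d \<Rightarrow> real^'d^'d" where
  "grad u x = jacobian u (at x)"

definition sym_grad :: "(real^'d \<Rightarrow> real^'d) \<Rightarrow> real^'d \<Rightarrow> real^'d^'d" where
  "sym_grad u x = (1/2) *\<^sub>R (grad u x + transpose (grad u x))"

text \<open>Pointwise divergence. For elementwise polynomial fields in H(div) it agrees almost
  everywhere with the weak divergence.\<close>

definition divg :: "(real^'d \<Rightarrow> real^'d) \<Rightarrow> real^'d \<Rightarrow> real" where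
  "divg u x = trace (grad u x)"

definition partial :: "'d \<Rightarrow> (real^'d \<Rightarrow> real) \<Rightarrow> real^'d \<Rightarrow> real" where
  "partial i f x = frechet_derivative f (at x) (axis i 1)"

text \<open>Sum over all ordered pairs \<open>(i, j)\<close>, i.e. the Frobenius norm of the Hessians; mixed
  derivatives are counted twice compared with the sum over multi-indices of order two.\<close>

definition h2_seminorm_sq :: "(real^'d) set \<Rightarrow> (real^'d \<Rightarrow> real^'d) \<Rightarrow> real" where
  "h2_seminorm_sq K u =
     (\<Sum>k\<in>UNIV. \<Sum>i\<in>UNIV. \<Sum>j\<in>UNIV.
        l2_inner K (partial i (partial j (\<lambda>y. u y $ k))) (partial i (partial j (\<lambda>y. u y $ k))))"

primrec Ck :: "nat \<Rightarrow> (real^'d \<Rightarrow> real) \<Rightarrow> bool" where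
  "Ck 0 f \<longleftrightarrow> continuous_on UNIV f"
| "Ck (Suc k) f \<longleftrightarrow> (\<forall>x. f differentiable (at x)) \<and> (\<forall>i. Ck k (partial i f))"

definition test_functions :: "(real^'d) set \<Rightarrow> (real^'d \<Rightarrow> real) set" where
  "test_functions \<Omega> =
     {\<phi>. (\<forall>k. Ck k \<phi>) \<and> (\<exists>S. compact S \<and> S \<subseteq> \<Omega> \<and> (\<forall>x. x \<notin> S \<longrightarrow> \<phi> x = 0))}"

definition weak_div :: "(real^'d) set \<Rightarrow> (real^'d \<Rightarrow> real^'d) \<Rightarrow> (real^'d \<Rightarrow> real) \<Rightarrow> bool" where
  "weak_div \<Omega> u g \<longleftrightarrow>
     (\<forall>\<phi>\<in>test_functions \<Omega>. l2_inner \<Omega> u (\<lambda>x. \<chi> i. partial i \<phi> x) = - l2_inner \<Omega> g \<phi>)"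

definition Hdiv :: "(real^'d) set \<Rightarrow> (real^'d \<Rightarrow> real^'d) set" where
  "Hdiv \<Omega> = {u. square_integrable \<Omega> u \<and> (\<exists>g. square_integrable \<Omega> g \<and> weak_div \<Omega> u g)}"

definition polys :: "nat \<Rightarrow> (real^'d \<Rightarrow> real) set" where
  "polys k = {f. \<exists>c. f = (\<lambda>x. \<Sum>a | sum a UNIV \<le> k. c a * (\<Prod>i\<in>UNIV. (x $ i) ^ a i))}"

definition vec_polys :: "nat \<Rightarrow> (real^'d \<Rightarrow> real^'d) set" where
  "vec_polys k = {f. \<forall>i. (\<lambda>x. f x $ i) \<in> polys k}"

definition BDM :: "nat \<Rightarrow> (real^'d) set \<Rightarrow> (real^'d \<Rightarrow> real^'d) set" where
  "BDM l K = vec_polys l"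

text \<open>Only meaningful for \<open>l \<ge> 1\<close>: the normal component on each facet loses one degree.\<close>

definition BDFM :: "nat \<Rightarrow> (real^'d) set \<Rightarrow> (real^'d \<Rightarrow> real^'d) set" where
  "BDFM l K = {f \<in> vec_polys l.
     \<forall>e. e facet_of K \<longrightarrow> (\<exists>g\<in>polys (l - 1). \<forall>x\<in>e. f x \<bullet> outer_normal K e = g x)}"

definition RT :: "nat \<Rightarrow> (real^'d) set \<Rightarrow> (real^'d \<Rightarrow> real^'d) set" where
  "RT k K = {f. \<exists>g\<in>vec_polys k. \<exists>q\<in>polys k. f = (\<lambda>x. g x + q x *\<^sub>R x)}"

definition Hdiv_space :: "(real^'d) set \<Rightarrow> (real^'d) set set \<Rightarrow>
    ((real^'d) set \<Rightarrow> (real^'d \<Rightarrow> real^'d) set) \<Rightarrow> (real^'d \<Rightarrow> real^'d) set" where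
  "Hdiv_space \<Omega> \<T> loc =
     {u \<in> Hdiv \<Omega>.
        (\<forall>K\<in>\<T>. \<exists>f\<in>loc K. \<forall>x\<in>interior K. u x = f x) \<and>
        (\<forall>K\<in>\<T>. \<forall>e. e facet_of K \<and> e \<subseteq> frontier \<Omega> \<longrightarrow>
           (\<forall>x\<in>e. elem_trace K u x \<bullet> outer_normal K e = 0))}"

text \<open>\<open>Uloc\<close> is \<^const>\<open>BDM\<close> or \<^const>\<open>BDFM\<close>. The \<open>n\<close> components of the product spaces are
  indexed by \<open>0, \<dots>, n - 1\<close>.\<close>

definition U_space :: "(real^'d) set \<Rightarrow> (real^'d) set set \<Rightarrow>
    (nat \<Rightarrow> (real^'d) set \<Rightarrow> (real^'d \<Rightarrow> real^'d) set) \<Rightarrow> nat \<Rightarrow> (real^'d \<Rightarrow> real^'d) set" where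
  "U_space \<Omega> \<T> Uloc l = Hdiv_space \<Omega> \<T> (Uloc l)"

definition V_space :: "(real^'d) set \<Rightarrow> (real^'d) set set \<Rightarrow> nat \<Rightarrow> nat \<Rightarrow>
    (nat \<Rightarrow> real^'d \<Rightarrow> real^'d) set" where
  "V_space \<Omega> \<T> l n = {v. \<forall>i<n. v i \<in> Hdiv_space \<Omega> \<T> (RT (l - 1))}"

definition P_space :: "(real^'d) set \<Rightarrow> (real^'d) set set \<Rightarrow> nat \<Rightarrow> nat \<Rightarrow>
    (nat \<Rightarrow> real^'d \<Rightarrow> real) set" where
  "P_space \<Omega> \<T> l n =
     {p. \<forall>i<n. square_integrable \<Omega> (p i) \<and>
           (\<forall>K\<in>\<T>. \<exists>f\<in>polys (l - 1). \<forall>x\<in>interior K. p i x = f x) \<and>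
           (LINT x:\<Omega>|lebesgue. p i x) = 0}"

definition exchange :: "real \<Rightarrow> (nat \<Rightarrow> real) \<Rightarrow> (nat \<Rightarrow> nat \<Rightarrow> real) \<Rightarrow> nat \<Rightarrow> nat \<Rightarrow> real" where
  "exchange \<tau> b \<beta> i j = \<tau> * \<beta> i j / (b i * b j)"

text \<open>\<open>Rinv i\<close>, \<open>\<alpha>p i\<close>, \<open>\<alpha> i j\<close> stand for \<open>R\<^sub>i\<close> inverse, \<open>\<alpha>\<close> with index \<open>p\<^sub>i\<close>, and \<open>\<alpha>\<^sub>i\<^sub>j\<close>.\<close>

definition Lambda :: "nat \<Rightarrow> real \<Rightarrow> (nat \<Rightarrow> real) \<Rightarrow> (nat \<Rightarrow> real) \<Rightarrow> (nat \<Rightarrow> nat \<Rightarrow> real) \<Rightarrow> real mat" where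
  "Lambda n lam Rinv \<alpha>p \<alpha> =
     (let \<Lambda>1 = Matrix.mat n n (\<lambda>(i,j). if i = j then \<alpha> i i else - \<alpha> i j);
          \<Lambda>2 = Matrix.mat n n (\<lambda>(i,j). if i = j then \<alpha>p i else 0);
          R = 1 / Max (Rinv ` {..<n});
          \<Lambda>3 = R \<cdot>\<^sub>m 1\<^sub>m n;
          \<Lambda>4 = Matrix.mat n n (\<lambda>_. 1 / max 1 lam)
      in \<Lambda>1 + \<Lambda>2 + \<Lambda>3 + \<Lambda>4)"

definition weighted_inner :: "'a::euclidean_space set \<Rightarrow> nat \<Rightarrow> real mat \<Rightarrow>
    (nat \<Rightarrow> 'a \<Rightarrow> real) \<Rightarrow> (nat \<Rightarrow> 'a \<Rightarrow> real) \<Rightarrow> real" where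
  "weighted_inner \<Omega> n M p q =
     (\<Sum>i<n. l2_inner \<Omega> (\<lambda>x. \<Sum>j<n. M $$ (i, j) * p j x) (q i))"

definition DG_norm :: "(real^'d) set set \<Rightarrow> (real^'d \<Rightarrow> real^'d) \<Rightarrow> real" where
  "DG_norm \<T> u = sqrt (
      (\<Sum>K\<in>\<T>. l2_inner K (grad u) (grad u))
    + (\<Sum>e\<in>facets \<T>. inverse (diameter e) * facet_integral e (\<lambda>x. (norm (tangential_jump \<T> e u x))\<^sup>2))
    + (\<Sum>K\<in>\<T>. (diameter K)\<^sup>2 * h2_seminorm_sq K u))"

definition U_norm :: "(real^'d) set \<Rightarrow> (real^'d) set set \<Rightarrow> real \<Rightarrow> (real^'d \<Rightarrow> real^'d) \<Rightarrow> real" where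
  "U_norm \<Omega> \<T> lam u = sqrt ((DG_norm \<T> u)\<^sup>2 + lam * l2_inner \<Omega> (divg u) (divg u))"

text \<open>The matrix \<open>\<Lambda>\<close> is symmetric positive definite for all admissible parameters, so its inverse
  exists.\<close>

definition V_norm :: "(real^'d) set \<Rightarrow> nat \<Rightarrow> (nat \<Rightarrow> real) \<Rightarrow> real mat \<Rightarrow>
    (nat \<Rightarrow> real^'d \<Rightarrow> real^'d) \<Rightarrow> real" where
  "V_norm \<Omega> n Rinv \<Lambda> v = sqrt (
      (\<Sum>i<n. Rinv i * l2_inner \<Omega> (v i) (v i))
    + weighted_inner \<Omega> n (the (mat_inverse \<Lambda>)) (\<lambda>i. divg (v i)) (\<lambda>i. divg (v i)))"

definition P_norm :: "(real^'d) set \<Rightarrow> nat \<Rightarrow> real mat \<Rightarrow> (nat \<Rightarrow> real^'d \<Rightarrow> real) \<Rightarrow> real" where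
  "P_norm \<Omega> n \<Lambda> p = sqrt (weighted_inner \<Omega> n \<Lambda> p p)"

definition a_form :: "(real^'d) set set \<Rightarrow> real \<Rightarrow> (real^'d \<Rightarrow> real^'d) \<Rightarrow> (real^'d \<Rightarrow> real^'d) \<Rightarrow> real" where
  "a_form \<T> \<eta> u w =
      (\<Sum>K\<in>\<T>. l2_inner K (sym_grad u) (sym_grad w))
    - (\<Sum>e\<in>facets \<T>. facet_integral e (\<lambda>x. avg \<T> e (sym_grad u) x \<bullet> tangential_jump \<T> e w x))
    - (\<Sum>e\<in>facets \<T>. facet_integral e (\<lambda>x. avg \<T> e (sym_grad w) x \<bullet> tangential_jump \<T> e u x))
    + (\<Sum>e\<in>facets \<T>. facet_integral e
         (\<lambda>x. \<eta> * inverse (diameter e) * (tangential_jump \<T> e u x \<bullet> tangential_jump \<T> e w x)))"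

definition A_form :: "(real^'d) set \<Rightarrow> (real^'d) set set \<Rightarrow> real \<Rightarrow> nat \<Rightarrow> real \<Rightarrow> (nat \<Rightarrow> real) \<Rightarrow>
    (nat \<Rightarrow> real) \<Rightarrow> (nat \<Rightarrow> nat \<Rightarrow> real) \<Rightarrow>
    (real^'d \<Rightarrow> real^'d) \<times> (nat \<Rightarrow> real^'d \<Rightarrow> real^'d) \<times> (nat \<Rightarrow> real^'d \<Rightarrow> real) \<Rightarrow>
    (real^'d \<Rightarrow> real^'d) \<times> (nat \<Rightarrow> real^'d \<Rightarrow> real^'d) \<times> (nat \<Rightarrow> real^'d \<Rightarrow> real) \<Rightarrow> real" where
  "A_form \<Omega> \<T> \<eta> n lam Rinv \<alpha>p \<alpha> = (\<lambda>(u, v, p) (w, z, q).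
      a_form \<T> \<eta> u w + lam * l2_inner \<Omega> (divg u) (divg w)
    - (\<Sum>i<n. l2_inner \<Omega> (p i) (divg w))
    + (\<Sum>i<n. l2_inner \<Omega> (\<lambda>x. Rinv i *\<^sub>R v i x) (z i))
    - (\<Sum>i<n. l2_inner \<Omega> (p i) (divg (z i)))
    - (\<Sum>i<n. l2_inner \<Omega> (divg u) (q i))
    - (\<Sum>i<n. l2_inner \<Omega> (divg (v i)) (q i))
    + (\<Sum>i<n. (- \<alpha>p i - \<alpha> i i) * l2_inner \<Omega> (p i) (q i))
    + (\<Sum>i<n. \<Sum>j\<in>{..<n} - {i}. \<alpha> i j * l2_inner \<Omega> (p j) (q i)))"

end

theory Submission
  imports Defs "Jordan_Normal_Form.Determinant"
begin

no_notation vec_index (infixl "$" 100)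
no_notation scalar_prod (infix "\<bullet>" 70)

text \<open>All terms except \<open>a\<^sub>h\<close> follow from weighted Cauchy--Schwarz inequalities that hold
  pointwise in \<open>\<Omega>\<close> for vectors indexed by the networks: \<open>\<Lambda>\<close> dominates both the exchange part
  \<open>\<Lambda>\<^sub>1 + \<Lambda>\<^sub>2\<close> (a rescaled graph Laplacian plus a nonnegative diagonal) and the rank-one part
  \<open>\<Lambda>\<^sub>4\<close>, and the pairing of pressures with flux divergences is the duality between \<open>\<Lambda>\<close> and its
  inverse. No constant depends on \<open>n\<close>.

  For \<open>a\<^sub>h\<close> the only issue is to bound the averages of \<open>\<epsilon>(u)\<close> on a facet by the gradient on the adjacent
  elements. Along every segment, a value of a polynomial of degree at most \<open>l\<close> is a fixed combination
  of its values at \<open>l + 1\<close> points near the other end; averaging that end over a ball inscribed in \<open>K\<close>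
  bounds the maximum of \<open>|\<nabla>u|\<^sup>2\<close> over \<open>K\<close> by \<open>h\<^sub>K\<close> to the power \<open>-d\<close> times its integral, with a
  constant depending only on \<open>l\<close>, \<open>d\<close> and the shape regularity. Together with an elementary bound for
  the area of a facet this replaces the trace and inverse inequalities on a reference
  element.\<close>

section \<open>Cauchy--Schwarz estimates and quadratic forms\<close>

text \<open>The delicate point is the order of quantifiers: one constant must serve all meshes and
  all parameters. Nodes and weights of the extrapolation are therefore fixed, from l and the shape
  regularity alone, before any element appears. In the consistency terms Cauchy-Schwarz is split
  with the weights \<open>h_e\<close> and \<open>1/h_e\<close>. The gradient bound brings
  \<open>h_K\<close> to the power -d, and \<open>h_e\<close> times the area of e is at most a
  constant times \<open>h_K\<close> to the power d, so the powers of the mesh size cancel element by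
  element. A factor 1 + 2 \<open>h_K\<close>, due to the fixed height of the prisms, is absorbed by
  the diameter of the domain. The norm of U contains lambda times the squared norm of div u, whereas
  Lambda_4 asks for max(1, lambda) times it. The missing part is taken from the elementwise
  gradient, at the price of the dimension d. The final constant A + 2 d + 5 collects A from a_h, d
  from each of the two pairings of pressures with div u or div w, and 1 from each of the five other
  groups of terms.\<close>

text \<open>Cauchy--Schwarz bounds are stated as \<open>c\<^sup>2 \<le> a * b\<close>; the right-hand side of the
  equivalence below is linear in \<open>\<bar>c\<bar>\<close>, \<open>a\<close> and \<open>b\<close>, so they can be summed and integrated.\<close>

lemma square_le_mult_iff:
  fixes a b c :: real
  assumes "0 \<le> a" "0 \<le> b"
  shows "c\<^sup>2 \<le> a * b \<longleftrightarrow> (\<forall>t>0. 2 * \<bar>c\<bar> \<le> t * a + b / t)"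
proof
  assume c: "c\<^sup>2 \<le> a * b"
  show "\<forall>t>0. 2 * \<bar>c\<bar> \<le> t * a + b / t"
  proof (intro allI impI)
    fix t :: real assume t: "t > 0"
    have "(2 * \<bar>c\<bar>)\<^sup>2 \<le> 4 * ((t * a) * (b / t))" using c t by (simp add: power_mult_distrib)
    also have "\<dots> \<le> (t * a + b / t)\<^sup>2"
    proof -
      have "4 * (x * y) \<le> (x + y)\<^sup>2" for x y :: real
        using zero_le_power2[of "x - y"] unfolding power2_diff power2_sum by simp
      then show ?thesis .
    qed
    finally have "(2 * \<bar>c\<bar>)\<^sup>2 \<le> (t * a + b / t)\<^sup>2" .
    moreover have "0 \<le> t * a + b / t" using assms t by simp
    ultimately show "2 * \<bar>c\<bar> \<le> t * a + b / t" by (rule power2_le_imp_le)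
  qed
next
  assume *: "\<forall>t>0. 2 * \<bar>c\<bar> \<le> t * a + b / t"
  have "c\<^sup>2 \<le> (a + e) * (b + e)" if e: "e > 0" for e
  proof -
    \<comment> \<open>This t minimises t * (a + e) + (b + e) / t and makes the two summands equal.
      The shift by e > 0 keeps it defined and positive when a or b is 0; afterwards e tends to
      0.\<close>
    define t where "t = sqrt ((b + e) / (a + e))"
    have p: "a + e > 0" "b + e > 0" using assms e by auto
    have t: "t > 0" using p by (simp add: t_def)
    have t2: "t\<^sup>2 = (b + e) / (a + e)" using p by (simp add: t_def)
    have "2 * \<bar>c\<bar> \<le> t * a + b / t" using * t by blast
    also have "\<dots> \<le> t * (a + e) + (b + e) / t"
      using t e by (intro add_mono mult_left_mono divide_right_mono) auto
    also have "(b + e) / t = t * (a + e)"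
      using t2 t p by (simp add: field_simps power2_eq_square)
    finally have "\<bar>c\<bar> \<le> t * (a + e)" by simp
    then have "\<bar>c\<bar>\<^sup>2 \<le> (t * (a + e))\<^sup>2" by (intro power_mono) auto
    also have "\<dots> = (a + e) * (b + e)"
      using p by (simp add: power_mult_distrib t2) (simp add: power2_eq_square)
    finally show ?thesis by simp
  qed
  then have "\<forall>\<^sub>F e in at_right 0. c\<^sup>2 \<le> (a + e) * (b + e)"
    by (auto simp: eventually_at_right_less eventually_at_filter)
  moreover have "((\<lambda>e. (a + e) * (b + e)) \<longlongrightarrow> (a + 0) * (b + 0)) (at_right 0)"
    by (intro tendsto_intros)
  ultimately show "c\<^sup>2 \<le> a * b"
    using tendsto_lowerbound[of _ _ "at_right (0::real)" "c\<^sup>2"] by fastforce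
qed

lemma sum_square_le_mult:
  fixes a b c :: "'i \<Rightarrow> real"
  assumes "\<And>i. i \<in> A \<Longrightarrow> 0 \<le> a i" "\<And>i. i \<in> A \<Longrightarrow> 0 \<le> b i"
    and "\<And>i. i \<in> A \<Longrightarrow> (c i)\<^sup>2 \<le> a i * b i"
  shows "(sum c A)\<^sup>2 \<le> sum a A * sum b A"
proof -
  have "2 * \<bar>sum c A\<bar> \<le> t * sum a A + sum b A / t" if "t > 0" for t
  proof -
    have "2 * \<bar>sum c A\<bar> \<le> (\<Sum>i\<in>A. 2 * \<bar>c i\<bar>)" by (simp flip: sum_distrib_left)
    also have "\<dots> \<le> (\<Sum>i\<in>A. t * a i + b i / t)"
      using assms that square_le_mult_iff by (intro sum_mono) blast
    finally show ?thesis by (simp add: sum.distrib sum_distrib_left sum_divide_distrib)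
  qed
  then show ?thesis using assms by (subst square_le_mult_iff) (auto intro: sum_nonneg)
qed

text \<open>Integrability is asked of the majorants only: a c that is not integrable has integral 0
  by convention. Products of averages and jumps can thus be estimated without proving them
  measurable.\<close>

lemma integral_square_le_mult:
  fixes a b c :: "'a \<Rightarrow> real"
  assumes "integrable M a" "integrable M b"
    and "\<And>x. x \<in> space M \<Longrightarrow> 0 \<le> a x" "\<And>x. x \<in> space M \<Longrightarrow> 0 \<le> b x"
    and "\<And>x. x \<in> space M \<Longrightarrow> (c x)\<^sup>2 \<le> a x * b x"
  shows "(integral\<^sup>L M c)\<^sup>2 \<le> integral\<^sup>L M a * integral\<^sup>L M b"
proof (cases "integrable M c")
  case True
  have "2 * \<bar>integral\<^sup>L M c\<bar> \<le> t * integral\<^sup>L M a + integral\<^sup>L M b / t" if "t > 0" for t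
  proof -
    have "2 * \<bar>integral\<^sup>L M c\<bar> \<le> 2 * (\<integral>x. \<bar>c x\<bar> \<partial>M)" by simp
    also have "\<dots> = (\<integral>x. 2 * \<bar>c x\<bar> \<partial>M)" by simp
    also have "\<dots> \<le> (\<integral>x. t * a x + b x / t \<partial>M)"
      using assms that square_le_mult_iff True by (intro Bochner_Integration.integral_mono) auto
    finally show ?thesis using assms by simp
  qed
  then show ?thesis
    using assms by (subst square_le_mult_iff) (auto intro!: Bochner_Integration.integral_nonneg)
qed (use assms in \<open>auto simp: not_integrable_integral_eq intro!: mult_nonneg_nonneg
  Bochner_Integration.integral_nonneg\<close>)

text \<open>The last move in the estimate of a term: a and b are the parts of two squared norms that
  the term consumes.\<close>

lemma abs_le_mult_of_square_le:
  fixes a b c x y :: real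
  assumes "c\<^sup>2 \<le> a * b" "a \<le> x\<^sup>2" "b \<le> y\<^sup>2" "0 \<le> a" "0 \<le> b" "0 \<le> x" "0 \<le> y"
  shows "\<bar>c\<bar> \<le> x * y"
proof (rule power2_le_imp_le)
  have "a * b \<le> x\<^sup>2 * y\<^sup>2" using assms by (intro mult_mono) auto
  then show "\<bar>c\<bar>\<^sup>2 \<le> (x * y)\<^sup>2" using assms(1) by (simp add: power_mult_distrib)
qed (use assms in simp)

text \<open>Vectors are functions on the naturals, read below n, so that the values of a family of
  fields at a point can be inserted directly. Matrices remain those of the library, because
  \<Lambda> and its inverse are given as such.\<close>

definition bil :: "nat \<Rightarrow> real mat \<Rightarrow> (nat \<Rightarrow> real) \<Rightarrow> (nat \<Rightarrow> real) \<Rightarrow> real" where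
  "bil n M x y = (\<Sum>i<n. (\<Sum>j<n. M $$ (i, j) * x j) * y i)"

lemma bil_add: "A \<in> carrier_mat n n \<Longrightarrow> B \<in> carrier_mat n n \<Longrightarrow>
    bil n (A + B) x y = bil n A x y + bil n B x y"
  by (auto simp: bil_def algebra_simps sum.distrib sum_distrib_left intro!: sum.cong)

lemma bil_diff_scale:
  assumes "\<And>i j. i < n \<Longrightarrow> j < n \<Longrightarrow> M $$ (i, j) = M $$ (j, i)"
  shows "bil n M (\<lambda>i. x i - s * y i) (\<lambda>i. x i - s * y i) =
    bil n M x x - 2 * s * bil n M x y + s\<^sup>2 * bil n M y y"
proof -
  have sym: "bil n M y x = bil n M x y"
    unfolding bil_def sum_distrib_right
    by (subst sum.swap) (auto intro!: sum.cong simp: assms mult_ac)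
  have "bil n M (\<lambda>i. x i - s * y i) (\<lambda>i. x i - s * y i) =
     bil n M x x - s * bil n M x y - s * bil n M y x + s * s * bil n M y y"
    unfolding bil_def by (simp add: algebra_simps sum.distrib sum_subtractf sum_distrib_left)
  then show ?thesis by (simp add: sym power2_eq_square)
qed

lemma bil_Cauchy_Schwarz:
  assumes "\<And>i j. i < n \<Longrightarrow> j < n \<Longrightarrow> M $$ (i, j) = M $$ (j, i)"
    and pos: "\<And>x. 0 \<le> bil n M x x"
  shows "(bil n M x y)\<^sup>2 \<le> bil n M x x * bil n M y y"
proof -
  have "2 * \<bar>bil n M x y\<bar> \<le> t * bil n M x x + bil n M y y / t" if t: "t > 0" for t
  proof -
    \<comment> \<open>The signs s = 1 and s = -1 together give the absolute value. The inequality is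
      t times the form at x - (s/t) y being nonnegative, so semidefiniteness of M suffices, as it
      must for the exchange matrix.\<close>
    have "s * 2 * bil n M x y \<le> t * bil n M x x + bil n M y y / t" if "s\<^sup>2 = 1" for s
    proof -
      have "0 \<le> t * bil n M (\<lambda>i. x i - (s / t) * y i) (\<lambda>i. x i - (s / t) * y i)"
        using pos t by simp
      also have "\<dots> = t * (bil n M x x - 2 * (s / t) * bil n M x y + (s / t)\<^sup>2 * bil n M y y)"
        by (subst bil_diff_scale) (use assms(1) in auto)
      also have "\<dots> = t * bil n M x x - s * 2 * bil n M x y + s\<^sup>2 * bil n M y y / t"
        using t by (simp add: field_simps power2_eq_square)
      finally show ?thesis using that by simp
    qed
    from this[of 1] this[of "-1"] show ?thesis by auto
  qed
  then show ?thesis using pos by (simp add: square_le_mult_iff)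
qed

text \<open>A kernel vector annihilates the form and is therefore 0, so the determinant is nonzero
  and \<open>mat_inverse\<close> returns \<open>Some\<close>; only then does \<open>the\<close>
  denote an inverse.\<close>

lemma mat_inverse_posdef:
  assumes M: "M \<in> carrier_mat n n"
    and pos: "\<And>x. 0 \<le> bil n M x x"
    and def: "\<And>x. bil n M x x = 0 \<Longrightarrow> \<forall>i<n. x i = 0"
  shows "M * the (mat_inverse M) = 1\<^sub>m n" "the (mat_inverse M) \<in> carrier_mat n n"
proof -
  have "Determinant.det M \<noteq> 0"
  proof
    assume "Determinant.det M = 0"
    then obtain v where v: "v \<in> carrier_vec n" "v \<noteq> 0\<^sub>v n" "M *\<^sub>v v = 0\<^sub>v n"
      using det_0_iff_vec_prod_zero_field[OF M] by blast
    have "(\<Sum>j<n. M $$ (i, j) * vec_index v j) = 0" if "i < n" for i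
    proof -
      have "vec_index (M *\<^sub>v v) i = (\<Sum>j<n. M $$ (i, j) * vec_index v j)"
        using v(1) M that by (simp add: scalar_prod_def atLeast0LessThan)
      then show ?thesis using v(3) that by simp
    qed
    then have "bil n M (vec_index v) (vec_index v) = 0" by (simp add: bil_def)
    then have "v = 0\<^sub>v n" using def v by (intro eq_vecI) auto
    then show False using v by simp
  qed
  then have "M \<in> Units (ring_mat TYPE(real) n ())" by (rule det_non_zero_imp_unit[OF M])
  then have "mat_inverse M \<noteq> None" using mat_inverse(1)[OF M, of "()"] by blast
  then obtain B where "mat_inverse M = Some B" by blast
  then show "M * the (mat_inverse M) = 1\<^sub>m n" "the (mat_inverse M) \<in> carrier_mat n n"
    using mat_inverse(2)[OF M] by auto
qed

context
  fixes n :: nat and M N :: "real mat"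
  assumes Msym: "\<And>i j. i < n \<Longrightarrow> j < n \<Longrightarrow> M $$ (i, j) = M $$ (j, i)"
    and pos: "\<And>x. 0 \<le> bil n M x x"
    and inv: "M * N = 1\<^sub>m n" "M \<in> carrier_mat n n" "N \<in> carrier_mat n n"
begin

lemma right_inverse_apply:
  assumes "i < n"
  shows "(\<Sum>j<n. M $$ (i, j) * (\<Sum>k<n. N $$ (j, k) * s k)) = s i"
proof -
  have "(\<Sum>j<n. M $$ (i, j) * (\<Sum>k<n. N $$ (j, k) * s k)) = (\<Sum>k<n. (M * N) $$ (i, k) * s k)"
    unfolding sum_distrib_left
    by (subst sum.swap) (use inv(2,3) assms in
      \<open>auto intro!: sum.cong simp: scalar_prod_def atLeast0LessThan sum_distrib_left mult_ac\<close>)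
  also have "\<dots> = (\<Sum>k<n. if k = i then s i else 0)"
    unfolding inv(1) using assms by (intro sum.cong) auto
  finally show ?thesis using assms by simp
qed

text \<open>With x = N s one has M x = s, so both sides equal the pairing of s with x. This carries
  nonnegativity from M to N.\<close>

lemma bil_right_inverse:
  "bil n N s s = bil n M (\<lambda>j. \<Sum>k<n. N $$ (j, k) * s k) (\<lambda>j. \<Sum>k<n. N $$ (j, k) * s k)"
proof -
  have "bil n M (\<lambda>j. \<Sum>k<n. N $$ (j, k) * s k) (\<lambda>j. \<Sum>k<n. N $$ (j, k) * s k)
     = (\<Sum>i<n. s i * (\<Sum>k<n. N $$ (i, k) * s k))"
    unfolding bil_def by (intro sum.cong) (auto simp: right_inverse_apply)
  then show ?thesis by (simp add: bil_def mult.commute)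
qed

lemma bil_right_inverse_nonneg: "0 \<le> bil n N s s"
  unfolding bil_right_inverse by (rule pos)

text \<open>The pairing of p with s is the form of M between N s and p, to which Cauchy-Schwarz for
  M applies; the constant is 1 whatever n is.\<close>

lemma dual_Cauchy_Schwarz: "(\<Sum>i<n. p i * s i)\<^sup>2 \<le> bil n M p p * bil n N s s"
proof -
  have "(\<Sum>i<n. p i * s i) = bil n M (\<lambda>j. \<Sum>k<n. N $$ (j, k) * s k) p"
    unfolding bil_def by (intro sum.cong) (auto simp: right_inverse_apply)
  then show ?thesis
    unfolding bil_right_inverse
    by (simp only: mult.commute[of "bil n M p p"]) (rule bil_Cauchy_Schwarz; blast intro: Msym pos)
qed

end

text \<open>The energy of a weighted graph whose degrees are the row sums of \<beta>. Ordered pairs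
  count every edge twice, hence the division by 2.\<close>

lemma laplacian_quadratic_form:
  fixes \<beta> :: "nat \<Rightarrow> nat \<Rightarrow> real"
  assumes sym: "\<And>i j. i < n \<Longrightarrow> j < n \<Longrightarrow> i \<noteq> j \<Longrightarrow> \<beta> i j = \<beta> j i"
  shows "(\<Sum>i<n. (\<Sum>j\<in>{..<n} - {i}. \<beta> i j) * (y i)\<^sup>2 - (\<Sum>j\<in>{..<n} - {i}. \<beta> i j * y j) * y i)
    = (\<Sum>i<n. \<Sum>j\<in>{..<n} - {i}. \<beta> i j * (y i - y j)\<^sup>2) / 2"
proof -
  \<comment> \<open>The range of j depends on i, so the sums are exchanged in the form of
    \<open>sum.swap_restrict\<close>; the symmetry of \<beta> then restores the weights.\<close>
  have swap: "(\<Sum>i<n. \<Sum>j\<in>{..<n} - {i}. \<beta> i j * (y j)\<^sup>2) = (\<Sum>i<n. \<Sum>j\<in>{..<n} - {i}. \<beta> i j * (y i)\<^sup>2)"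
  proof -
    have "(\<Sum>i<n. \<Sum>j\<in>{..<n} - {i}. \<beta> i j * (y j)\<^sup>2)
      = (\<Sum>i<n. \<Sum>j | j \<in> {..<n} \<and> j \<noteq> i. \<beta> i j * (y j)\<^sup>2)"
      by (intro sum.cong) auto
    also have "\<dots> = (\<Sum>j<n. \<Sum>i | i \<in> {..<n} \<and> j \<noteq> i. \<beta> i j * (y j)\<^sup>2)"
      by (rule sum.swap_restrict) auto
    also have "\<dots> = (\<Sum>j<n. \<Sum>i\<in>{..<n} - {j}. \<beta> j i * (y j)\<^sup>2)"
      by (intro sum.cong) (auto simp: sym)
    finally show ?thesis .
  qed
  have "(\<Sum>i<n. \<Sum>j\<in>{..<n} - {i}. \<beta> i j * (y i - y j)\<^sup>2)
    = (\<Sum>i<n. \<Sum>j\<in>{..<n} - {i}. \<beta> i j * (y i)\<^sup>2) + (\<Sum>i<n. \<Sum>j\<in>{..<n} - {i}. \<beta> i j * (y j)\<^sup>2)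
      - 2 * (\<Sum>i<n. \<Sum>j\<in>{..<n} - {i}. \<beta> i j * y j * y i)"
    by (simp add: power2_diff algebra_simps sum.distrib sum_subtractf sum_distrib_left)
  also have "\<dots> = 2 * (\<Sum>i<n. (\<Sum>j\<in>{..<n} - {i}. \<beta> i j) * (y i)\<^sup>2 - (\<Sum>j\<in>{..<n} - {i}. \<beta> i j * y j) * y i)"
    unfolding swap sum_subtractf sum_distrib_right by (simp only: mult_2 right_diff_distrib)
  finally show ?thesis by simp
qed

section \<open>The parameter matrix\<close>

text \<open>This is Lambda_1 + Lambda_2. Up to the sign it is also the matrix of the
  pressure-pressure block of \<open>A_form\<close>, which links that block to the norm of the
  pressures.\<close>

definition exchange_mat :: "nat \<Rightarrow> (nat \<Rightarrow> real) \<Rightarrow> (nat \<Rightarrow> nat \<Rightarrow> real) \<Rightarrow> real mat" where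
  "exchange_mat n \<alpha>p \<alpha> = Matrix.mat n n (\<lambda>(i, j). if i = j then \<alpha>p i + \<alpha> i i else - \<alpha> i j)"

lemma exchange_mat_carrier: "exchange_mat n \<alpha>p \<alpha> \<in> carrier_mat n n"
  by (simp add: exchange_mat_def)

lemma bil_exchange_mat:
  "bil n (exchange_mat n \<alpha>p \<alpha>) x y =
    (\<Sum>i<n. (\<alpha>p i + \<alpha> i i) * (x i * y i)) - (\<Sum>i<n. \<Sum>j\<in>{..<n} - {i}. \<alpha> i j * (x j * y i))"
proof -
  have "(\<Sum>j<n. exchange_mat n \<alpha>p \<alpha> $$ (i, j) * x j) * y i
      = (\<alpha>p i + \<alpha> i i) * (x i * y i) - (\<Sum>j\<in>{..<n} - {i}. \<alpha> i j * (x j * y i))" if "i < n" for i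
  proof -
    have "(\<Sum>j<n. exchange_mat n \<alpha>p \<alpha> $$ (i, j) * x j)
       = exchange_mat n \<alpha>p \<alpha> $$ (i, i) * x i + (\<Sum>j\<in>{..<n} - {i}. exchange_mat n \<alpha>p \<alpha> $$ (i, j) * x j)"
      using that by (subst sum.remove[of _ i]) auto
    also have "(\<Sum>j\<in>{..<n} - {i}. exchange_mat n \<alpha>p \<alpha> $$ (i, j) * x j) = (\<Sum>j\<in>{..<n} - {i}. - (\<alpha> i j * x j))"
      using that by (intro sum.cong) (auto simp: exchange_mat_def)
    also have "\<dots> = - (\<Sum>j\<in>{..<n} - {i}. \<alpha> i j * x j)" by (rule sum_negf)
    finally show ?thesis
      using that by (simp add: exchange_mat_def left_diff_distrib sum_distrib_right mult.assoc)
  qed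
  then show ?thesis by (simp add: bil_def sum_subtractf)
qed

lemma Lambda_carrier: "Lambda n lam Rinv \<alpha>p \<alpha> \<in> carrier_mat n n"
  by (simp add: Lambda_def Let_def)

lemma Lambda_eq:
  "Lambda n lam Rinv \<alpha>p \<alpha> = exchange_mat n \<alpha>p \<alpha> + (1 / Max (Rinv ` {..<n})) \<cdot>\<^sub>m 1\<^sub>m n
     + Matrix.mat n n (\<lambda>_. 1 / max 1 lam)"
  by (rule eq_matI) (auto simp: Lambda_def exchange_mat_def Let_def)

lemma bil_Lambda:
  "bil n (Lambda n lam Rinv \<alpha>p \<alpha>) x y = bil n (exchange_mat n \<alpha>p \<alpha>) x y
     + 1 / Max (Rinv ` {..<n}) * (\<Sum>i<n. x i * y i) + (\<Sum>i<n. x i) * (\<Sum>i<n. y i) / max 1 lam"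
proof -
  have "(\<Sum>j<n. (r \<cdot>\<^sub>m 1\<^sub>m n) $$ (i, j) * x j) = r * x i" if "i < n" for i and r :: real
  proof -
    have "(\<Sum>j<n. (r \<cdot>\<^sub>m 1\<^sub>m n) $$ (i, j) * x j) = (\<Sum>j<n. if j = i then r * x i else 0)"
      using that by (intro sum.cong) auto
    then show ?thesis using that by simp
  qed
  then have "bil n (r \<cdot>\<^sub>m 1\<^sub>m n) x y = r * (\<Sum>i<n. x i * y i)" for r :: real
    by (simp add: bil_def sum_distrib_left mult.assoc)
  moreover have "bil n (Matrix.mat n n (\<lambda>_. c)) x y = c * ((\<Sum>i<n. x i) * (\<Sum>i<n. y i))" for c :: real
    by (simp add: bil_def sum_distrib_left sum_distrib_right mult.assoc)
  ultimately show ?thesis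
    unfolding Lambda_eq by (subst bil_add | simp add: exchange_mat_carrier)+
qed

context
  fixes n :: nat and lam \<tau> :: real and Rinv \<alpha>p b :: "nat \<Rightarrow> real" and \<alpha> \<beta> :: "nat \<Rightarrow> nat \<Rightarrow> real"
  assumes n: "n \<ge> 1" and Rinv: "\<forall>i<n. Rinv i > 0" and \<alpha>p: "\<forall>i<n. \<alpha>p i \<ge> 0"
    and \<tau>: "\<tau> > 0" and b: "\<forall>i<n. b i > 0"
    and \<beta>: "\<forall>i<n. \<forall>j<n. i \<noteq> j \<longrightarrow> \<beta> i j = \<beta> j i \<and> \<beta> i j \<ge> 0"
    and \<beta>_diag: "\<forall>i<n. \<beta> i i = (\<Sum>j\<in>{..<n} - {i}. \<beta> i j)"
    and \<alpha>: "\<alpha> = exchange \<tau> b \<beta>"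
begin

lemma exchange_mat_sym:
  assumes "i < n" "j < n"
  shows "exchange_mat n \<alpha>p \<alpha> $$ (i, j) = exchange_mat n \<alpha>p \<alpha> $$ (j, i)"
  using assms \<beta> by (auto simp: exchange_mat_def \<alpha> exchange_def mult.commute)

lemma Lambda_sym:
  assumes "i < n" "j < n"
  shows "Lambda n lam Rinv \<alpha>p \<alpha> $$ (i, j) = Lambda n lam Rinv \<alpha>p \<alpha> $$ (j, i)"
  using assms exchange_mat_sym[OF assms] exchange_mat_carrier[of n \<alpha>p \<alpha>] by (auto simp: Lambda_eq)

lemma bil_exchange_mat_nonneg: "0 \<le> bil n (exchange_mat n \<alpha>p \<alpha>) x x"
proof -
  \<comment> \<open>The rescaling removes the denominators \<open>b i * b j\<close> from \<alpha>,
    leaving \<tau> * \<beta>; the condition on the diagonal of \<beta> then says that the rows of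
    the exchange part sum to 0, as in a graph Laplacian.\<close>
  define y where "y i = x i / b i" for i
  have diag: "(\<alpha>p i + \<alpha> i i) * (x i * x i) = \<alpha>p i * (x i)\<^sup>2 + \<tau> * ((\<Sum>j\<in>{..<n} - {i}. \<beta> i j) * (y i)\<^sup>2)"
    if "i < n" for i
  proof -
    have "\<alpha> i i * (x i * x i) = \<tau> * (\<beta> i i * (y i)\<^sup>2)"
      by (simp add: \<alpha> exchange_def y_def power2_eq_square)
    then show ?thesis using \<beta>_diag that by (simp add: distrib_right power2_eq_square)
  qed
  have off: "\<alpha> i j * (x j * x i) = \<tau> * (\<beta> i j * y j * y i)" for i j
    by (simp add: \<alpha> exchange_def y_def mult_ac)
  have "bil n (exchange_mat n \<alpha>p \<alpha>) x x = (\<Sum>i<n. \<alpha>p i * (x i)\<^sup>2)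
     + \<tau> * (\<Sum>i<n. (\<Sum>j\<in>{..<n} - {i}. \<beta> i j) * (y i)\<^sup>2 - (\<Sum>j\<in>{..<n} - {i}. \<beta> i j * y j) * y i)"
    unfolding bil_exchange_mat
    by (simp add: diag off sum.distrib sum_subtractf right_diff_distrib sum_distrib_left sum_distrib_right)
  also have "\<dots> = (\<Sum>i<n. \<alpha>p i * (x i)\<^sup>2) + \<tau> * ((\<Sum>i<n. \<Sum>j\<in>{..<n} - {i}. \<beta> i j * (y i - y j)\<^sup>2) / 2)"
    using \<beta> by (subst laplacian_quadratic_form) auto
  also have "\<dots> \<ge> 0"
    using \<alpha>p \<tau> \<beta> by (intro add_nonneg_nonneg mult_nonneg_nonneg divide_nonneg_nonneg sum_nonneg) auto
  finally show ?thesis .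
qed

text \<open>All summands of \<Lambda> are semidefinite, so each bound drops some of them.
  Definiteness comes from R I alone: R is positive because n \<ge> 1 makes the maximum range over a
  nonempty set of positive numbers.\<close>

lemma bil_Lambda_ge:
  shows "bil n (exchange_mat n \<alpha>p \<alpha>) x x \<le> bil n (Lambda n lam Rinv \<alpha>p \<alpha>) x x"
    and "(\<Sum>i<n. x i)\<^sup>2 / max 1 lam \<le> bil n (Lambda n lam Rinv \<alpha>p \<alpha>) x x"
    and "0 \<le> bil n (Lambda n lam Rinv \<alpha>p \<alpha>) x x"
    and "bil n (Lambda n lam Rinv \<alpha>p \<alpha>) x x = 0 \<Longrightarrow> \<forall>i<n. x i = 0"
proof -
  have "{..<n} \<noteq> {}" using n by (simp add: lessThan_empty_iff)
  then have "Max (Rinv ` {..<n}) > 0" using Rinv by (subst Max_gr_iff) auto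
  then have R: "1 / Max (Rinv ` {..<n}) > 0" by simp
  have sq: "0 \<le> (\<Sum>i<n. x i * x i)" by (intro sum_nonneg) auto
  have R1: "0 \<le> 1 / Max (Rinv ` {..<n}) * (\<Sum>i<n. x i * x i)" using R sq by (intro mult_nonneg_nonneg) auto
  have S: "0 \<le> (\<Sum>i<n. x i) * (\<Sum>i<n. x i) / max 1 lam" by (intro divide_nonneg_nonneg) auto
  note E = bil_exchange_mat_nonneg[of x]
  show "bil n (exchange_mat n \<alpha>p \<alpha>) x x \<le> bil n (Lambda n lam Rinv \<alpha>p \<alpha>) x x"
    using R1 S unfolding bil_Lambda by linarith
  show "(\<Sum>i<n. x i)\<^sup>2 / max 1 lam \<le> bil n (Lambda n lam Rinv \<alpha>p \<alpha>) x x"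
    using R1 E unfolding bil_Lambda power2_eq_square by linarith
  show "0 \<le> bil n (Lambda n lam Rinv \<alpha>p \<alpha>) x x"
    using R1 S E unfolding bil_Lambda by linarith
  assume "bil n (Lambda n lam Rinv \<alpha>p \<alpha>) x x = 0"
  then have "1 / Max (Rinv ` {..<n}) * (\<Sum>i<n. x i * x i) = 0"
    using R1 S E unfolding bil_Lambda by linarith
  then have "(\<Sum>i<n. x i * x i) = 0" using R by (metis less_irrefl mult_eq_0_iff)
  then show "\<forall>i<n. x i = 0" by (subst (asm) sum_nonneg_eq_0_iff) auto
qed

text \<open>Applying Cauchy-Schwarz to the exchange form as a whole, and only then enlarging both
  factors, gives the constant 1; estimating the entries one at a time would bring in n.\<close>

lemma exchange_Cauchy_Schwarz:
  "(bil n (exchange_mat n \<alpha>p \<alpha>) x y)\<^sup>2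
     \<le> bil n (Lambda n lam Rinv \<alpha>p \<alpha>) x x * bil n (Lambda n lam Rinv \<alpha>p \<alpha>) y y"
proof -
  have "(bil n (exchange_mat n \<alpha>p \<alpha>) x y)\<^sup>2
     \<le> bil n (exchange_mat n \<alpha>p \<alpha>) x x * bil n (exchange_mat n \<alpha>p \<alpha>) y y"
    by (rule bil_Cauchy_Schwarz; blast intro: exchange_mat_sym bil_exchange_mat_nonneg)
  also have "\<dots> \<le> bil n (Lambda n lam Rinv \<alpha>p \<alpha>) x x * bil n (Lambda n lam Rinv \<alpha>p \<alpha>) y y"
    by (intro mult_mono bil_Lambda_ge bil_exchange_mat_nonneg)
  finally show ?thesis .
qed

lemmas Lambda_inverse = mat_inverse_posdef[OF Lambda_carrier bil_Lambda_ge(3) bil_Lambda_ge(4)]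

lemma Lambda_dual_Cauchy_Schwarz:
  "(\<Sum>i<n. p i * s i)\<^sup>2 \<le> bil n (Lambda n lam Rinv \<alpha>p \<alpha>) p p
     * bil n (the (mat_inverse (Lambda n lam Rinv \<alpha>p \<alpha>))) s s"
  by (rule dual_Cauchy_Schwarz; blast intro: Lambda_sym bil_Lambda_ge(3) Lambda_inverse Lambda_carrier)

lemma bil_Lambda_inverse_nonneg: "0 \<le> bil n (the (mat_inverse (Lambda n lam Rinv \<alpha>p \<alpha>))) s s"
  by (rule bil_right_inverse_nonneg; blast intro: Lambda_sym bil_Lambda_ge(3) Lambda_inverse Lambda_carrier)

end

section \<open>Extrapolation of polynomials and their gradients\<close>

lemma Lagrange_interpolation:
  fixes p :: "real poly"
  assumes T: "finite T" and deg: "degree p < card T"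
  shows "poly p x = (\<Sum>t\<in>T. (\<Prod>s\<in>T - {t}. (x - s) / (t - s)) * poly p t)"
proof -
  define q where "q = (\<Sum>t\<in>T. Polynomial.smult (poly p t) (\<Prod>s\<in>T - {t}. Polynomial.smult (1 / (t - s)) [:- s, 1:]))"
  have q: "poly q x = (\<Sum>t\<in>T. (\<Prod>s\<in>T - {t}. (x - s) / (t - s)) * poly p t)" for x
    by (simp add: q_def poly_sum poly_prod mult.commute diff_divide_distrib)
  have deg_basis: "degree (\<Prod>s\<in>T - {t}. Polynomial.smult (1 / (t - s)) [:- s, 1:]) \<le> card T - 1"
    if "t \<in> T" for t
  proof -
    have "degree (\<Prod>s\<in>T - {t}. Polynomial.smult (1 / (t - s)) [:- s, 1:])
        \<le> (\<Sum>s\<in>T - {t}. degree (Polynomial.smult (1 / (t - s)) [:- s, 1:]))"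
      using degree_prod_sum_le[of "T - {t}" "\<lambda>s. Polynomial.smult (1 / (t - s)) [:- s, 1:]"] T by (simp add: o_def)
    also have "\<dots> \<le> (\<Sum>s\<in>T - {t}. 1)" by (intro sum_mono) simp
    finally show ?thesis using T that by simp
  qed
  have "degree q \<le> card T - 1"
    unfolding q_def by (intro degree_sum_le T order_trans[OF degree_smult_le] deg_basis)
  \<comment> \<open>The premise on the degree of p also makes \<open>card T\<close> positive, so the
    truncated difference \<open>card T - 1\<close> is strictly smaller than
    \<open>card T\<close>.\<close>
  then have "degree (p - q) < card T"
    using deg by (intro le_less_trans[OF degree_diff_le[of p "card T - 1" q]]) auto
  moreover have "card T \<le> degree (p - q)" if "p \<noteq> q"
  proof -
    have "poly (p - q) y = 0" if y: "y \<in> T" for y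
    proof -
      have "poly q y = (\<Sum>t\<in>T. if t = y then poly p y else 0)"
        unfolding q
      proof (intro sum.cong refl)
        fix t assume t: "t \<in> T"
        show "(\<Prod>s\<in>T - {t}. (y - s) / (t - s)) * poly p t = (if t = y then poly p y else 0)"
        proof (cases "t = y")
          case True
          have "(\<Prod>s\<in>T - {y}. (y - s) / (y - s)) = 1" by (intro prod.neutral) auto
          then show ?thesis using True by simp
        next
          case False
          then have "(\<Prod>s\<in>T - {t}. (y - s) / (t - s)) = 0" using T y by (intro prod_zero) auto
          then show ?thesis using False by simp
        qed
      qed
      then show ?thesis using T y by simp
    qed
    then have "card T \<le> card {y. poly (p - q) y = 0}"
      using that by (intro card_mono poly_roots_finite) auto
    also have "\<dots> \<le> degree (p - q)" using that by (intro card_poly_roots_bound) simp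
    finally show ?thesis .
  qed
  ultimately have "p = q" by (metis not_le)
  then show ?thesis using q[of x] by (simp only:)
qed

text \<open>Extrapolation along every line with the same nodes and weights. In contrast to being
  a polynomial, this identity is visibly inherited by the derivative.\<close>

definition interpolates :: "real set \<Rightarrow> (real \<Rightarrow> real) \<Rightarrow> ('a::real_vector \<Rightarrow> 'b::real_vector) \<Rightarrow> bool" where
  "interpolates T w g \<longleftrightarrow> (\<forall>y z. g (y + z) = (\<Sum>t\<in>T. w t *\<^sub>R g (y + t *\<^sub>R z)))"

text \<open>The Lagrange basis polynomial of the node t, evaluated at 1, because y + z is the point
  with parameter 1 on the line through y in direction z.\<close>

definition lagrange_weight :: "real set \<Rightarrow> real \<Rightarrow> real" where
  "lagrange_weight T t = (\<Prod>s\<in>T - {t}. (1 - s) / (t - s))"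

lemma polys_interpolates:
  fixes f :: "real^'d \<Rightarrow> real"
  assumes f: "f \<in> polys k" and T: "finite T" "card T = Suc k"
  shows "interpolates T (lagrange_weight T) f"
  unfolding interpolates_def
proof (intro allI)
  fix y z :: "real^'d"
  obtain c where c: "f = (\<lambda>x. \<Sum>a | sum a UNIV \<le> k. c a * (\<Prod>i\<in>UNIV. (x $ i) ^ a i))"
    using f by (auto simp: polys_def)
  have mono: "(\<Prod>i\<in>UNIV. ((y + z) $ i) ^ a i)
      = (\<Sum>t\<in>T. lagrange_weight T t * (\<Prod>i\<in>UNIV. ((y + t *\<^sub>R z) $ i) ^ a i))"
    if a: "sum a UNIV \<le> k" for a :: "'d \<Rightarrow> nat"
  proof -
    \<comment> \<open>The monomial restricted to the line through y in direction z, as a univariate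
      polynomial. Its degree is at most k, one less than the number of nodes.\<close>
    define p where "p = (\<Prod>i\<in>UNIV. [:y $ i, z $ i:] ^ a i)"
    have p: "poly p t = (\<Prod>i\<in>UNIV. ((y + t *\<^sub>R z) $ i) ^ a i)" for t
      by (simp add: p_def poly_prod)
    have "degree p \<le> (\<Sum>i\<in>UNIV. degree ([:y $ i, z $ i:] ^ a i))"
      unfolding p_def using degree_prod_sum_le[of UNIV "\<lambda>i. [:y $ i, z $ i:] ^ a i"] by (simp add: o_def)
    also have "\<dots> \<le> sum a UNIV"
    proof (intro sum_mono)
      fix i
      have "degree ([:y $ i, z $ i:] ^ a i) \<le> degree [:y $ i, z $ i:] * a i" by (rule degree_power_le)
      also have "\<dots> \<le> 1 * a i" by (intro mult_right_mono) auto
      finally show "degree ([:y $ i, z $ i:] ^ a i) \<le> a i" by simp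
    qed
    finally have "degree p < card T" using a T by simp
    from Lagrange_interpolation[OF T(1) this, of 1] show ?thesis
      unfolding p lagrange_weight_def by simp
  qed
  have "f (y + z) = (\<Sum>a | sum a UNIV \<le> k. \<Sum>t\<in>T. lagrange_weight T t * (c a * (\<Prod>i\<in>UNIV. ((y + t *\<^sub>R z) $ i) ^ a i)))"
    unfolding c using mono by (intro sum.cong) (auto simp: sum_distrib_left mult_ac)
  also have "\<dots> = (\<Sum>t\<in>T. lagrange_weight T t *\<^sub>R f (y + t *\<^sub>R z))"
    unfolding c by (subst sum.swap) (simp add: sum_distrib_left)
  finally show "f (y + z) = (\<Sum>t\<in>T. lagrange_weight T t *\<^sub>R f (y + t *\<^sub>R z))" .
qed

lemma vec_polys_interpolates:
  fixes f :: "real^'d \<Rightarrow> real^'d"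
  assumes "f \<in> vec_polys k" "finite T" "card T = Suc k"
  shows "interpolates T (lagrange_weight T) f"
proof -
  have comp: "interpolates T (lagrange_weight T) (\<lambda>x. f x $ i)" for i
  proof (rule polys_interpolates)
    show "(\<lambda>x. f x $ i) \<in> polys k" using assms(1) by (simp add: vec_polys_def)
  qed (fact assms)+
  have "f (y + z) $ i = (\<Sum>t\<in>T. lagrange_weight T t *\<^sub>R f (y + t *\<^sub>R z)) $ i" for y z i
    using comp[of i, unfolded interpolates_def, rule_format, of y z] by simp
  then show ?thesis unfolding interpolates_def Finite_Cartesian_Product.vec_eq_iff by blast
qed

section \<open>Continuously differentiable representatives and the differentiated extrapolation
  identity\<close>

definition C1_fun :: "(real^'d \<Rightarrow> real) \<Rightarrow> bool" where
  "C1_fun f \<longleftrightarrow> (\<exists>G. (\<forall>x. (f has_derivative (\<lambda>h. G x \<bullet> h)) (at x)) \<and> continuous_on UNIV G)"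

text \<open>The Jacobian is carried as a continuous function on the whole space: a discrete function
  agrees with its polynomial only inside an element, so its own \<open>grad\<close> says nothing on
  the boundary.\<close>

definition C1_field :: "(real^'d \<Rightarrow> real^'d) \<Rightarrow> (real^'d \<Rightarrow> real^'d^'d) \<Rightarrow> bool" where
  "C1_field f J \<longleftrightarrow> (\<forall>x. (f has_derivative (\<lambda>h. J x *v h)) (at x)) \<and> continuous_on UNIV J"

lemma C1_fun_const: "C1_fun (\<lambda>x. c)"
  unfolding C1_fun_def
  by (intro exI[of _ "\<lambda>x. 0"] conjI allI has_derivative_eq_rhs[OF has_derivative_const]) auto

lemma C1_fun_component: "C1_fun (\<lambda>x. x $ i)"
  unfolding C1_fun_def
proof (intro exI conjI allI)
  show "((\<lambda>x. x $ i) has_derivative (\<lambda>h. axis i 1 \<bullet> h)) (at x)" for x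
    by (simp add: inner_axis' bounded_linear_imp_has_derivative bounded_linear_vec_nth)
qed (rule continuous_on_const)

lemma C1_fun_add: "C1_fun f \<Longrightarrow> C1_fun g \<Longrightarrow> C1_fun (\<lambda>x. f x + g x)"
  unfolding C1_fun_def
proof (elim exE conjE)
  fix F G assume *: "\<forall>x. (f has_derivative (\<lambda>h. F x \<bullet> h)) (at x)" "continuous_on UNIV F"
    "\<forall>x. (g has_derivative (\<lambda>h. G x \<bullet> h)) (at x)" "continuous_on UNIV G"
  show "\<exists>G. (\<forall>x. ((\<lambda>x. f x + g x) has_derivative (\<lambda>h. G x \<bullet> h)) (at x)) \<and> continuous_on UNIV G"
  proof (intro exI[of _ "\<lambda>x. F x + G x"] conjI allI)
    show "((\<lambda>x. f x + g x) has_derivative (\<lambda>h. (F x + G x) \<bullet> h)) (at x)" for x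
      using has_derivative_add[OF *(1)[rule_format] *(3)[rule_format], of x] by (simp add: inner_add_left)
  qed (intro continuous_intros *)
qed

lemma C1_fun_mult: "C1_fun f \<Longrightarrow> C1_fun g \<Longrightarrow> C1_fun (\<lambda>x. f x * g x)"
  unfolding C1_fun_def
proof (elim exE conjE)
  fix F G assume *: "\<forall>x. (f has_derivative (\<lambda>h. F x \<bullet> h)) (at x)" "continuous_on UNIV F"
    "\<forall>x. (g has_derivative (\<lambda>h. G x \<bullet> h)) (at x)" "continuous_on UNIV G"
  have c: "continuous_on UNIV f" "continuous_on UNIV g"
    using *(1,3) by (auto intro!: has_derivative_continuous_on)
  show "\<exists>G. (\<forall>x. ((\<lambda>x. f x * g x) has_derivative (\<lambda>h. G x \<bullet> h)) (at x)) \<and> continuous_on UNIV G"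
  proof (intro exI[of _ "\<lambda>x. f x *\<^sub>R G x + g x *\<^sub>R F x"] conjI allI)
    show "((\<lambda>x. f x * g x) has_derivative (\<lambda>h. (f x *\<^sub>R G x + g x *\<^sub>R F x) \<bullet> h)) (at x)" for x
      using has_derivative_mult[OF *(1)[rule_format] *(3)[rule_format], of x]
      by (simp add: inner_add_left mult.commute)
  qed (intro continuous_intros * c)
qed

lemma C1_fun_power: "C1_fun f \<Longrightarrow> C1_fun (\<lambda>x. f x ^ k)"
  by (induction k) (auto intro: C1_fun_const C1_fun_mult)

lemma C1_fun_prod: "(\<And>i. i \<in> A \<Longrightarrow> C1_fun (f i)) \<Longrightarrow> C1_fun (\<lambda>x. \<Prod>i\<in>A. f i x)"
  by (induction A rule: infinite_finite_induct) (auto intro: C1_fun_const C1_fun_mult)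

lemma C1_fun_sum: "(\<And>i. i \<in> A \<Longrightarrow> C1_fun (f i)) \<Longrightarrow> C1_fun (\<lambda>x. \<Sum>i\<in>A. f i x)"
  by (induction A rule: infinite_finite_induct) (auto intro: C1_fun_const C1_fun_add)

lemma polys_C1: "f \<in> polys k \<Longrightarrow> C1_fun f"
  unfolding polys_def
  by (auto intro!: C1_fun_sum C1_fun_mult C1_fun_prod C1_fun_power C1_fun_const C1_fun_component)

lemma C1_field_of_components:
  assumes "\<And>i. C1_fun (\<lambda>x. f x $ i)"
  shows "\<exists>J. C1_field f J"
proof -
  obtain G where G: "\<And>i x. ((\<lambda>x. f x $ i) has_derivative (\<lambda>h. G i x \<bullet> h)) (at x)"
    "\<And>i. continuous_on UNIV (G i)"
    using assms unfolding C1_fun_def by metis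
  define J where "J x = (\<chi> i. G i x)" for x
  have J: "(J x *v h) $ i = G i x \<bullet> h" for x h i
    by (simp add: J_def matrix_vector_mult_def inner_vec_def)
  have "(f has_derivative (\<lambda>h. J x *v h)) (at x)" for x
    unfolding has_derivative_componentwise_within[of f]
    using G(1) by (auto simp: Basis_vec_def inner_axis J)
  moreover have "continuous_on UNIV J"
    unfolding J_def by (intro continuous_on_vec_lambda G)
  ultimately show ?thesis unfolding C1_field_def by blast
qed

lemma vec_polys_C1: "f \<in> vec_polys k \<Longrightarrow> \<exists>J. C1_field f J"
  by (rule C1_field_of_components) (auto simp: vec_polys_def intro: polys_C1)

lemma RT_C1:
  assumes "f \<in> RT k K" shows "\<exists>J. C1_field f J"
proof (rule C1_field_of_components)
  fix i
  obtain g q where "g \<in> vec_polys k" "q \<in> polys k" "f = (\<lambda>x. g x + q x *\<^sub>R x)"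
    using assms by (auto simp: RT_def)
  then show "C1_fun (\<lambda>x. f x $ i)"
    by (auto simp: vec_polys_def intro!: C1_fun_add C1_fun_mult C1_fun_component intro: polys_C1)
qed

lemma sum_scaleR_matrix_vector_mult:
  fixes J :: "'i \<Rightarrow> real^'n^'m"
  shows "(\<Sum>t\<in>T. w t *\<^sub>R J t) *v h = (\<Sum>t\<in>T. w t *\<^sub>R (J t *v h))"
  by (induction T rule: infinite_finite_induct)
    (auto simp: matrix_vector_mult_add_rdistrib scaleR_matrix_vector_assoc)

text \<open>The identity is differentiated with respect to y, with z fixed. All base points are
  translates of y, so nodes and weights are unchanged; uniqueness of the derivative turns this into
  an identity between Jacobians.\<close>

lemma interpolates_derivative:
  assumes f: "interpolates T w f" and J: "C1_field f J"
  shows "interpolates T w J"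
  unfolding interpolates_def
proof (intro allI)
  fix y z
  have d: "((\<lambda>x. f (x + a)) has_derivative (\<lambda>h. J (y + a) *v h)) (at y)" for a
  proof -
    have "((\<lambda>x. x + a) has_derivative (\<lambda>h. h)) (at y)" by (auto intro!: derivative_eq_intros)
    moreover have "(f has_derivative (\<lambda>h. J (y + a) *v h)) (at (y + a))" using J by (simp add: C1_field_def)
    ultimately show ?thesis by (rule has_derivative_compose)
  qed
  have "((\<lambda>x. \<Sum>t\<in>T. w t *\<^sub>R f (x + t *\<^sub>R z)) has_derivative (\<lambda>h. \<Sum>t\<in>T. w t *\<^sub>R (J (y + t *\<^sub>R z) *v h))) (at y)"
    by (intro has_derivative_sum has_derivative_scaleR_right d)
  moreover have "(\<lambda>x. \<Sum>t\<in>T. w t *\<^sub>R f (x + t *\<^sub>R z)) = (\<lambda>x. f (x + z))"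
    using f unfolding interpolates_def by metis
  ultimately have "(\<lambda>h. J (y + z) *v h) = (\<lambda>h. \<Sum>t\<in>T. w t *\<^sub>R (J (y + t *\<^sub>R z) *v h))"
    using has_derivative_unique[OF d[of z]] by simp
  then show "J (y + z) = (\<Sum>t\<in>T. w t *\<^sub>R J (y + t *\<^sub>R z))"
    unfolding matrix_eq sum_scaleR_matrix_vector_mult by meson
qed

section \<open>Averages over an inscribed ball\<close>

lemma lborel_integral_affine:
  fixes F :: "'a::euclidean_space \<Rightarrow> real"
  assumes c: "c \<noteq> 0" and F: "integrable lborel F"
  shows "integrable lborel (\<lambda>y. F (a + c *\<^sub>R y))"
    and "integral\<^sup>L lborel F = \<bar>c\<bar> ^ DIM('a) * (\<integral>y. F (a + c *\<^sub>R y) \<partial>lborel)"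
proof -
  have [measurable]: "F \<in> borel_measurable borel" using F by auto
  have "integrable (density (distr lborel borel (\<lambda>x. a + c *\<^sub>R x)) (\<lambda>_. ennreal (\<bar>c\<bar> ^ DIM('a)))) F"
    using F lborel_affine[OF c, of a] by (simp add: ennreal_power)
  then have "integrable lborel (\<lambda>y. \<bar>c\<bar> ^ DIM('a) * F (a + c *\<^sub>R y))"
    by (subst (asm) integrable_density) (auto simp: integrable_distr_eq)
  then show "integrable lborel (\<lambda>y. F (a + c *\<^sub>R y))" using c by simp
  have "integral\<^sup>L lborel F = integral\<^sup>L (density (distr lborel borel (\<lambda>x. a + c *\<^sub>R x)) (\<lambda>_. ennreal (\<bar>c\<bar> ^ DIM('a)))) F"
    using lborel_affine[OF c, of a] by (simp add: ennreal_power)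
  also have "\<dots> = (\<integral>y. \<bar>c\<bar> ^ DIM('a) * F (a + c *\<^sub>R y) \<partial>lborel)"
    by (subst integral_density) (auto simp: integral_distr)
  finally show "integral\<^sup>L lborel F = \<bar>c\<bar> ^ DIM('a) * (\<integral>y. F (a + c *\<^sub>R y) \<partial>lborel)" by simp
qed

text \<open>The contraction of B towards x maps B into K and scales volumes by 1 - t to the power d.
  As t is at most 1/2, undoing it costs at most 2 to the power d, uniformly in t.\<close>

lemma average_le_integral:
  fixes x :: "'a::euclidean_space" and h :: "'a \<Rightarrow> real"
  assumes h: "continuous_on UNIV h" "\<And>y. 0 \<le> h y" and K: "compact K" and B: "compact B"
    and t: "0 \<le> t" "t \<le> 1 / 2" and BK: "\<And>y. y \<in> B \<Longrightarrow> t *\<^sub>R x + (1 - t) *\<^sub>R y \<in> K"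
  shows "(LINT y:B|lborel. h (t *\<^sub>R x + (1 - t) *\<^sub>R y)) \<le> 2 ^ DIM('a) * (LINT y:K|lborel. h y)"
proof -
  let ?\<phi> = "\<lambda>y. t *\<^sub>R x + (1 - t) *\<^sub>R y"
  have hs: "continuous_on S h" for S using h(1) continuous_on_subset by blast
  have iK: "integrable lborel (\<lambda>y. indicator K y *\<^sub>R h y)"
    using K hs[of K] by (rule borel_integrable_compact)
  have iB: "integrable lborel (\<lambda>y. indicator B y *\<^sub>R h (?\<phi> y))"
    using B by (rule borel_integrable_compact) (intro continuous_on_compose2[OF h(1)] continuous_intros subset_UNIV)
  have t': "1 - t \<noteq> 0" using t by simp
  note a = lborel_integral_affine[OF t' iK, of "t *\<^sub>R x"]
  have half: "(1/2) ^ DIM('a) \<le> \<bar>1 - t\<bar> ^ DIM('a)" using t by (intro power_mono) auto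
  have nn': "0 \<le> (\<integral>y. indicator K (?\<phi> y) *\<^sub>R h (?\<phi> y) \<partial>lborel)"
    using h(2) by (intro Bochner_Integration.integral_nonneg) simp
  have "(LINT y:B|lborel. h (?\<phi> y)) \<le> (\<integral>y. indicator K (?\<phi> y) *\<^sub>R h (?\<phi> y) \<partial>lborel)"
    unfolding set_lebesgue_integral_def using BK h(2)
    by (intro Bochner_Integration.integral_mono iB a(1)) (auto simp: indicator_def)
  also have "\<dots> = 2 ^ DIM('a) * ((1/2) ^ DIM('a) * (\<integral>y. indicator K (?\<phi> y) *\<^sub>R h (?\<phi> y) \<partial>lborel))"
    by (simp add: power_one_over)
  also have "\<dots> \<le> 2 ^ DIM('a) * (\<bar>1 - t\<bar> ^ DIM('a) * (\<integral>y. indicator K (?\<phi> y) *\<^sub>R h (?\<phi> y) \<partial>lborel))"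
    using half nn' by (intro mult_left_mono mult_right_mono) auto
  also have "\<dots> = 2 ^ DIM('a) * (LINT y:K|lborel. h y)"
    unfolding set_lebesgue_integral_def a(2) ..
  finally show ?thesis .
qed

lemma set_integral_lebesgue_eq_lborel:
  fixes h :: "'a::euclidean_space \<Rightarrow> real"
  assumes "continuous_on UNIV h" "compact K"
  shows "(LINT y:K|lebesgue. h y) = (LINT y:K|lborel. h y)"
proof -
  have "integrable lborel (\<lambda>y. indicator K y *\<^sub>R h y)"
    using assms continuous_on_subset by (intro borel_integrable_compact) blast+
  then show ?thesis unfolding set_lebesgue_integral_def by (intro integral_completion) auto
qed

text \<open>Averaging the extrapolation formula over the base points in a ball replaces the
  equivalence of norms on a space of polynomials, and makes the constant explicit.\<close>

lemma norm_le_L2_norm_of_interpolates: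
  fixes g :: "'a::euclidean_space \<Rightarrow> 'b::euclidean_space"
  assumes g: "continuous_on UNIV g" and T: "finite T" "T \<subseteq> {0..1 / (2 * \<rho>)}" and \<rho>: "\<rho> \<ge> 1"
    and int: "interpolates T w g" and K: "compact K" "cball c r \<subseteq> K" and r: "r > 0"
    and x: "dist c x \<le> \<rho> * r"
  shows "unit_ball_vol DIM('a) * r ^ DIM('a) * (norm (g x))\<^sup>2
    \<le> 4 ^ DIM('a) * (\<Sum>t\<in>T. (w t)\<^sup>2) * card T * (LINT y:K|lebesgue. (norm (g y))\<^sup>2)"
proof -
  \<comment> \<open>Half the radius leaves room for the pull towards x: the contraction moves the
    centre by at most t * \<rho> * r, which is at most r / 2, so the images of \<open>?B\<close>
    stay in the ball of radius r.\<close>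
  let ?B = "cball c (r / 2)" and ?W = "\<Sum>t\<in>T. (w t)\<^sup>2"
  let ?h = "\<lambda>y. (norm (g y))\<^sup>2" and ?I = "LINT y:K|lborel. (norm (g y))\<^sup>2"
  have h: "continuous_on UNIV ?h" using g by (intro continuous_intros)
  have iB: "set_integrable lborel ?B (\<lambda>y. ?h (t *\<^sub>R x + (1 - t) *\<^sub>R y))" for t
    unfolding set_integrable_def
    by (intro borel_integrable_compact continuous_on_compose2[OF h] continuous_intros subset_UNIV compact_cball)
  \<comment> \<open>The bound 1/2 on t controls the change of volume, the bound on t * \<rho> the
    displacement of the ball.\<close>
  have t: "0 \<le> t \<and> t \<le> 1 / 2 \<and> t * \<rho> \<le> 1 / 2" if "t \<in> T" for t
  proof -
    have "0 \<le> t" "t \<le> 1 / (2 * \<rho>)" using T that by auto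
    moreover have "1 / (2 * \<rho>) \<le> 1 / 2" using \<rho> by (simp add: field_simps)
    moreover have "t * \<rho> \<le> 1 / 2" using \<open>t \<le> 1 / (2 * \<rho>)\<close> \<rho> by (simp add: field_simps)
    ultimately show ?thesis by linarith
  qed
  \<comment> \<open>Extrapolation with z = x - y, followed by the discrete Cauchy-Schwarz
    inequality, which separates the weights from the values.\<close>
  have pt: "?h x \<le> ?W * (\<Sum>t\<in>T. ?h (t *\<^sub>R x + (1 - t) *\<^sub>R y))" for y
  proof -
    have "g x = (\<Sum>t\<in>T. w t *\<^sub>R g (t *\<^sub>R x + (1 - t) *\<^sub>R y))"
      using int[unfolded interpolates_def, rule_format, of y "x - y"]
      by (simp add: algebra_simps)
    then have "norm (g x) \<le> (\<Sum>t\<in>T. \<bar>w t\<bar> * \<bar>norm (g (t *\<^sub>R x + (1 - t) *\<^sub>R y))\<bar>)"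
      by (metis (no_types, lifting) abs_norm_cancel norm_scaleR norm_sum sum.cong)
    also have "\<dots> \<le> L2_set w T * L2_set (\<lambda>t. norm (g (t *\<^sub>R x + (1 - t) *\<^sub>R y))) T"
      by (rule L2_set_mult_ineq)
    finally have "?h x \<le> (L2_set w T * L2_set (\<lambda>t. norm (g (t *\<^sub>R x + (1 - t) *\<^sub>R y))) T)\<^sup>2"
      by (intro power_mono) auto
    also have "\<dots> = ?W * (\<Sum>t\<in>T. ?h (t *\<^sub>R x + (1 - t) *\<^sub>R y))"
      by (simp add: power_mult_distrib L2_set_def sum_nonneg)
    finally show ?thesis .
  qed
  have vol: "measure lborel ?B = unit_ball_vol DIM('a) * (r / 2) ^ DIM('a)"
    using r by (simp add: content_cball)
  have "measure lborel ?B * ?h x = (LINT y:?B|lborel. ?h x)"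
    by (simp add: set_lebesgue_integral_def)
  also have "\<dots> \<le> (LINT y:?B|lborel. ?W * (\<Sum>t\<in>T. ?h (t *\<^sub>R x + (1 - t) *\<^sub>R y)))"
  proof (rule set_integral_mono)
    show "set_integrable lborel ?B (\<lambda>y. ?h x)"
      unfolding set_integrable_def by (intro borel_integrable_compact continuous_on_const compact_cball)
    show "set_integrable lborel ?B (\<lambda>y. ?W * (\<Sum>t\<in>T. ?h (t *\<^sub>R x + (1 - t) *\<^sub>R y)))"
      unfolding set_integrable_def
      by (intro borel_integrable_compact continuous_intros continuous_on_compose2[OF h] subset_UNIV compact_cball)
  qed (rule pt)
  also have "\<dots> = ?W * (\<Sum>t\<in>T. (LINT y:?B|lborel. ?h (t *\<^sub>R x + (1 - t) *\<^sub>R y)))"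
  proof -
    have "(LINT y:?B|lborel. \<Sum>t\<in>T. ?h (t *\<^sub>R x + (1 - t) *\<^sub>R y))
        = (\<Sum>t\<in>T. (LINT y:?B|lborel. ?h (t *\<^sub>R x + (1 - t) *\<^sub>R y)))"
      unfolding set_lebesgue_integral_def scaleR_sum_right
      by (rule Bochner_Integration.integral_sum) (rule iB[unfolded set_integrable_def])
    then show ?thesis by simp
  qed
  also have "\<dots> \<le> ?W * (\<Sum>t\<in>T. 2 ^ DIM('a) * ?I)"
  proof (intro mult_left_mono sum_mono)
    fix s assume s: "s \<in> T"
    show "(LINT y:?B|lborel. ?h (s *\<^sub>R x + (1 - s) *\<^sub>R y)) \<le> 2 ^ DIM('a) * ?I"
    proof (rule average_le_integral[OF h])
      fix y assume y: "y \<in> ?B"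
      have "norm (s *\<^sub>R x + (1 - s) *\<^sub>R y - c) = norm (s *\<^sub>R (x - c) + (1 - s) *\<^sub>R (y - c))"
        by (simp add: algebra_simps)
      also have "\<dots> \<le> s * norm (x - c) + (1 - s) * norm (y - c)"
        using t[OF s] by (intro order_trans[OF norm_triangle_ineq]) auto
      also have "\<dots> \<le> s * (\<rho> * r) + 1 * (r / 2)"
        using t[OF s] x y r by (intro add_mono mult_mono mult_left_mono) (auto simp: dist_norm norm_minus_commute)
      also have "\<dots> \<le> r"
      proof -
        have "(s * \<rho>) * r \<le> 1 / 2 * r" using t[OF s] r by (intro mult_right_mono) auto
        then show ?thesis by (simp add: mult.assoc)
      qed
      finally show "s *\<^sub>R x + (1 - s) *\<^sub>R y \<in> K"
        using K(2) by (auto simp: dist_norm norm_minus_commute)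
    qed (use t[OF s] K in auto)
  qed (simp add: sum_nonneg)
  finally have "unit_ball_vol DIM('a) * (r / 2) ^ DIM('a) * ?h x \<le> ?W * (card T * (2 ^ DIM('a) * ?I))"
    unfolding vol by simp
  \<comment> \<open>One factor 2 to the power d comes from the contraction, a second from passing
    from the radius r / 2 to r; together they are the 4 to the power d of the claim.\<close>
  then have "2 ^ DIM('a) * (unit_ball_vol DIM('a) * (r / 2) ^ DIM('a) * ?h x)
      \<le> 2 ^ DIM('a) * (?W * (card T * (2 ^ DIM('a) * ?I)))"
    by (intro mult_left_mono) auto
  moreover have "(4::real) ^ DIM('a) = 2 ^ DIM('a) * 2 ^ DIM('a)"
    by (simp flip: power_mult_distrib)
  ultimately show ?thesis
    unfolding set_integral_lebesgue_eq_lborel[OF h K(1)] by (simp add: power_divide mult_ac)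
qed

section \<open>Simplices, facets and facet prisms\<close>

lemma full_simplex_basics:
  fixes K :: "'a::euclidean_space set"
  assumes K: "int DIM('a) simplex K"
  shows "compact K" "convex K" "aff_dim K = int DIM('a)" "interior K \<noteq> {}" "closure (interior K) = K"
proof -
  show cc: "compact K" "convex K" using K by (auto intro: compact_simplex convex_simplex)
  show ad: "aff_dim K = int DIM('a)" by (rule aff_dim_simplex[OF K])
  then have "K \<noteq> {}" by auto
  then have "rel_interior K \<noteq> {}" using cc(2) rel_interior_eq_empty by blast
  then show "interior K \<noteq> {}" using ad aff_dim_eq_full rel_interior_interior by metis
  then show "closure (interior K) = K"
    using convex_closure_interior[OF cc(2)] cc(1) by (simp add: compact_imp_closed)
qed

text \<open>A facet of a polyhedron is cut out by a supporting hyperplane. That hyperplane is the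
  whole affine hull, since both have dimension d - 1. Normalising makes orthogonal projection onto
  it explicit.\<close>

lemma facet_hyperplane:
  fixes K :: "'a::euclidean_space set"
  assumes K: "int DIM('a) simplex K" and e: "e facet_of K"
  obtains n c where "norm n = 1" "K \<subseteq> {x. n \<bullet> x \<le> c}" "e = K \<inter> {x. n \<bullet> x = c}"
    "affine hull e = {x. n \<bullet> x = c}"
proof -
  obtain a b where ab: "a \<noteq> 0" "K \<subseteq> {x. a \<bullet> x \<le> b}" "e = K \<inter> {x. a \<bullet> x = b}"
    using facet_of_polyhedron[OF simplex_imp_polyhedron[OF K] e] by blast
  define n c where "n = a /\<^sub>R norm a" and "c = b / norm a"
  have le: "n \<bullet> x \<le> c \<longleftrightarrow> a \<bullet> x \<le> b" and eq: "n \<bullet> x = c \<longleftrightarrow> a \<bullet> x = b" for x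
    using ab(1) by (auto simp: n_def c_def field_simps)
  have n: "norm n = 1" using ab(1) by (simp add: n_def)
  have sub: "affine hull e \<subseteq> {x. n \<bullet> x = c}"
    by (rule hull_minimal) (use ab(3) eq in \<open>auto simp: affine_hyperplane\<close>)
  have "aff_dim e = int DIM('a) - 1"
    using e full_simplex_basics(3)[OF K] by (simp add: facet_of_def)
  moreover have "n \<noteq> 0" using n by auto
  moreover have "e \<noteq> {}" using e by (simp add: facet_of_def)
  ultimately have "affine hull e = {x. n \<bullet> x = c}"
    using sub by (intro affine_dim_equal) (auto simp: affine_hyperplane)
  with n show ?thesis using ab(2,3) le eq by (intro that[of n c]) auto
qed

text \<open>\<open>outer_normal\<close> is a definite description, so uniqueness has to be proved. A
  second candidate m is constant on e, hence on its hyperplane, hence a multiple of n; the unit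
  length leaves n and -n.\<close>

lemma norm_outer_normal:
  fixes K :: "'a::euclidean_space set"
  assumes K: "int DIM('a) simplex K" and e: "e facet_of K"
  shows "norm (outer_normal K e) = 1"
proof -
  obtain n c where n: "norm n = 1" "K \<subseteq> {x. n \<bullet> x \<le> c}" "e = K \<inter> {x. n \<bullet> x = c}"
    "affine hull e = {x. n \<bullet> x = c}"
    using facet_hyperplane[OF K e] by blast
  obtain x0 where x0: "x0 \<in> e" using e by (auto simp: facet_of_def)
  let ?P = "\<lambda>n. norm n = 1 \<and> (\<forall>x\<in>e. \<forall>y\<in>K. n \<bullet> (y - x) \<le> 0)"
  have unique: "m = n" if m: "?P m" for m
  proof -
    have "e \<subseteq> {x. m \<bullet> x = m \<bullet> x0}"
    proof safe
      fix x assume x: "x \<in> e"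
      then have "m \<bullet> (x - x0) \<le> 0" "m \<bullet> (x0 - x) \<le> 0" using m x0 n(3) by blast+
      then show "m \<bullet> x = m \<bullet> x0" by (simp add: inner_diff_right)
    qed
    then have hull: "{x. n \<bullet> x = c} \<subseteq> {x. m \<bullet> x = m \<bullet> x0}"
      unfolding n(4)[symmetric] by (rule hull_minimal) (rule affine_hyperplane)
    have orth: "m \<bullet> v = 0" if "n \<bullet> v = 0" for v
    proof -
      have "x0 + v \<in> {x. n \<bullet> x = c}" using x0 n(3) that by (auto simp: inner_add_right)
      then have "m \<bullet> (x0 + v) = m \<bullet> x0" using hull by blast
      then show ?thesis by (simp add: inner_add_right)
    qed
    define s v where "s = m \<bullet> n" and "v = m - s *\<^sub>R n"
    have "n \<bullet> n = 1" using n(1) by (simp add: norm_eq_1)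
    then have nv: "n \<bullet> v = 0" by (simp add: v_def s_def inner_diff_right inner_commute)
    have "v \<bullet> v = m \<bullet> v - s * (n \<bullet> v)" by (simp add: v_def inner_diff_left)
    then have "v = 0" using nv orth[OF nv] by simp
    then have ms: "m = s *\<^sub>R n" by (simp add: v_def)
    then have "\<bar>s\<bar> = 1" using m n(1) by simp
    moreover have "s \<noteq> - 1"
    proof
      \<comment> \<open>Then K would lie on both sides of the hyperplane, that is, inside it, and
        could not have full dimension.\<close>
      assume "s = - 1"
      have "K \<subseteq> {x. n \<bullet> x = c}"
      proof
        fix y assume y: "y \<in> K"
        then have "m \<bullet> (y - x0) \<le> 0" using m x0 by blast
        then have "n \<bullet> y \<ge> n \<bullet> x0" using ms \<open>s = - 1\<close> by (simp add: inner_diff_right)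
        then show "y \<in> {x. n \<bullet> x = c}" using n(2,3) x0 y by force
      qed
      then have "aff_dim K \<le> aff_dim {x. n \<bullet> x = c}" by (rule aff_dim_subset)
      moreover have "n \<noteq> 0" using n(1) by auto
      ultimately show False using full_simplex_basics(3)[OF K] by simp
    qed
    ultimately show ?thesis using ms by (auto simp: abs_if split: if_splits)
  qed
  have "?P n" using n by (auto simp: inner_diff_right)
  then have "?P (THE n. ?P n)" by (rule theI) (rule unique)
  then show ?thesis unfolding outer_normal_def by (rule conjunct1)
qed

text \<open>Faces of a simplex are hulls of subsets of its d + 1 vertices. The crude count of all
  subsets is enough, because the bound has to depend on d only.\<close>

lemma card_facets_le:
  fixes K :: "'a::euclidean_space set"
  assumes K: "int DIM('a) simplex K"
  shows "card {e. e facet_of K} \<le> 2 ^ (DIM('a) + 1)"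
proof -
  obtain C where C: "\<not> affine_dependent C" "int (card C) = int DIM('a) + 1" "K = convex hull C"
    using K by (auto simp: simplex_def)
  have fin: "finite C" using C(1) by (rule aff_independent_finite)
  have "{e. e facet_of K} \<subseteq> (\<lambda>c. convex hull c) ` Pow C"
    using face_of_convex_hull_affine_independent[OF C(1)] by (auto simp: C(3) facet_of_def)
  then have "card {e. e facet_of K} \<le> card ((\<lambda>c. convex hull c) ` Pow C)"
    using fin by (intro card_mono) auto
  also have "\<dots> \<le> card (Pow C)" using fin by (intro card_image_le) simp
  finally have le: "card {e. e facet_of K} \<le> card (Pow C)" .
  have "card C = DIM('a) + 1" using C(2) by linarith
  then have "card (Pow C) = 2 ^ (DIM('a) + 1)" using fin by (simp only: card_Pow)
  then show ?thesis using le by simp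
qed

text \<open>From d \<ge> 2 on a facet has dimension at least 1 and so two distinct points; this
  makes the weight \<open>inverse (diameter e)\<close> meaningful.\<close>

lemma facet_diameter:
  fixes K :: "'a::euclidean_space set"
  assumes K: "int DIM('a) simplex K" and e: "e facet_of K" and dim: "DIM('a) \<ge> 2"
  shows "0 < diameter e" "diameter e \<le> diameter K"
proof -
  have bK: "bounded K" using full_simplex_basics(1)[OF K] by (rule compact_imp_bounded)
  have eK: "e \<subseteq> K" using e by (rule facet_of_imp_subset)
  show "diameter e \<le> diameter K" using eK bK by (rule diameter_subset)
  have "aff_dim e \<ge> 1" using e dim full_simplex_basics(3)[OF K] by (simp add: facet_of_def)
  obtain x y where "x \<in> e" "y \<in> e" "x \<noteq> y"
  proof -
    obtain x where x: "x \<in> e" using e by (auto simp: facet_of_def)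
    have "\<not> e \<subseteq> {x}"
      using \<open>aff_dim e \<ge> 1\<close> aff_dim_subset[of e "{x}"] by auto
    then show ?thesis using x that by blast
  qed
  moreover have "bounded e" using bK eK by (rule bounded_subset)
  ultimately show "0 < diameter e"
    using diameter_bounded_bound[of e x y] by (metis less_le_trans zero_less_dist_iff)
qed

text \<open>Instead of showing that the supremum is attained, a ball whose diameter 2 r exceeds half
  of it is taken; this is the origin of the factor 4.\<close>

lemma inball_of_shape_regular:
  fixes K :: "'a::euclidean_space set"
  assumes K: "compact K" "K \<noteq> {}" and pos: "0 < diameter K"
    and \<sigma>: "diameter K \<le> \<sigma> * inball_diameter K"
  obtains c r where "r > 0" "cball c r \<subseteq> K" "diameter K \<le> 4 * \<sigma> * r"
proof -
  let ?S = "{2 * r | r. 0 \<le> r \<and> (\<exists>c. cball c r \<subseteq> K)}"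
  obtain x where "x \<in> K" using K by blast
  \<comment> \<open>The degenerate ball makes the set nonempty, so that its supremum is a genuine
    one and nonnegative.\<close>
  then have "cball x 0 \<subseteq> K" by simp
  then have 0: "0 \<in> ?S" by force
  have bound: "s \<le> diameter K" if s: "s \<in> ?S" for s
  proof -
    obtain r c where r: "s = 2 * r" "0 \<le> r" "cball c r \<subseteq> K" using s by blast
    then have "diameter (cball c r) \<le> diameter K"
      by (intro diameter_subset compact_imp_bounded K)
    then show ?thesis using r by simp
  qed
  have bdd: "bdd_above ?S" by (rule bdd_aboveI) (rule bound)
  have "0 \<le> inball_diameter K" unfolding inball_diameter_def by (rule cSup_upper[OF 0 bdd])
  moreover have "0 < \<sigma> * inball_diameter K" using pos \<sigma> by linarith
  ultimately have p: "0 < inball_diameter K" "0 < \<sigma>" by (auto simp: zero_less_mult_iff)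
  then have "inball_diameter K / 2 < Sup ?S" by (simp add: inball_diameter_def)
  then obtain s where s: "s \<in> ?S" "inball_diameter K / 2 < s"
    using less_cSupD[of ?S] 0 by blast
  then obtain r c where r: "s = 2 * r" "0 \<le> r" "cball c r \<subseteq> K" by blast
  have "\<sigma> * inball_diameter K \<le> \<sigma> * (4 * r)" using p s r by (intro mult_left_mono) auto
  then have "diameter K \<le> 4 * \<sigma> * r" using \<sigma> by simp
  moreover have "r > 0" using p(1) s(2) r(1) by simp
  ultimately show ?thesis using r(3) that by blast
qed

section \<open>Prisms over facets and the area of a facet\<close>

lemma closest_point_hyperplane:
  assumes "norm n = 1"
  shows "closest_point {x. n \<bullet> x = c} x = x - (n \<bullet> x - c) *\<^sub>R n"
proof (rule closest_point_unique[symmetric])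
  have nn: "n \<bullet> n = 1" using assms by (simp add: norm_eq_1)
  show "x - (n \<bullet> x - c) *\<^sub>R n \<in> {x. n \<bullet> x = c}" by (simp add: inner_diff_right nn)
  show "\<forall>z\<in>{x. n \<bullet> x = c}. dist x (x - (n \<bullet> x - c) *\<^sub>R n) \<le> dist x z"
  proof safe
    fix z assume c: "c = n \<bullet> z"
    have "\<bar>n \<bullet> (x - z)\<bar> \<le> norm n * norm (x - z)" by (rule Cauchy_Schwarz_ineq2)
    then show "dist x (x - (n \<bullet> x - n \<bullet> z) *\<^sub>R n) \<le> dist x z"
      using assms by (simp add: dist_norm inner_diff_right)
  qed
qed (auto simp: convex_hyperplane closed_hyperplane)

lemma closest_point_in_facet_prism: "x \<in> facet_prism e \<Longrightarrow> closest_point (affine hull e) x \<in> e"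
  by (simp add: facet_prism_def)

lemma compact_facet_prism:
  assumes "compact e" "e \<noteq> {}"
  shows "compact (facet_prism e)"
proof -
  let ?p = "closest_point (affine hull e)"
  have cont: "continuous_on UNIV ?p"
    using assms by (intro continuous_on_closest_point affine_imp_convex affine_affine_hull closed_affine_hull) auto
  have "closed (?p -` e)"
    using continuous_closed_vimage[of e ?p] cont assms(1)
    by (auto simp: continuous_on_eq_continuous_at compact_imp_closed)
  moreover have "closed {x. dist x (?p x) \<le> 1/2}"
    by (intro closed_Collect_le continuous_intros cont)
  moreover have "facet_prism e = ?p -` e \<inter> {x. dist x (?p x) \<le> 1/2}" by (auto simp: facet_prism_def)
  ultimately have "closed (facet_prism e)" by auto
  moreover have "bounded (facet_prism e)"
  proof -
    obtain B where B: "\<And>y. y \<in> e \<Longrightarrow> norm y \<le> B"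
      using compact_imp_bounded[OF assms(1)] by (auto simp: bounded_iff)
    have "norm x \<le> B + 1/2" if "x \<in> facet_prism e" for x
    proof -
      have "norm (?p x) \<le> B" "norm (x - ?p x) \<le> 1/2"
        using that B by (auto simp: facet_prism_def dist_norm)
      then show ?thesis using norm_triangle_sub[of x "?p x"] by linarith
    qed
    then show ?thesis by (auto simp: bounded_iff)
  qed
  ultimately show ?thesis by (simp add: compact_eq_bounded_closed)
qed

text \<open>The prism has height 1, so about \<open>1/h\<close> balls of radius \<open>2h\<close> cover it.\<close>

lemma facet_prism_measure_le:
  fixes K :: "'a::euclidean_space set"
  assumes K: "int DIM('a) simplex K" and e: "e facet_of K" and dim: "DIM('a) \<ge> 2"
  defines "h \<equiv> diameter K"
  shows "diameter e * measure lebesgue (facet_prism e) \<le> (1 + 2 * h) * (unit_ball_vol DIM('a) * (2 * h) ^ DIM('a))"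
proof -
  obtain n c where n: "norm n = 1" "affine hull e = {x. n \<bullet> x = c}" "e = K \<inter> {x. n \<bullet> x = c}"
    using facet_hyperplane[OF K e] by metis
  obtain x0 where x0: "x0 \<in> e" using e by (auto simp: facet_of_def)
  have ce: "compact e"
    unfolding n(3) using full_simplex_basics(1)[OF K] by (intro compact_Int_closed closed_hyperplane)
  have bK: "bounded K" using full_simplex_basics(1)[OF K] by (rule compact_imp_bounded)
  have h: "0 < h" "diameter e \<le> h" "0 < diameter e"
    using facet_diameter[OF K e dim] unfolding h_def by linarith+
  \<comment> \<open>The spacing 1/N of the layers is at most h, while rounding up adds less than one
    layer to 1/h.\<close>
  define N where "N = nat \<lceil>1 / h\<rceil>"
  have N: "1 / h \<le> real N" "real N \<le> 1 / h + 1" "0 < real N"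
  proof -
    have "0 < \<lceil>1 / h\<rceil>" using h(1) by simp
    then have "real N = of_int \<lceil>1 / h\<rceil>" "0 < real N" by (simp_all add: N_def)
    then show "1 / h \<le> real N" "real N \<le> 1 / h + 1" "0 < real N" by linarith+
  qed
  have N': "1 / real N \<le> h" using N(1,3) h(1) by (simp add: field_simps)
  \<comment> \<open>The centres lie on the normal line through x0, at heights from -1/2 to 1/2. Of
    the radius 2 h, one h covers the distance within e and one the distance to the chosen
    height.\<close>
  define b where "b j = cball (x0 + (real j / real N - 1/2) *\<^sub>R n) (2 * h)" for j :: nat
  have sub: "facet_prism e \<subseteq> (\<Union>j\<in>{..N}. b j)"
  proof
    fix x assume x: "x \<in> facet_prism e"
    define s y where "s = n \<bullet> x - c" and "y = x - s *\<^sub>R n"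
    have y: "y \<in> e" "dist x y \<le> 1/2"
      using x by (auto simp: facet_prism_def n(2) closest_point_hyperplane[OF n(1)] y_def s_def)
    have s: "- (1/2) \<le> s" "s \<le> 1/2" using y(2) n(1) by (auto simp: y_def dist_norm)
    \<comment> \<open>The last layer not above x. At the top s = 1/2 the index is N, which is why N
      + 1 balls are used.\<close>
    define j where "j = nat \<lfloor>(s + 1/2) * N\<rfloor>"
    have "0 \<le> (s + 1/2) * N" using s by simp
    then have "real j = of_int \<lfloor>(s + 1/2) * N\<rfloor>" by (simp add: j_def)
    then have j: "real j \<le> (s + 1/2) * N" "(s + 1/2) * N \<le> real j + 1" by linarith+
    have "(s + 1/2) * N \<le> 1 * real N" using s by (intro mult_right_mono) auto
    then have jN: "j \<in> {..N}" using j(1) by simp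
    have "real j / real N \<le> s + 1/2" "s + 1/2 \<le> real j / real N + 1 / real N"
      using j N(3) by (simp_all add: divide_le_eq add_divide_distrib[symmetric] le_divide_eq)
    then have sj: "\<bar>s - (real j / real N - 1/2)\<bar> \<le> h" using N' by linarith
    have "dist (x0 + (real j / real N - 1/2) *\<^sub>R n) x
        = norm ((y - x0) + (s - (real j / real N - 1/2)) *\<^sub>R n)"
      by (simp add: dist_norm y_def norm_minus_commute algebra_simps)
    also have "\<dots> \<le> norm (y - x0) + \<bar>s - (real j / real N - 1/2)\<bar>"
      using n(1) norm_triangle_ineq[of "y - x0" "(s - (real j / real N - 1/2)) *\<^sub>R n"] by simp
    also have "norm (y - x0) \<le> h"
      unfolding h_def dist_norm[symmetric]
      using y(1) x0 n(3) by (intro diameter_bounded_bound bK) auto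
    finally have "x \<in> b j" using sj by (simp add: b_def)
    then show "x \<in> (\<Union>j\<in>{..N}. b j)" using jN by blast
  qed
  have bm: "b j \<in> lmeasurable" for j unfolding b_def by (intro lmeasurable_compact compact_cball)
  have bv: "measure lebesgue (b j) = unit_ball_vol DIM('a) * (2 * h) ^ DIM('a)" for j
    unfolding b_def using h(1) by (simp add: measure_completion content_cball)
  have "measure lebesgue (facet_prism e) \<le> measure lebesgue (\<Union>j\<in>{..N}. b j)"
  proof (rule measure_mono_fmeasurable[OF sub])
    show "facet_prism e \<in> sets lebesgue"
      using compact_facet_prism[OF ce] x0 by (intro fmeasurableD lmeasurable_compact) auto
    show "(\<Union>j\<in>{..N}. b j) \<in> lmeasurable" using bm by (intro fmeasurable.finite_UN) auto
  qed
  also have "\<dots> \<le> (\<Sum>j\<in>{..N}. measure lebesgue (b j))"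
    using bm by (intro measure_UNION_le) auto
  also have "\<dots> = (real N + 1) * (unit_ball_vol DIM('a) * (2 * h) ^ DIM('a))"
    by (simp add: bv add.commute)
  finally have m: "measure lebesgue (facet_prism e) \<le> (real N + 1) * (unit_ball_vol DIM('a) * (2 * h) ^ DIM('a))" .
  have V: "0 \<le> unit_ball_vol DIM('a) * (2 * h) ^ DIM('a)" using h(1) by simp
  have "diameter e * measure lebesgue (facet_prism e)
      \<le> h * ((real N + 1) * (unit_ball_vol DIM('a) * (2 * h) ^ DIM('a)))"
    using h m by (intro mult_mono) auto
  also have "\<dots> = (h * (real N + 1)) * (unit_ball_vol DIM('a) * (2 * h) ^ DIM('a))" by (simp only: mult.assoc)
  also have "\<dots> \<le> (1 + 2 * h) * (unit_ball_vol DIM('a) * (2 * h) ^ DIM('a))"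
  proof (rule mult_right_mono[OF _ V])
    have "h * (real N + 1) \<le> h * (1 / h + 2)" using h(1) N(2) by (intro mult_left_mono) auto
    then show "h * (real N + 1) \<le> 1 + 2 * h" using h(1) by (simp add: distrib_left)
  qed
  finally show ?thesis .
qed

section \<open>Integrals and traces of elementwise smooth functions\<close>

lemma l2_inner_eq_lebesgue_on:
  "S \<in> sets lebesgue \<Longrightarrow> l2_inner S f g = (\<integral>x. f x \<bullet> g x \<partial>lebesgue_on S)"
  unfolding l2_inner_def set_lebesgue_integral_def by (simp add: integral_restrict_space)

lemma l2_inner_self: "l2_inner S f f = (LINT x:S|lebesgue. (norm (f x))\<^sup>2)"
  by (simp add: l2_inner_def dot_square_norm)

lemma l2_inner_self_nonneg: "0 \<le> l2_inner S f f"
  unfolding l2_inner_def set_lebesgue_integral_def by (rule Bochner_Integration.integral_nonneg) simp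

lemma square_integrable_product:
  assumes f: "square_integrable S f" and g: "square_integrable S g"
  shows "integrable (lebesgue_on S) (\<lambda>x. f x \<bullet> g x)"
proof (rule Bochner_Integration.integrable_bound)
  show "integrable (lebesgue_on S) (\<lambda>x. (norm (f x))\<^sup>2 + (norm (g x))\<^sup>2)"
    using f g by (intro Bochner_Integration.integrable_add) (auto simp: square_integrable_def)
  show "(\<lambda>x. f x \<bullet> g x) \<in> borel_measurable (lebesgue_on S)"
    using f g by (intro borel_measurable_inner) (auto simp: square_integrable_def)
  have "\<bar>f x \<bullet> g x\<bar> \<le> (norm (f x))\<^sup>2 + (norm (g x))\<^sup>2" for x
  proof -
    have "\<bar>f x \<bullet> g x\<bar> \<le> norm (f x) * norm (g x)" by (rule Cauchy_Schwarz_ineq2)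
    also have "\<dots> \<le> (norm (f x))\<^sup>2 + (norm (g x))\<^sup>2"
      using sum_squares_bound[of "norm (f x)" "norm (g x)"]
        mult_nonneg_nonneg[OF norm_ge_zero[of "f x"] norm_ge_zero[of "g x"]]
      unfolding mult.assoc by linarith
    finally show ?thesis .
  qed
  then show "AE x in lebesgue_on S. norm (f x \<bullet> g x) \<le> norm ((norm (f x))\<^sup>2 + (norm (g x))\<^sup>2)"
    by (intro AE_I2) (simp add: abs_le_D1)
qed

lemma set_integrable_continuous_compact:
  fixes h :: "'a::euclidean_space \<Rightarrow> real"
  assumes "compact K" "continuous_on K h"
  shows "set_integrable lebesgue K h"
proof -
  have i: "integrable lborel (\<lambda>x. indicator K x *\<^sub>R h x)" using assms by (rule borel_integrable_compact)
  then have "(\<lambda>x. indicator K x *\<^sub>R h x) \<in> borel_measurable lborel" by (rule borel_measurable_integrable)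
  from integrable_completion[OF this] i show ?thesis unfolding set_integrable_def by blast
qed

text \<open>The frontier of a convex set is negligible, so arbitrary values of h there are harmless.
  The detour through \<open>integral\<close> gives access to the spike rules.\<close>

lemma integral_on_full_simplex:
  fixes K :: "'a::euclidean_space set" and h H :: "'a \<Rightarrow> real"
  assumes K: "int DIM('a) simplex K" and H: "continuous_on UNIV H"
    and hH: "\<And>x. x \<in> interior K \<Longrightarrow> h x = H x"
  shows "set_integrable lebesgue K h" "(LINT x:K|lebesgue. h x) = (LINT x:K|lebesgue. H x)"
proof -
  note basics = full_simplex_basics[OF K]
  have neg: "negligible (frontier K)" using basics(2) by (rule negligible_convex_frontier)
  have eq: "h x = H x" if "x \<in> K - frontier K" for x
    using that hH closure_subset[of K] by (auto simp: frontier_def)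
  have H': "set_integrable lebesgue K H"
    using basics(1) H continuous_on_subset by (blast intro: set_integrable_continuous_compact)
  show h': "set_integrable lebesgue K h" using absolutely_integrable_spike[OF H' neg eq] .
  have "integral K H = integral K h" by (rule integral_spike[OF neg]) (rule eq)
  then show "(LINT x:K|lebesgue. h x) = (LINT x:K|lebesgue. H x)"
    using set_lebesgue_integral_eq_integral(2)[OF h'] set_lebesgue_integral_eq_integral(2)[OF H'] by simp
qed

lemma set_integrable_finite_Union:
  fixes h :: "'a::euclidean_space \<Rightarrow> real"
  assumes "finite \<T>" "\<And>K. K \<in> \<T> \<Longrightarrow> K \<in> sets lebesgue" "\<And>K. K \<in> \<T> \<Longrightarrow> set_integrable lebesgue K h"
  shows "set_integrable lebesgue (\<Union>\<T>) h"
  using assms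
proof (induction \<T>)
  case (insert K \<T>)
  have "set_integrable lebesgue (K \<union> \<Union>\<T>) h"
    using insert by (intro set_integrable_Un sets.finite_Union) auto
  then show ?case by simp
qed (simp add: set_integrable_def)

text \<open>For nonnegative h the indicator of \<Omega> is at most the sum of the indicators of the
  covering elements; the bound follows without discussing how elements overlap.\<close>

lemma integral_on_mesh:
  fixes \<Omega> :: "'a::euclidean_space set" and h :: "'a \<Rightarrow> real"
  assumes \<T>: "simplicial_mesh \<Omega> \<T>" and \<Omega>: "open \<Omega>"
    and h: "\<And>K. K \<in> \<T> \<Longrightarrow> \<exists>H. continuous_on UNIV H \<and> (\<forall>x\<in>interior K. h x = H x)"
  shows "set_integrable lebesgue \<Omega> h"
    and "(\<And>x. 0 \<le> h x) \<Longrightarrow> (LINT x:\<Omega>|lebesgue. h x) \<le> (\<Sum>K\<in>\<T>. LINT x:K|lebesgue. h x)"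
proof -
  have fin: "finite \<T>" and simp: "\<And>K. K \<in> \<T> \<Longrightarrow> int DIM('a) simplex K" and cover: "\<Union>\<T> = closure \<Omega>"
    using \<T> by (auto simp: simplicial_mesh_def triangulation_def)
  have meas: "K \<in> sets lebesgue" if "K \<in> \<T>" for K
    using full_simplex_basics(1)[OF simp[OF that]] by (intro lmeasurable_compact fmeasurableD)
  have int: "set_integrable lebesgue K h" if K: "K \<in> \<T>" for K
  proof -
    obtain H where "continuous_on UNIV H" "\<forall>x\<in>interior K. h x = H x" using h[OF K] by blast
    then show ?thesis using integral_on_full_simplex(1)[OF simp[OF K], of H h] by blast
  qed
  have sub: "\<Omega> \<subseteq> \<Union>\<T>" unfolding cover by (rule closure_subset)
  have "set_integrable lebesgue (\<Union>\<T>) h" using fin meas int by (rule set_integrable_finite_Union)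
  then show \<Omega>h: "set_integrable lebesgue \<Omega> h"
    by (rule set_integrable_subset) (use \<Omega> sub in auto)
  assume pos: "\<And>x. 0 \<le> h x"
  have pw: "indicator \<Omega> x *\<^sub>R h x \<le> (\<Sum>K\<in>\<T>. indicator K x *\<^sub>R h x)" for x
  proof (cases "x \<in> \<Omega>")
    case True
    then obtain K where K: "K \<in> \<T>" "x \<in> K" using sub by blast
    have "indicator K x *\<^sub>R h x \<le> (\<Sum>K\<in>\<T>. indicator K x *\<^sub>R h x)"
      using fin K(1) pos by (intro member_le_sum) auto
    then show ?thesis using True K(2) by simp
  qed (use pos in \<open>auto intro!: sum_nonneg\<close>)
  have "(LINT x:\<Omega>|lebesgue. h x) \<le> (\<integral>x. (\<Sum>K\<in>\<T>. indicator K x *\<^sub>R h x) \<partial>lebesgue)"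
    unfolding set_lebesgue_integral_def
    using \<Omega>h int pw unfolding set_integrable_def
    by (intro Bochner_Integration.integral_mono Bochner_Integration.integrable_sum)
  also have "\<dots> = (\<Sum>K\<in>\<T>. LINT x:K|lebesgue. h x)"
    unfolding set_lebesgue_integral_def
    using int unfolding set_integrable_def by (intro Bochner_Integration.integral_sum)
  finally show "(LINT x:\<Omega>|lebesgue. h x) \<le> (\<Sum>K\<in>\<T>. LINT x:K|lebesgue. h x)" .
qed

text \<open>K is the closure of its interior, so every point of K is a limit point of the interior;
  the limit is then unique and \<open>Lim\<close> returns it.\<close>

lemma elem_trace_eq:
  fixes K :: "'a::euclidean_space set"
  assumes K: "int DIM('a) simplex K" and x: "x \<in> K" and G: "continuous_on UNIV G"
    and gG: "\<And>y. y \<in> interior K \<Longrightarrow> g y = G y"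
  shows "elem_trace K g x = G x"
proof -
  have "x islimpt interior K"
  proof (cases "x \<in> interior K")
    case True
    then show ?thesis by (intro open_imp_islimpt open_interior)
  next
    case False
    then show ?thesis using x full_simplex_basics(5)[OF K] by (auto simp: closure_def)
  qed
  then have nt: "at x within interior K \<noteq> bot" by (simp add: trivial_limit_within)
  have "(G \<longlongrightarrow> G x) (at x within interior K)"
    using G by (meson UNIV_I continuous_on_def subset_UNIV tendsto_within_subset)
  then have "(g \<longlongrightarrow> G x) (at x within interior K)"
    by (rule Lim_transform_eventually) (auto simp: eventually_at_filter gG)
  then show ?thesis unfolding elem_trace_def using nt by (intro tendsto_Lim)
qed

lemma grad_eq:
  assumes J: "C1_field f J" and x: "x \<in> interior K" and uf: "\<And>y. y \<in> interior K \<Longrightarrow> u y = f y"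
  shows "grad u x = J x"
proof -
  have "(f has_derivative (\<lambda>h. J x *v h)) (at x)" using J by (simp add: C1_field_def)
  then have "(u has_derivative (\<lambda>h. J x *v h)) (at x)"
    by (rule has_derivative_transform_within_open[OF _ open_interior x]) (simp add: uf)
  then have "frechet_derivative u (at x) = (\<lambda>h. J x *v h)" by (rule frechet_derivative_at[symmetric])
  then show ?thesis by (simp add: grad_def jacobian_def)
qed

section \<open>Inequalities for the Frobenius norm\<close>

lemma norm_matrix_sq: "(norm (A :: real^'n^'m))\<^sup>2 = (\<Sum>i\<in>UNIV. \<Sum>j\<in>UNIV. (A $ i $ j)\<^sup>2)"
  unfolding power2_norm_eq_inner by (simp add: inner_vec_def power2_eq_square)

lemma norm_transpose_matrix: "norm (transpose A) = norm (A :: real^'n^'m)"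
proof -
  have "(norm (transpose A))\<^sup>2 = (norm A)\<^sup>2"
    unfolding norm_matrix_sq by (subst sum.swap) (simp add: transpose_def)
  then show ?thesis by (simp add: power2_eq_iff_nonneg)
qed

lemma norm_sym_part_le: "norm ((1/2) *\<^sub>R (A + transpose A)) \<le> norm (A :: real^'n^'n)"
  using norm_triangle_ineq[of A "transpose A"] by (simp add: norm_transpose_matrix)

lemma norm_matrix_vector_le: "norm (A *v x) \<le> norm (A :: real^'n^'m) * norm x"
proof -
  have "(norm (A *v x))\<^sup>2 = (\<Sum>i\<in>UNIV. (A $ i \<bullet> x)\<^sup>2)"
    unfolding power2_norm_eq_inner[of "A *v x"] inner_vec_def[of "A *v x"]
    by (simp add: matrix_vector_mul_component power2_eq_square)
  also have "\<dots> \<le> (\<Sum>i\<in>UNIV. (A $ i \<bullet> A $ i) * (x \<bullet> x))"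
    by (intro sum_mono) (rule Cauchy_Schwarz_ineq)
  also have "\<dots> = (norm A * norm x)\<^sup>2"
    by (simp add: power_mult_distrib power2_norm_eq_inner sum_distrib_right inner_vec_def[of A])
  finally show ?thesis by (rule power2_le_imp_le) simp
qed

text \<open>Cauchy-Schwarz of the diagonal against the vector of ones. This is where the dimension
  enters the bound for the divergence.\<close>

lemma trace_sq_le: "(trace A)\<^sup>2 \<le> CARD('n) * (norm (A :: real^'n^'n))\<^sup>2"
proof -
  have "(trace A)\<^sup>2 \<le> (\<Sum>i\<in>(UNIV :: 'n set). 1) * (\<Sum>i\<in>UNIV. (A $ i $ i)\<^sup>2)"
    unfolding trace_def by (rule sum_square_le_mult) auto
  also have "\<dots> \<le> (\<Sum>i\<in>(UNIV :: 'n set). 1) * (\<Sum>i\<in>UNIV. \<Sum>j\<in>UNIV. (A $ i $ j)\<^sup>2)"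
    by (intro mult_left_mono sum_mono member_le_sum) auto
  finally show ?thesis by (simp add: norm_matrix_sq)
qed

lemma continuous_on_trace:
  fixes J :: "'a::topological_space \<Rightarrow> real^'n^'n"
  shows "continuous_on S J \<Longrightarrow> continuous_on S (\<lambda>x. trace (J x))"
  unfolding trace_def by (intro continuous_intros)

section \<open>The interior penalty form\<close>

lemma U_space_local:
  assumes "u \<in> U_space \<Omega> \<T> Uloc l" "Uloc = BDM \<or> Uloc = BDFM" "K \<in> \<T>"
  obtains f J where "f \<in> vec_polys l" "C1_field f J" "\<And>x. x \<in> interior K \<Longrightarrow> u x = f x"
proof -
  have "\<exists>f\<in>Uloc l K. \<forall>x\<in>interior K. u x = f x"
    using assms(1,3) by (simp add: U_space_def Hdiv_space_def)
  then obtain f where f: "f \<in> Uloc l K" "\<forall>x\<in>interior K. u x = f x" by blast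
  then have "f \<in> vec_polys l" using assms(2) by (auto simp: BDM_def BDFM_def)
  then show ?thesis using vec_polys_C1 f(2) that by blast
qed

text \<open>An inverse estimate whose constant is chosen before the element: nodes, weights and the
  volume of the unit ball depend on l, \<rho> and d only. The radius r serves as the local length
  scale and is finally exchanged for the diameter.\<close>

lemma gradient_sup_bound:
  fixes \<rho> :: real
  assumes \<rho>: "\<rho> \<ge> 1"
  shows "\<exists>D\<ge>0. \<forall>(K :: (real^'d) set) c r f J u x.
    int CARD('d) simplex K \<longrightarrow> r > 0 \<longrightarrow> cball c r \<subseteq> K \<longrightarrow> diameter K \<le> \<rho> * r \<longrightarrow>
    f \<in> vec_polys l \<longrightarrow> C1_field f J \<longrightarrow> (\<forall>x\<in>interior K. u x = f x) \<longrightarrow> x \<in> K \<longrightarrow>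
    diameter K ^ CARD('d) * (norm (J x))\<^sup>2 \<le> D * l2_inner K (grad u) (grad u)"
proof -
  let ?d = "CARD('d)" and ?V = "unit_ball_vol (real CARD('d))"
  \<comment> \<open>Equidistant nodes starting at 0, all below 1 / (2 * \<rho>). There are l + 1 of
    them, as required for f; the Jacobian inherits the identity with the same nodes.\<close>
  define \<phi> where "\<phi> i = real i / (2 * \<rho> * real (Suc l))" for i
  define T where "T = \<phi> ` {..l}"
  have p: "0 < 2 * \<rho> * real (Suc l)" using \<rho> by simp
  have inj: "inj_on \<phi> {..l}" using p by (auto simp: inj_on_def \<phi>_def)
  have T: "finite T" "card T = Suc l" by (simp_all add: T_def card_image[OF inj])
  have T01: "T \<subseteq> {0..1 / (2 * \<rho>)}"
  proof
    fix t assume "t \<in> T"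
    then obtain i where i: "i \<le> l" "t = \<phi> i" by (auto simp: T_def)
    have "\<phi> i = (real i / real (Suc l)) * (1 / (2 * \<rho>))" by (simp add: \<phi>_def)
    also have "\<dots> \<le> 1 * (1 / (2 * \<rho>))" using i(1) \<rho> by (intro mult_right_mono) auto
    finally show "t \<in> {0..1 / (2 * \<rho>)}" using i(2) p by (simp add: \<phi>_def)
  qed
  define W where "W = 4 ^ ?d * (\<Sum>t\<in>T. (lagrange_weight T t)\<^sup>2) * card T"
  have W: "0 \<le> W" by (simp add: W_def sum_nonneg)
  have V: "0 < ?V" by simp
  show ?thesis
  \<comment> \<open>The quotient of W by the volume of the unit ball is the constant in terms of r;
    \<rho> to the power d pays for replacing r by the diameter.\<close>
  proof (intro exI[of _ "\<rho> ^ ?d * W / ?V"] conjI allI impI)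
    show "0 \<le> \<rho> ^ ?d * W / ?V" using W V \<rho> by simp
    fix K :: "(real^'d) set" and c r f J u x
    assume K: "int CARD('d) simplex K" and r: "r > 0" and ball: "cball c r \<subseteq> K"
      and diam: "diameter K \<le> \<rho> * r" and f: "f \<in> vec_polys l" and J: "C1_field f J"
      and u: "\<forall>x\<in>interior K. u x = f x" and x: "x \<in> K"
    have K': "int DIM(real^'d) simplex K" using K by simp
    have cK: "compact K" using full_simplex_basics(1)[OF K'] .
    have cJ: "continuous_on UNIV J" using J by (simp add: C1_field_def)
    have "dist c x \<le> diameter K"
      using ball x r by (intro diameter_bounded_bound compact_imp_bounded cK) auto
    then have cx: "dist c x \<le> \<rho> * r" using diam by linarith
    have int: "interpolates T (lagrange_weight T) J"
      using vec_polys_interpolates[OF f T] J by (rule interpolates_derivative)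
    have I: "(LINT y:K|lebesgue. (norm (J y))\<^sup>2) = l2_inner K (grad u) (grad u)"
    proof -
      have "(LINT y:K|lebesgue. (norm (grad u y))\<^sup>2) = (LINT y:K|lebesgue. (norm (J y))\<^sup>2)"
      proof (rule integral_on_full_simplex(2)[OF K'])
        show "continuous_on UNIV (\<lambda>y. (norm (J y))\<^sup>2)" using cJ by (intro continuous_intros)
        show "(norm (grad u y))\<^sup>2 = (norm (J y))\<^sup>2" if "y \<in> interior K" for y
          using grad_eq[OF J that] u by simp
      qed
      then show ?thesis by (simp add: l2_inner_self)
    qed
    have "?V * r ^ ?d * (norm (J x))\<^sup>2 \<le> W * (LINT y:K|lebesgue. (norm (J y))\<^sup>2)"
      using norm_le_L2_norm_of_interpolates[OF cJ T(1) T01 \<rho> int cK ball r cx] by (simp add: W_def)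
    then have 1: "r ^ ?d * (norm (J x))\<^sup>2 \<le> W / ?V * l2_inner K (grad u) (grad u)"
      using V by (simp add: I field_simps)
    have "diameter K ^ ?d * (norm (J x))\<^sup>2 \<le> (\<rho> * r) ^ ?d * (norm (J x))\<^sup>2"
      using diam diameter_ge_0[OF compact_imp_bounded[OF cK]] by (intro mult_right_mono power_mono) auto
    also have "\<dots> = \<rho> ^ ?d * (r ^ ?d * (norm (J x))\<^sup>2)" by (simp add: power_mult_distrib)
    also have "\<dots> \<le> \<rho> ^ ?d * (W / ?V * l2_inner K (grad u) (grad u))"
      using 1 \<rho> by (intro mult_left_mono) auto
    finally show "diameter K ^ ?d * (norm (J x))\<^sup>2 \<le> \<rho> ^ ?d * W / ?V * l2_inner K (grad u) (grad u)"
      by simp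
  qed
qed

section \<open>Averages and jumps on a single facet\<close>

lemma elem1_facet: "e \<in> facets \<T> \<Longrightarrow> elem1 \<T> e \<in> \<T> \<and> e facet_of elem1 \<T> e"
  unfolding elem1_def facets_def by (rule someI_ex) blast

lemma elem2_facet:
  assumes "interior_facet \<T> e"
  shows "elem2 \<T> e \<in> \<T> \<and> e facet_of elem2 \<T> e \<and> elem2 \<T> e \<noteq> elem1 \<T> e"
  unfolding elem2_def by (rule someI_ex) (use assms in \<open>unfold interior_facet_def, metis\<close>)

definition jump_sq :: "(real^'d) set set \<Rightarrow> (real^'d) set \<Rightarrow> (real^'d \<Rightarrow> real^'d) \<Rightarrow> real" where
  "jump_sq \<T> e w = facet_integral e (\<lambda>x. (norm (tangential_jump \<T> e w x))\<^sup>2)"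

lemma facet_integral_eq_lebesgue_on:
  assumes "facet_prism e \<in> sets lebesgue"
  shows "facet_integral e f = (\<integral>x. f (closest_point (affine hull e) x) \<partial>lebesgue_on (facet_prism e))"
  unfolding facet_integral_def set_lebesgue_integral_def using assms by (simp add: integral_restrict_space)

lemma jump_sq_nonneg: "0 \<le> jump_sq \<T> e w"
  unfolding jump_sq_def facet_integral_def set_lebesgue_integral_def
  by (rule Bochner_Integration.integral_nonneg) simp

text \<open>The inverse estimate for one whole mesh, with inscribed balls and shape regularity
  hidden in D. Of the geometry, the estimates of \<open>a_form\<close> see only D and a bound H for
  the diameters.\<close>

definition gradient_bounded :: "(real^'d) set set \<Rightarrow> nat \<Rightarrow> real \<Rightarrow> bool" where
  "gradient_bounded \<T> l D \<longleftrightarrow>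
     (\<forall>K\<in>\<T>. \<forall>f\<in>vec_polys l. \<forall>J u. C1_field f J \<longrightarrow> (\<forall>x\<in>interior K. u x = f x) \<longrightarrow>
        (\<forall>x\<in>K. diameter K ^ CARD('d) * (norm (J x))\<^sup>2 \<le> D * l2_inner K (grad u) (grad u)))"

context
  fixes \<Omega> :: "(real^'d) set" and \<T> :: "(real^'d) set set" and l :: nat and D H :: real
    and Uloc :: "nat \<Rightarrow> (real^'d) set \<Rightarrow> (real^'d \<Rightarrow> real^'d) set"
  assumes mesh: "simplicial_mesh \<Omega> \<T>" and dim: "CARD('d) \<ge> 2"
    and Uloc: "Uloc = BDM \<or> Uloc = BDFM"
    and D: "0 \<le> D" and H: "0 \<le> H" and diam: "\<And>K. K \<in> \<T> \<Longrightarrow> diameter K \<le> H"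
    and grad_bounded: "gradient_bounded \<T> l D"
begin

lemma mesh_finite: "finite \<T>"
  using mesh by (simp add: simplicial_mesh_def triangulation_def)

lemma mesh_simplex: "K \<in> \<T> \<Longrightarrow> int DIM(real^'d) simplex K"
  using mesh by (simp add: simplicial_mesh_def)

lemma mesh_diameter_nonneg: "K \<in> \<T> \<Longrightarrow> 0 \<le> diameter K"
  using full_simplex_basics(1)[OF mesh_simplex] by (intro diameter_ge_0 compact_imp_bounded)

lemma mesh_facets_finite: "finite (facets \<T>)"
proof -
  have "facets \<T> = (\<Union>K\<in>\<T>. {e. e facet_of K})" by (auto simp: facets_def)
  moreover have "finite {e. e facet_of K}" if "K \<in> \<T>" for K
    using mesh_simplex[OF that] by (intro finite_polytope_facets simplex_imp_polytope)
  ultimately show ?thesis using mesh_finite by simp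
qed

lemma mesh_facet_compact: "e \<in> facets \<T> \<Longrightarrow> compact e \<and> e \<noteq> {}"
proof -
  assume "e \<in> facets \<T>"
  then obtain K where K: "K \<in> \<T>" "e facet_of K" by (auto simp: facets_def)
  then have "compact K" "convex K" using full_simplex_basics[OF mesh_simplex] by auto
  then show ?thesis using K(2) face_of_imp_compact by (auto simp: facet_of_def)
qed

lemma prism_sets: "e \<in> facets \<T> \<Longrightarrow> facet_prism e \<in> sets lebesgue"
  using compact_facet_prism mesh_facet_compact by (intro fmeasurableD lmeasurable_compact) blast

lemma prism_space: "space (lebesgue_on (facet_prism e)) = facet_prism e"
  by (simp add: space_restrict_space)

lemma elem_trace_sym_grad_bound:
  assumes u: "u \<in> U_space \<Omega> \<T> Uloc l" and K: "K \<in> \<T>" and x: "x \<in> K"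
  shows "diameter K ^ CARD('d) * (norm (elem_trace K (sym_grad u) x))\<^sup>2 \<le> D * l2_inner K (grad u) (grad u)"
proof -
  obtain f J where f: "f \<in> vec_polys l" "C1_field f J" "\<And>x. x \<in> interior K \<Longrightarrow> u x = f x"
    using U_space_local[OF u Uloc K] by metis
  have cJ: "continuous_on UNIV J" using f(2) by (simp add: C1_field_def)
  have "elem_trace K (sym_grad u) x = (1/2) *\<^sub>R (J x + transpose (J x))"
  proof (rule elem_trace_eq[OF mesh_simplex[OF K] x])
    show "continuous_on UNIV (\<lambda>x. (1/2) *\<^sub>R (J x + transpose (J x)))"
      unfolding transpose_def using cJ by (intro continuous_intros)
    show "sym_grad u y = (1/2) *\<^sub>R (J y + transpose (J y))" if "y \<in> interior K" for y
      using grad_eq[OF f(2) that f(3)] by (simp add: sym_grad_def)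
  qed
  then have "norm (elem_trace K (sym_grad u) x) \<le> norm (J x)" using norm_sym_part_le by metis
  moreover have "0 \<le> diameter K" using K by (rule mesh_diameter_nonneg)
  ultimately have "diameter K ^ CARD('d) * (norm (elem_trace K (sym_grad u) x))\<^sup>2
      \<le> diameter K ^ CARD('d) * (norm (J x))\<^sup>2"
    by (intro mult_left_mono power_mono) auto
  also have "\<dots> \<le> D * l2_inner K (grad u) (grad u)"
    using grad_bounded[unfolded gradient_bounded_def, rule_format, OF K f(1,2) _ x] f(3) by blast
  finally show ?thesis .
qed

lemma elem_trace_normal_bound:
  assumes u: "u \<in> U_space \<Omega> \<T> Uloc l" and K: "K \<in> \<T>" "e facet_of K" and x: "x \<in> e"
  shows "(norm (elem_trace K (sym_grad u) x *v outer_normal K e))\<^sup>2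
    \<le> D * l2_inner K (grad u) (grad u) / diameter K ^ CARD('d)"
proof -
  have "norm (elem_trace K (sym_grad u) x *v outer_normal K e) \<le> norm (elem_trace K (sym_grad u) x)"
    using norm_matrix_vector_le[of "elem_trace K (sym_grad u) x" "outer_normal K e"]
      norm_outer_normal[OF mesh_simplex[OF K(1)] K(2)] by simp
  then have 1: "(norm (elem_trace K (sym_grad u) x *v outer_normal K e))\<^sup>2
      \<le> (norm (elem_trace K (sym_grad u) x))\<^sup>2" by (intro power_mono) auto
  \<comment> \<open>Division by 0 yields 0, so moving the power of the diameter to the other side
    needs a positive diameter.\<close>
  have "0 < diameter K" using facet_diameter[OF mesh_simplex[OF K(1)] K(2)] dim by simp
  then have "0 < diameter K ^ CARD('d)" by simp
  then have "(norm (elem_trace K (sym_grad u) x))\<^sup>2 \<le> D * l2_inner K (grad u) (grad u) / diameter K ^ CARD('d)"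
    using elem_trace_sym_grad_bound[OF u K(1), of x] facet_of_imp_subset[OF K(2)] x
    by (auto simp: pos_le_divide_eq mult.commute)
  with 1 show ?thesis by linarith
qed

text \<open>Bounding by a sum over all elements that have e as a facet treats interior and boundary
  facets alike and lets the sums over facets and elements be exchanged later.\<close>

lemma avg_bound:
  assumes u: "u \<in> U_space \<Omega> \<T> Uloc l" and e: "e \<in> facets \<T>" and x: "x \<in> e"
  shows "(norm (avg \<T> e (sym_grad u) x))\<^sup>2
    \<le> (\<Sum>K | K \<in> \<T> \<and> e facet_of K. D * l2_inner K (grad u) (grad u) / diameter K ^ CARD('d))"
proof -
  let ?B = "\<lambda>K. D * l2_inner K (grad u) (grad u) / diameter K ^ CARD('d)"
  let ?t = "\<lambda>K. elem_trace K (sym_grad u) x *v outer_normal K e"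
  let ?S = "{K. K \<in> \<T> \<and> e facet_of K}"
  have fin: "finite ?S" using mesh_finite by simp
  have pos: "0 \<le> ?B K" if "K \<in> ?S" for K
    using elem_trace_normal_bound[OF u _ _ x, of K] that zero_le_power2 order_trans by blast
  note e1 = elem1_facet[OF e]
  show ?thesis
  proof (cases "interior_facet \<T> e")
    case True
    note e2 = elem2_facet[OF True]
    have "avg \<T> e (sym_grad u) x = (1/2) *\<^sub>R (?t (elem1 \<T> e) - ?t (elem2 \<T> e))"
      using True by (simp add: avg_def Let_def)
    then have "norm (avg \<T> e (sym_grad u) x) \<le> (norm (?t (elem1 \<T> e)) + norm (?t (elem2 \<T> e))) / 2"
      using norm_triangle_ineq4[of "?t (elem1 \<T> e)" "?t (elem2 \<T> e)"] by simp
    then have "(norm (avg \<T> e (sym_grad u) x))\<^sup>2 \<le> ((norm (?t (elem1 \<T> e)) + norm (?t (elem2 \<T> e))) / 2)\<^sup>2"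
      by (intro power_mono) auto
    also have "\<dots> \<le> (norm (?t (elem1 \<T> e)))\<^sup>2 + (norm (?t (elem2 \<T> e)))\<^sup>2"
    proof -
      have "((a + b) / 2)\<^sup>2 \<le> a\<^sup>2 + b\<^sup>2" for a b :: real
      proof -
        have "(a + b)\<^sup>2 \<le> 2 * (a\<^sup>2 + b\<^sup>2)" unfolding power2_sum using sum_squares_bound[of a b] by simp
        also have "\<dots> \<le> 4 * (a\<^sup>2 + b\<^sup>2)" by simp
        finally show ?thesis by (simp add: power_divide)
      qed
      then show ?thesis .
    qed
    also have "\<dots> \<le> ?B (elem1 \<T> e) + ?B (elem2 \<T> e)"
      using e1 e2 by (intro add_mono elem_trace_normal_bound u x) auto
    also have "\<dots> = sum ?B {elem1 \<T> e, elem2 \<T> e}"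
      using e2 by (simp add: eq_commute[of "elem1 \<T> e"])
    also have "\<dots> \<le> sum ?B ?S" using e1 e2 fin pos by (intro sum_mono2) auto
    finally show ?thesis .
  next
    case False
    then have "(norm (avg \<T> e (sym_grad u) x))\<^sup>2 = (norm (?t (elem1 \<T> e)))\<^sup>2"
      by (simp add: avg_def Let_def)
    also have "\<dots> \<le> ?B (elem1 \<T> e)" using e1 by (intro elem_trace_normal_bound u x) auto
    also have "\<dots> \<le> sum ?B ?S" using e1 fin pos by (intro member_le_sum) auto
    finally show ?thesis .
  qed
qed

text \<open>On e both one-sided traces are polynomials projected along the fixed normal of
  \<open>elem1\<close>. A continuous extension to the whole space makes the squared jump integrable
  over the prism.\<close>

lemma tangential_jump_continuous:
  assumes w: "w \<in> U_space \<Omega> \<T> Uloc l" and e: "e \<in> facets \<T>"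
  obtains \<Phi> where "continuous_on UNIV \<Phi>" "\<And>x. x \<in> e \<Longrightarrow> tangential_jump \<T> e w x = \<Phi> x"
proof -
  let ?n = "outer_normal (elem1 \<T> e) e"
  have tr: "\<exists>G. continuous_on UNIV G \<and> (\<forall>x\<in>e. elem_trace K (\<lambda>x. tangential ?n (w x)) x = G x)"
    if K: "K \<in> \<T>" "e facet_of K" for K
  proof -
    obtain f J where f: "C1_field f J" "\<And>x. x \<in> interior K \<Longrightarrow> w x = f x"
      using U_space_local[OF w Uloc K(1)] by metis
    have cf: "continuous_on UNIV f"
      using f(1) unfolding C1_field_def by (intro has_derivative_continuous_on) auto
    have cG: "continuous_on UNIV (\<lambda>x. tangential ?n (f x))"
      unfolding tangential_def using cf by (intro continuous_intros)
    have "elem_trace K (\<lambda>x. tangential ?n (w x)) x = tangential ?n (f x)" if "x \<in> e" for x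
      using facet_of_imp_subset[OF K(2)] that f(2)
      by (intro elem_trace_eq[OF mesh_simplex[OF K(1)] _ cG]) auto
    then show ?thesis using cG by blast
  qed
  obtain G1 where G1: "continuous_on UNIV G1"
    "\<And>x. x \<in> e \<Longrightarrow> elem_trace (elem1 \<T> e) (\<lambda>x. tangential ?n (w x)) x = G1 x"
    using tr elem1_facet[OF e] by blast
  show ?thesis
  proof (cases "interior_facet \<T> e")
    case True
    obtain G2 where G2: "continuous_on UNIV G2"
      "\<And>x. x \<in> e \<Longrightarrow> elem_trace (elem2 \<T> e) (\<lambda>x. tangential ?n (w x)) x = G2 x"
      using tr elem2_facet[OF True] by blast
    show ?thesis
    proof (rule that)
      show "continuous_on UNIV (\<lambda>x. G1 x - G2 x)" using G1(1) G2(1) by (intro continuous_intros)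
    qed (use True G1 G2 in \<open>simp add: tangential_jump_def jump_def\<close>)
  next
    case False
    show ?thesis using False G1 by (intro that[of G1]) (simp_all add: tangential_jump_def jump_def)
  qed
qed

lemma jump_sq_integrable:
  assumes w: "w \<in> U_space \<Omega> \<T> Uloc l" and e: "e \<in> facets \<T>"
  shows "integrable (lebesgue_on (facet_prism e))
    (\<lambda>x. (norm (tangential_jump \<T> e w (closest_point (affine hull e) x)))\<^sup>2)"
proof -
  let ?p = "closest_point (affine hull e)"
  obtain \<Phi> where \<Phi>: "continuous_on UNIV \<Phi>" "\<And>x. x \<in> e \<Longrightarrow> tangential_jump \<T> e w x = \<Phi> x"
    using tangential_jump_continuous[OF w e] by blast
  have p: "continuous_on UNIV ?p"
    using mesh_facet_compact[OF e]
    by (intro continuous_on_closest_point affine_imp_convex affine_affine_hull closed_affine_hull) auto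
  have "continuous_on (facet_prism e) (\<lambda>x. (norm (\<Phi> (?p x)))\<^sup>2)"
    using p continuous_on_subset
    by (intro continuous_intros continuous_on_compose2[OF \<Phi>(1)]) auto
  then have "set_integrable lebesgue (facet_prism e) (\<lambda>x. (norm (\<Phi> (?p x)))\<^sup>2)"
    using compact_facet_prism mesh_facet_compact[OF e] by (blast intro: set_integrable_continuous_compact)
  also have "?this \<longleftrightarrow> set_integrable lebesgue (facet_prism e) (\<lambda>x. (norm (tangential_jump \<T> e w (?p x)))\<^sup>2)"
    by (intro set_integrable_cong) (auto simp: \<Phi>(2) closest_point_in_facet_prism)
  finally show ?thesis using prism_sets[OF e] by (simp add: set_integrable_eq)
qed

text \<open>The average is replaced by its uniform bound m on e. Cauchy-Schwarz with the weights
  \<open>h_e\<close> and \<open>1/h_e\<close> then leaves the facet term of the DG norm on one side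
  and \<open>h_e\<close> times the area of e times m on the other.\<close>

lemma consistency_term_bound:
  assumes u: "u \<in> U_space \<Omega> \<T> Uloc l" and w: "w \<in> U_space \<Omega> \<T> Uloc l" and e: "e \<in> facets \<T>"
  defines "C \<equiv> (1 + 2 * H) * (unit_ball_vol CARD('d) * 2 ^ CARD('d)) * D"
  shows "(facet_integral e (\<lambda>x. avg \<T> e (sym_grad u) x \<bullet> tangential_jump \<T> e w x))\<^sup>2
    \<le> (\<Sum>K | K \<in> \<T> \<and> e facet_of K. C * l2_inner K (grad u) (grad u)) * (inverse (diameter e) * jump_sq \<T> e w)"
proof -
  let ?p = "closest_point (affine hull e)" and ?M = "lebesgue_on (facet_prism e)"
  let ?S = "{K. K \<in> \<T> \<and> e facet_of K}" and ?h = "diameter e"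
  define m where "m = (\<Sum>K\<in>?S. D * l2_inner K (grad u) (grad u) / diameter K ^ CARD('d))"
  obtain K0 where K0: "K0 \<in> \<T>" "e facet_of K0" using e by (auto simp: facets_def)
  have h: "0 < ?h" using facet_diameter[OF mesh_simplex[OF K0(1)] K0(2)] dim by simp
  have m: "0 \<le> m"
    using D mesh_diameter_nonneg unfolding m_def
    by (intro sum_nonneg divide_nonneg_nonneg mult_nonneg_nonneg l2_inner_self_nonneg zero_le_power) auto
  have mM: "measure ?M (space ?M) = measure lebesgue (facet_prism e)"
    using prism_sets[OF e] by (simp add: prism_space measure_restrict_space)
  have "(facet_integral e (\<lambda>x. avg \<T> e (sym_grad u) x \<bullet> tangential_jump \<T> e w x))\<^sup>2
    \<le> (\<integral>x. ?h * m \<partial>?M) * (\<integral>x. inverse ?h * (norm (tangential_jump \<T> e w (?p x)))\<^sup>2 \<partial>?M)"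
    unfolding facet_integral_eq_lebesgue_on[OF prism_sets[OF e]]
  proof (rule integral_square_le_mult)
    show "integrable ?M (\<lambda>x. ?h * m)"
    proof -
      have "compact (facet_prism e)" using compact_facet_prism mesh_facet_compact[OF e] by blast
      then have "set_integrable lebesgue (facet_prism e) (\<lambda>x. ?h * m)"
        by (rule set_integrable_continuous_compact) (rule continuous_on_const)
      then show ?thesis using prism_sets[OF e] by (simp only: set_integrable_eq sets.Int_space_eq2)
    qed
    show "integrable ?M (\<lambda>x. inverse ?h * (norm (tangential_jump \<T> e w (?p x)))\<^sup>2)"
      using jump_sq_integrable[OF w e] by (rule integrable_mult_right)
    fix x assume "x \<in> space ?M"
    then have px: "?p x \<in> e" unfolding prism_space by (rule closest_point_in_facet_prism)
    show "0 \<le> ?h * m" "0 \<le> inverse ?h * (norm (tangential_jump \<T> e w (?p x)))\<^sup>2" using h m by simp_all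
    have "(avg \<T> e (sym_grad u) (?p x) \<bullet> tangential_jump \<T> e w (?p x))\<^sup>2
        \<le> (norm (avg \<T> e (sym_grad u) (?p x)))\<^sup>2 * (norm (tangential_jump \<T> e w (?p x)))\<^sup>2"
      unfolding power2_norm_eq_inner by (rule Cauchy_Schwarz_ineq)
    also have "\<dots> \<le> m * (norm (tangential_jump \<T> e w (?p x)))\<^sup>2"
      unfolding m_def by (intro mult_right_mono avg_bound u e px) simp
    also have "\<dots> = (?h * m) * (inverse ?h * (norm (tangential_jump \<T> e w (?p x)))\<^sup>2)"
      using h by simp
    finally show "(avg \<T> e (sym_grad u) (?p x) \<bullet> tangential_jump \<T> e w (?p x))\<^sup>2
        \<le> (?h * m) * (inverse ?h * (norm (tangential_jump \<T> e w (?p x)))\<^sup>2)" .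
  qed
  also have "(\<integral>x. ?h * m \<partial>?M) = (?h * measure lebesgue (facet_prism e)) * m"
    by (simp add: mM[unfolded prism_space] prism_space mult_ac)
  also have "(\<integral>x. inverse ?h * (norm (tangential_jump \<T> e w (?p x)))\<^sup>2 \<partial>?M) = inverse ?h * jump_sq \<T> e w"
    unfolding jump_sq_def facet_integral_eq_lebesgue_on[OF prism_sets[OF e]] by simp
  also have "(?h * measure lebesgue (facet_prism e)) * m * (inverse ?h * jump_sq \<T> e w)
      \<le> (\<Sum>K\<in>?S. C * l2_inner K (grad u) (grad u)) * (inverse ?h * jump_sq \<T> e w)"
  proof (rule mult_right_mono)
    show "0 \<le> inverse ?h * jump_sq \<T> e w" using h jump_sq_nonneg[of \<T> e w] by simp
    show "(?h * measure lebesgue (facet_prism e)) * m \<le> (\<Sum>K\<in>?S. C * l2_inner K (grad u) (grad u))"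
      unfolding m_def sum_distrib_left
    proof (rule sum_mono)
      \<comment> \<open>Each adjacent element supplies its own area bound, whose power of the
        diameter cancels the one in its own summand of m; neighbouring element sizes are never
        compared.\<close>
      fix K assume K: "K \<in> ?S"
      let ?N = "l2_inner K (grad u) (grad u)"
      have dK: "0 < diameter K"
        using facet_diameter[OF mesh_simplex, of K e] K dim by auto
      have N: "0 \<le> D * ?N" using D l2_inner_self_nonneg by (intro mult_nonneg_nonneg)
      have "?h * measure lebesgue (facet_prism e)
          \<le> (1 + 2 * diameter K) * (unit_ball_vol CARD('d) * (2 * diameter K) ^ CARD('d))"
        using facet_prism_measure_le[OF mesh_simplex, of K e] K dim by simp
      also have "\<dots> \<le> (1 + 2 * H) * (unit_ball_vol CARD('d) * (2 * diameter K) ^ CARD('d))"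
        using diam[of K] K dK by (intro mult_right_mono) auto
      finally have "?h * measure lebesgue (facet_prism e) * (D * ?N / diameter K ^ CARD('d))
          \<le> (1 + 2 * H) * (unit_ball_vol CARD('d) * (2 * diameter K) ^ CARD('d)) * (D * ?N / diameter K ^ CARD('d))"
        using N dK by (intro mult_right_mono) auto
      also have "\<dots> = C * ?N"
        using dK by (simp add: C_def power_mult_distrib)
      finally show "?h * measure lebesgue (facet_prism e) * (D * ?N / diameter K ^ CARD('d)) \<le> C * ?N" .
    qed
  qed
  finally show ?thesis .
qed

text \<open>After exchanging the sums, every element is counted once for each of its facets, a
  number bounded in terms of d.\<close>

lemma facet_patch_sum_le:
  assumes "\<And>K. K \<in> \<T> \<Longrightarrow> 0 \<le> N K"
  shows "(\<Sum>e\<in>facets \<T>. \<Sum>K | K \<in> \<T> \<and> e facet_of K. N K) \<le> 2 ^ (CARD('d) + 1) * (\<Sum>K\<in>\<T>. N K :: real)"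
proof -
  have "(\<Sum>e\<in>facets \<T>. \<Sum>K | K \<in> \<T> \<and> e facet_of K. N K)
      = (\<Sum>K\<in>\<T>. \<Sum>e | e \<in> facets \<T> \<and> e facet_of K. N K)"
    by (rule sum.swap_restrict) (auto intro: mesh_finite mesh_facets_finite)
  also have "\<dots> \<le> (\<Sum>K\<in>\<T>. 2 ^ (CARD('d) + 1) * N K)"
  proof (rule sum_mono)
    fix K assume K: "K \<in> \<T>"
    then have "{e. e \<in> facets \<T> \<and> e facet_of K} = {e. e facet_of K}" by (auto simp: facets_def)
    then have "card {e. e \<in> facets \<T> \<and> e facet_of K} \<le> 2 ^ (CARD('d) + 1)"
      using card_facets_le[OF mesh_simplex[OF K]] by simp
    then have "real (card {e. e \<in> facets \<T> \<and> e facet_of K}) \<le> 2 ^ (CARD('d) + 1)"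
      using of_nat_mono by fastforce
    then show "(\<Sum>e | e \<in> facets \<T> \<and> e facet_of K. N K) \<le> 2 ^ (CARD('d) + 1) * N K"
      using assms[OF K] by (simp add: mult_right_mono)
  qed
  finally show ?thesis by (simp add: sum_distrib_left)
qed

lemma grad_square_integrable:
  assumes u: "u \<in> U_space \<Omega> \<T> Uloc l" and K: "K \<in> \<T>"
  shows "integrable (lebesgue_on K) (\<lambda>x. grad u x \<bullet> grad u x)"
proof -
  obtain f J where f: "C1_field f J" "\<And>x. x \<in> interior K \<Longrightarrow> u x = f x"
    using U_space_local[OF u Uloc K] by metis
  have "continuous_on UNIV (\<lambda>x. J x \<bullet> J x)"
    using f(1) unfolding C1_field_def by (intro continuous_intros) auto
  then have "set_integrable lebesgue K (\<lambda>x. grad u x \<bullet> grad u x)"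
    by (rule integral_on_full_simplex(1)[OF mesh_simplex[OF K]]) (simp add: grad_eq[OF f(1) _ f(2)])
  moreover have "K \<in> sets lebesgue"
    using full_simplex_basics(1)[OF mesh_simplex[OF K]] by (intro fmeasurableD lmeasurable_compact)
  ultimately show ?thesis by (simp add: set_integrable_eq)
qed

lemma volume_term_bound:
  assumes u: "u \<in> U_space \<Omega> \<T> Uloc l" and w: "w \<in> U_space \<Omega> \<T> Uloc l" and K: "K \<in> \<T>"
  shows "(l2_inner K (sym_grad u) (sym_grad w))\<^sup>2 \<le> l2_inner K (grad u) (grad u) * l2_inner K (grad w) (grad w)"
proof -
  have "K \<in> sets lebesgue"
    using full_simplex_basics(1)[OF mesh_simplex[OF K]] by (intro fmeasurableD lmeasurable_compact)
  note eq = l2_inner_eq_lebesgue_on[OF this]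
  have "(sym_grad u x \<bullet> sym_grad w x)\<^sup>2 \<le> (grad u x \<bullet> grad u x) * (grad w x \<bullet> grad w x)" for x
  proof -
    have "(sym_grad u x \<bullet> sym_grad w x)\<^sup>2 \<le> (norm (sym_grad u x))\<^sup>2 * (norm (sym_grad w x))\<^sup>2"
      unfolding power2_norm_eq_inner by (rule Cauchy_Schwarz_ineq)
    also have "\<dots> \<le> (norm (grad u x))\<^sup>2 * (norm (grad w x))\<^sup>2"
      unfolding sym_grad_def by (intro mult_mono power_mono norm_sym_part_le) auto
    finally show ?thesis by (simp add: power2_norm_eq_inner)
  qed
  then show ?thesis
    unfolding eq by (intro integral_square_le_mult grad_square_integrable u w K) auto
qed

lemma penalty_term_bound:
  assumes u: "u \<in> U_space \<Omega> \<T> Uloc l" and w: "w \<in> U_space \<Omega> \<T> Uloc l" and e: "e \<in> facets \<T>"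
  shows "(facet_integral e (\<lambda>x. \<eta> * inverse (diameter e) * (tangential_jump \<T> e u x \<bullet> tangential_jump \<T> e w x)))\<^sup>2
    \<le> (\<eta>\<^sup>2 * (inverse (diameter e) * jump_sq \<T> e u)) * (inverse (diameter e) * jump_sq \<T> e w)"
proof -
  let ?p = "closest_point (affine hull e)" and ?M = "lebesgue_on (facet_prism e)"
  let ?u = "\<lambda>x. tangential_jump \<T> e u (?p x)" and ?w = "\<lambda>x. tangential_jump \<T> e w (?p x)"
  have "(facet_integral e (\<lambda>x. \<eta> * inverse (diameter e) * (tangential_jump \<T> e u x \<bullet> tangential_jump \<T> e w x)))\<^sup>2
      = (\<eta> * inverse (diameter e))\<^sup>2 * (\<integral>x. ?u x \<bullet> ?w x \<partial>?M)\<^sup>2"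
    unfolding facet_integral_eq_lebesgue_on[OF prism_sets[OF e]] by (simp add: power_mult_distrib)
  also have "\<dots> \<le> (\<eta> * inverse (diameter e))\<^sup>2 * (jump_sq \<T> e u * jump_sq \<T> e w)"
    unfolding jump_sq_def facet_integral_eq_lebesgue_on[OF prism_sets[OF e]]
  proof (intro mult_left_mono integral_square_le_mult jump_sq_integrable u w e)
    show "(?u x \<bullet> ?w x)\<^sup>2 \<le> (norm (?u x))\<^sup>2 * (norm (?w x))\<^sup>2" for x
      unfolding power2_norm_eq_inner by (rule Cauchy_Schwarz_ineq)
  qed auto
  finally show ?thesis by (simp add: power2_eq_square mult_ac)
qed

section \<open>Summation over elements and facets\<close>

lemma DG_norm_sq:
  shows "0 \<le> DG_norm \<T> u"
    and "(\<Sum>K\<in>\<T>. l2_inner K (grad u) (grad u)) \<le> (DG_norm \<T> u)\<^sup>2"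
    and "(\<Sum>e\<in>facets \<T>. inverse (diameter e) * jump_sq \<T> e u) \<le> (DG_norm \<T> u)\<^sup>2"
proof -
  have 1: "0 \<le> (\<Sum>K\<in>\<T>. l2_inner K (grad u) (grad u))" by (intro sum_nonneg l2_inner_self_nonneg)
  have "0 \<le> diameter e" if "e \<in> facets \<T>" for e
    using mesh_facet_compact[OF that] by (intro diameter_ge_0 compact_imp_bounded) blast
  then have 2: "0 \<le> (\<Sum>e\<in>facets \<T>. inverse (diameter e) * jump_sq \<T> e u)"
    by (intro sum_nonneg mult_nonneg_nonneg jump_sq_nonneg) auto
  have 3: "0 \<le> (\<Sum>K\<in>\<T>. (diameter K)\<^sup>2 * h2_seminorm_sq K u)"
    unfolding h2_seminorm_sq_def by (intro sum_nonneg mult_nonneg_nonneg l2_inner_self_nonneg zero_le_power2)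
  have eq: "DG_norm \<T> u = sqrt ((\<Sum>K\<in>\<T>. l2_inner K (grad u) (grad u))
    + (\<Sum>e\<in>facets \<T>. inverse (diameter e) * jump_sq \<T> e u) + (\<Sum>K\<in>\<T>. (diameter K)\<^sup>2 * h2_seminorm_sq K u))"
    by (simp add: DG_norm_def jump_sq_def)
  then show "0 \<le> DG_norm \<T> u" using 1 2 3 by simp
  have "(DG_norm \<T> u)\<^sup>2 = (\<Sum>K\<in>\<T>. l2_inner K (grad u) (grad u))
    + (\<Sum>e\<in>facets \<T>. inverse (diameter e) * jump_sq \<T> e u) + (\<Sum>K\<in>\<T>. (diameter K)\<^sup>2 * h2_seminorm_sq K u)"
    unfolding eq using 1 2 3 by (intro real_sqrt_pow2) linarith
  then show "(\<Sum>K\<in>\<T>. l2_inner K (grad u) (grad u)) \<le> (DG_norm \<T> u)\<^sup>2"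
    and "(\<Sum>e\<in>facets \<T>. inverse (diameter e) * jump_sq \<T> e u) \<le> (DG_norm \<T> u)\<^sup>2"
    using 1 2 3 by linarith+
qed

lemma facet_weight_nonneg: "e \<in> facets \<T> \<Longrightarrow> 0 \<le> inverse (diameter e) * jump_sq \<T> e u"
  using mesh_facet_compact[of e] diameter_ge_0[OF compact_imp_bounded, of e]
  by (intro mult_nonneg_nonneg jump_sq_nonneg) auto

text \<open>C is the constant on a single facet and 2 to the power d + 1 the multiplicity of an
  element in the sum over facets; the root appears because both enter the squared estimate.\<close>

lemma consistency_bound:
  assumes u: "u \<in> U_space \<Omega> \<T> Uloc l" and w: "w \<in> U_space \<Omega> \<T> Uloc l"
  defines "C \<equiv> (1 + 2 * H) * (unit_ball_vol CARD('d) * 2 ^ CARD('d)) * D"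
  shows "\<bar>\<Sum>e\<in>facets \<T>. facet_integral e (\<lambda>x. avg \<T> e (sym_grad u) x \<bullet> tangential_jump \<T> e w x)\<bar>
    \<le> sqrt (C * 2 ^ (CARD('d) + 1)) * DG_norm \<T> u * DG_norm \<T> w"
proof (rule abs_le_mult_of_square_le)
  let ?A = "\<Sum>e\<in>facets \<T>. \<Sum>K | K \<in> \<T> \<and> e facet_of K. C * l2_inner K (grad u) (grad u)"
  let ?B = "\<Sum>e\<in>facets \<T>. inverse (diameter e) * jump_sq \<T> e w"
  have C: "0 \<le> C" using H D by (simp add: C_def)
  have N: "0 \<le> C * l2_inner K (grad u) (grad u)" for K
    using C l2_inner_self_nonneg by (intro mult_nonneg_nonneg)
  show "(\<Sum>e\<in>facets \<T>. facet_integral e (\<lambda>x. avg \<T> e (sym_grad u) x \<bullet> tangential_jump \<T> e w x))\<^sup>2 \<le> ?A * ?B"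
    using consistency_term_bound[OF u w] N
    by (intro sum_square_le_mult facet_weight_nonneg sum_nonneg) (auto simp: C_def)
  show "0 \<le> ?A" "0 \<le> ?B" using N facet_weight_nonneg by (intro sum_nonneg; blast)+
  have "?A \<le> 2 ^ (CARD('d) + 1) * (\<Sum>K\<in>\<T>. C * l2_inner K (grad u) (grad u))"
    using N by (intro facet_patch_sum_le)
  also have "\<dots> = (C * 2 ^ (CARD('d) + 1)) * (\<Sum>K\<in>\<T>. l2_inner K (grad u) (grad u))"
    by (simp add: sum_distrib_left mult_ac)
  also have "\<dots> \<le> (C * 2 ^ (CARD('d) + 1)) * (DG_norm \<T> u)\<^sup>2"
    using C DG_norm_sq(2)[of u] by (intro mult_left_mono) auto
  also have "\<dots> = (sqrt (C * 2 ^ (CARD('d) + 1)) * DG_norm \<T> u)\<^sup>2"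
    using C by (simp add: power_mult_distrib)
  finally show "?A \<le> (sqrt (C * 2 ^ (CARD('d) + 1)) * DG_norm \<T> u)\<^sup>2" .
  show "?B \<le> (DG_norm \<T> w)\<^sup>2" by (rule DG_norm_sq)
  show "0 \<le> sqrt (C * 2 ^ (CARD('d) + 1)) * DG_norm \<T> u" using C DG_norm_sq(1) by simp
qed (rule DG_norm_sq)

text \<open>The constant adds 1 for the volume term, the root once for each of the two mirrored
  consistency terms, and the absolute value of \<eta> for the penalty.\<close>

lemma a_form_bound:
  assumes u: "u \<in> U_space \<Omega> \<T> Uloc l" and w: "w \<in> U_space \<Omega> \<T> Uloc l"
  defines "C \<equiv> (1 + 2 * H) * (unit_ball_vol CARD('d) * 2 ^ CARD('d)) * D"
  shows "\<bar>a_form \<T> \<eta> u w\<bar>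
    \<le> (1 + 2 * sqrt (C * 2 ^ (CARD('d) + 1)) + \<bar>\<eta>\<bar>) * (DG_norm \<T> u * DG_norm \<T> w)"
proof -
  let ?G = "\<lambda>u. \<Sum>K\<in>\<T>. l2_inner K (grad u) (grad u)"
  let ?J = "\<lambda>u. \<Sum>e\<in>facets \<T>. inverse (diameter e) * jump_sq \<T> e u"
  define v where "v = (\<Sum>K\<in>\<T>. l2_inner K (sym_grad u) (sym_grad w))"
  define c where "c u w = (\<Sum>e\<in>facets \<T>. facet_integral e (\<lambda>x. avg \<T> e (sym_grad u) x \<bullet> tangential_jump \<T> e w x))"
    for u w
  define s where "s = (\<Sum>e\<in>facets \<T>. facet_integral e
         (\<lambda>x. \<eta> * inverse (diameter e) * (tangential_jump \<T> e u x \<bullet> tangential_jump \<T> e w x)))"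
  have G: "0 \<le> ?G u" for u by (intro sum_nonneg l2_inner_self_nonneg)
  have J: "0 \<le> ?J u" for u by (intro sum_nonneg facet_weight_nonneg)
  have "v\<^sup>2 \<le> ?G u * ?G w"
    unfolding v_def by (intro sum_square_le_mult l2_inner_self_nonneg volume_term_bound u w)
  then have v: "\<bar>v\<bar> \<le> DG_norm \<T> u * DG_norm \<T> w"
    by (rule abs_le_mult_of_square_le) (intro DG_norm_sq G)+
  have "s\<^sup>2 \<le> (\<Sum>e\<in>facets \<T>. \<eta>\<^sup>2 * (inverse (diameter e) * jump_sq \<T> e u)) * ?J w"
    unfolding s_def
    by (intro sum_square_le_mult facet_weight_nonneg mult_nonneg_nonneg[OF zero_le_power2] penalty_term_bound u w)
  then have "s\<^sup>2 \<le> (\<eta>\<^sup>2 * ?J u) * ?J w" by (simp only: sum_distrib_left)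
  then have s: "\<bar>s\<bar> \<le> (\<bar>\<eta>\<bar> * DG_norm \<T> u) * DG_norm \<T> w"
  proof (rule abs_le_mult_of_square_le)
    show "\<eta>\<^sup>2 * ?J u \<le> (\<bar>\<eta>\<bar> * DG_norm \<T> u)\<^sup>2"
      using DG_norm_sq(3)[of u] by (simp add: power_mult_distrib mult_left_mono)
  qed (use J DG_norm_sq in \<open>auto intro: mult_nonneg_nonneg\<close>)
  have c: "\<bar>c u w\<bar> \<le> sqrt (C * 2 ^ (CARD('d) + 1)) * DG_norm \<T> u * DG_norm \<T> w"
    "\<bar>c w u\<bar> \<le> sqrt (C * 2 ^ (CARD('d) + 1)) * DG_norm \<T> w * DG_norm \<T> u"
    unfolding c_def C_def by (intro consistency_bound u w)+
  have "a_form \<T> \<eta> u w = v - c u w - c w u + s"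
    by (simp add: a_form_def v_def c_def s_def)
  then have "\<bar>a_form \<T> \<eta> u w\<bar> \<le> \<bar>v\<bar> + \<bar>c u w\<bar> + \<bar>c w u\<bar> + \<bar>s\<bar>" by linarith
  also have "\<dots> \<le> DG_norm \<T> u * DG_norm \<T> w + sqrt (C * 2 ^ (CARD('d) + 1)) * DG_norm \<T> u * DG_norm \<T> w
      + sqrt (C * 2 ^ (CARD('d) + 1)) * DG_norm \<T> w * DG_norm \<T> u + \<bar>\<eta>\<bar> * DG_norm \<T> u * DG_norm \<T> w"
    using v c s by (intro add_mono)
  also have "\<dots> = (1 + 2 * sqrt (C * 2 ^ (CARD('d) + 1)) + \<bar>\<eta>\<bar>) * (DG_norm \<T> u * DG_norm \<T> w)"
    by (simp add: algebra_simps)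
  finally show ?thesis .
qed

text \<open>Bounds the divergence without any factor \<open>lam\<close>. This is what remains
  available when \<open>lam\<close> is small and the weighted divergence in \<open>U_norm\<close> is
  weak.\<close>

lemma divg_L2_le:
  assumes u: "u \<in> U_space \<Omega> \<T> Uloc l" and \<Omega>: "open \<Omega>"
  shows "l2_inner \<Omega> (divg u) (divg u) \<le> CARD('d) * (DG_norm \<T> u)\<^sup>2"
proof -
  have loc: "\<exists>G. continuous_on UNIV G \<and> (\<forall>x\<in>interior K. (norm (divg u x))\<^sup>2 = G x)" if K: "K \<in> \<T>" for K
  proof -
    obtain f J where f: "C1_field f J" "\<And>x. x \<in> interior K \<Longrightarrow> u x = f x"
      using U_space_local[OF u Uloc K] by metis
    have "continuous_on UNIV (\<lambda>x. (norm (trace (J x)))\<^sup>2)"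
      using f(1) unfolding C1_field_def by (intro continuous_intros continuous_on_trace) auto
    moreover have "(norm (divg u x))\<^sup>2 = (norm (trace (J x)))\<^sup>2" if "x \<in> interior K" for x
      using grad_eq[OF f(1) that f(2)] by (simp add: divg_def)
    ultimately show ?thesis by blast
  qed
  have "l2_inner \<Omega> (divg u) (divg u) \<le> (\<Sum>K\<in>\<T>. LINT x:K|lebesgue. (norm (divg u x))\<^sup>2)"
    unfolding l2_inner_self by (rule integral_on_mesh(2)[OF mesh \<Omega> loc]) auto
  also have "\<dots> \<le> (\<Sum>K\<in>\<T>. CARD('d) * l2_inner K (grad u) (grad u))"
  proof (rule sum_mono)
    fix K assume K: "K \<in> \<T>"
    have mK: "K \<in> sets lebesgue"
      using full_simplex_basics(1)[OF mesh_simplex[OF K]] by (intro fmeasurableD lmeasurable_compact)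
    obtain G where G: "continuous_on UNIV G" "\<forall>x\<in>interior K. (norm (divg u x))\<^sup>2 = G x"
      using loc[OF K] by blast
    have "set_integrable lebesgue K (\<lambda>x. (norm (divg u x))\<^sup>2)"
      by (rule integral_on_full_simplex(1)[OF mesh_simplex[OF K] G(1)]) (use G(2) in blast)
    moreover have "set_integrable lebesgue K (\<lambda>x. CARD('d) * (norm (grad u x))\<^sup>2)"
      using grad_square_integrable[OF u K] mK
      by (intro set_integrable_mult_right) (simp add: set_integrable_eq power2_norm_eq_inner)
    ultimately have "(LINT x:K|lebesgue. (norm (divg u x))\<^sup>2) \<le> (LINT x:K|lebesgue. CARD('d) * (norm (grad u x))\<^sup>2)"
      by (rule set_integral_mono) (use trace_sq_le in \<open>auto simp: divg_def\<close>)
    then show "(LINT x:K|lebesgue. (norm (divg u x))\<^sup>2) \<le> CARD('d) * l2_inner K (grad u) (grad u)"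
      by (simp add: l2_inner_self)
  qed
  also have "\<dots> = CARD('d) * (\<Sum>K\<in>\<T>. l2_inner K (grad u) (grad u))" by (simp add: sum_distrib_left)
  also have "\<dots> \<le> CARD('d) * (DG_norm \<T> u)\<^sup>2" by (intro mult_left_mono DG_norm_sq) simp
  finally show ?thesis .
qed

end

section \<open>Pressure and flux terms\<close>

text \<open>Formulated through smooth representatives on the elements, so that it serves
  displacements and Raviart-Thomas fluxes alike.\<close>

lemma divg_square_integrable:
  fixes \<Omega> :: "(real^'d) set"
  assumes mesh: "simplicial_mesh \<Omega> \<T>" and \<Omega>: "open \<Omega>"
    and u: "\<And>K. K \<in> \<T> \<Longrightarrow> \<exists>f J. C1_field f J \<and> (\<forall>x\<in>interior K. u x = f x)"
  shows "square_integrable \<Omega> (divg u)"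
proof -
  have loc: "\<exists>G. continuous_on UNIV G \<and> (\<forall>x\<in>interior K. divg u x = G x)" if K: "K \<in> \<T>" for K
  proof -
    obtain f J where f: "C1_field f J" "\<forall>x\<in>interior K. u x = f x" using u[OF K] by blast
    have "continuous_on UNIV (\<lambda>x. trace (J x))"
      using f(1) unfolding C1_field_def by (intro continuous_on_trace) auto
    moreover have "divg u x = trace (J x)" if "x \<in> interior K" for x
      using grad_eq[OF f(1) that] f(2) by (simp add: divg_def)
    ultimately show ?thesis by blast
  qed
  have loc2: "\<exists>G. continuous_on UNIV G \<and> (\<forall>x\<in>interior K. (norm (divg u x))\<^sup>2 = G x)" if K: "K \<in> \<T>" for K
  proof -
    obtain G where G: "continuous_on UNIV G" "\<forall>x\<in>interior K. divg u x = G x" using loc[OF K] by blast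
    then have "continuous_on UNIV (\<lambda>x. (norm (G x))\<^sup>2)" by (intro continuous_intros)
    then show ?thesis using G(2) by auto
  qed
  have "\<Omega> \<in> sets lebesgue" using \<Omega> by simp
  then show ?thesis
    unfolding square_integrable_def
    using integral_on_mesh(1)[OF mesh \<Omega> loc] integral_on_mesh(1)[OF mesh \<Omega> loc2]
    by (simp add: set_integrable_eq borel_measurable_integrable)
qed

lemma bil_integrable:
  assumes p: "\<And>i. i < n \<Longrightarrow> square_integrable \<Omega> (p i)" and q: "\<And>i. i < n \<Longrightarrow> square_integrable \<Omega> (q i)"
  shows "k < n \<Longrightarrow> integrable (lebesgue_on \<Omega>) (\<lambda>x. (\<Sum>j<n. M $$ (i, j) * p j x) * q k x)"
    and "integrable (lebesgue_on \<Omega>) (\<lambda>x. bil n M (\<lambda>i. p i x) (\<lambda>i. q i x))"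
proof -
  have *: "integrable (lebesgue_on \<Omega>) (\<lambda>x. (\<Sum>j<n. M $$ (i, j) * p j x) * q k x)" if "k < n" for i k
  proof -
    have "integrable (lebesgue_on \<Omega>) (\<lambda>x. \<Sum>j<n. M $$ (i, j) * (p j x * q k x))"
      using square_integrable_product[OF p q[OF that]]
      by (intro Bochner_Integration.integrable_sum integrable_mult_right) auto
    then show ?thesis by (simp add: sum_distrib_right mult.assoc)
  qed
  then show "integrable (lebesgue_on \<Omega>) (\<lambda>x. bil n M (\<lambda>i. p i x) (\<lambda>i. q i x))"
    unfolding bil_def by (intro Bochner_Integration.integrable_sum) auto
  show "k < n \<Longrightarrow> integrable (lebesgue_on \<Omega>) (\<lambda>x. (\<Sum>j<n. M $$ (i, j) * p j x) * q k x)"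
    by (rule *)
qed

text \<open>Moves the sum over the networks under the integral, so that the pointwise Cauchy-Schwarz
  inequalities can be fed to \<open>integral_square_le_mult\<close>.\<close>

lemma weighted_inner_eq:
  assumes \<Omega>: "\<Omega> \<in> sets lebesgue"
    and p: "\<And>i. i < n \<Longrightarrow> square_integrable \<Omega> (p i)" and q: "\<And>i. i < n \<Longrightarrow> square_integrable \<Omega> (q i)"
  shows "weighted_inner \<Omega> n M p q = (\<integral>x. bil n M (\<lambda>i. p i x) (\<lambda>i. q i x) \<partial>lebesgue_on \<Omega>)"
proof -
  have "weighted_inner \<Omega> n M p q = (\<Sum>i<n. \<integral>x. (\<Sum>j<n. M $$ (i, j) * p j x) * q i x \<partial>lebesgue_on \<Omega>)"
    by (simp add: weighted_inner_def l2_inner_eq_lebesgue_on[OF \<Omega>])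
  also have "\<dots> = (\<integral>x. bil n M (\<lambda>i. p i x) (\<lambda>i. q i x) \<partial>lebesgue_on \<Omega>)"
    unfolding bil_def using bil_integrable(1)[OF p q]
    by (intro Bochner_Integration.integral_sum[symmetric]) auto
  finally show ?thesis .
qed

section \<open>Integrated bounds for the pressure and flux terms\<close>

context
  fixes \<Omega> :: "(real^'d) set" and n :: nat and lam \<tau> :: real and Rinv \<alpha>p b :: "nat \<Rightarrow> real"
    and \<alpha> \<beta> :: "nat \<Rightarrow> nat \<Rightarrow> real" and \<Lambda> :: "real mat"
  assumes \<Omega>: "\<Omega> \<in> sets lebesgue"
    and n: "n \<ge> 1" and lam: "lam > 0" and Rinv: "\<forall>i<n. Rinv i > 0" and \<alpha>p: "\<forall>i<n. \<alpha>p i \<ge> 0"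
    and \<tau>: "\<tau> > 0" and b: "\<forall>i<n. b i > 0"
    and \<beta>: "\<forall>i<n. \<forall>j<n. i \<noteq> j \<longrightarrow> \<beta> i j = \<beta> j i \<and> \<beta> i j \<ge> 0"
    and \<beta>_diag: "\<forall>i<n. \<beta> i i = (\<Sum>j\<in>{..<n} - {i}. \<beta> i j)"
    and \<alpha>: "\<alpha> = exchange \<tau> b \<beta>" and \<Lambda>: "\<Lambda> = Lambda n lam Rinv \<alpha>p \<alpha>"
begin

lemmas Lambda_facts = bil_Lambda_ge[where lam = lam, OF n Rinv \<alpha>p \<tau> b \<beta> \<beta>_diag \<alpha>, folded \<Lambda>]
lemmas Lambda_exchange = exchange_Cauchy_Schwarz[where lam = lam, OF n Rinv \<alpha>p \<tau> b \<beta> \<beta>_diag \<alpha>, folded \<Lambda>]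
lemmas Lambda_dual = Lambda_dual_Cauchy_Schwarz[where lam = lam, OF n Rinv \<alpha>p \<tau> b \<beta> \<beta>_diag \<alpha>, folded \<Lambda>]
lemmas Lambda_inverse_nonneg = bil_Lambda_inverse_nonneg[where lam = lam, OF n Rinv \<alpha>p \<tau> b \<beta> \<beta>_diag \<alpha>, folded \<Lambda>]

lemma P_norm_sq:
  assumes p: "\<And>i. i < n \<Longrightarrow> square_integrable \<Omega> (p i)"
  shows "(P_norm \<Omega> n \<Lambda> p)\<^sup>2 = (\<integral>x. bil n \<Lambda> (\<lambda>i. p i x) (\<lambda>i. p i x) \<partial>lebesgue_on \<Omega>)"
    and "0 \<le> P_norm \<Omega> n \<Lambda> p"
proof -
  have "0 \<le> (\<integral>x. bil n \<Lambda> (\<lambda>i. p i x) (\<lambda>i. p i x) \<partial>lebesgue_on \<Omega>)"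
    by (intro Bochner_Integration.integral_nonneg Lambda_facts)
  then show "(P_norm \<Omega> n \<Lambda> p)\<^sup>2 = (\<integral>x. bil n \<Lambda> (\<lambda>i. p i x) (\<lambda>i. p i x) \<partial>lebesgue_on \<Omega>)"
    "0 \<le> P_norm \<Omega> n \<Lambda> p"
    by (simp_all add: P_norm_def weighted_inner_eq[OF \<Omega> p p])
qed

lemma V_norm_sq:
  assumes "\<And>i. i < n \<Longrightarrow> square_integrable \<Omega> (divg (v i))"
  shows "(\<Sum>i<n. Rinv i * l2_inner \<Omega> (v i) (v i)) \<le> (V_norm \<Omega> n Rinv \<Lambda> v)\<^sup>2"
    and "(\<integral>x. bil n (the (mat_inverse \<Lambda>)) (\<lambda>i. divg (v i) x) (\<lambda>i. divg (v i) x) \<partial>lebesgue_on \<Omega>)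
      \<le> (V_norm \<Omega> n Rinv \<Lambda> v)\<^sup>2"
    and "0 \<le> V_norm \<Omega> n Rinv \<Lambda> v"
proof -
  let ?I = "\<integral>x. bil n (the (mat_inverse \<Lambda>)) (\<lambda>i. divg (v i) x) (\<lambda>i. divg (v i) x) \<partial>lebesgue_on \<Omega>"
  have 1: "0 \<le> ?I" by (intro Bochner_Integration.integral_nonneg Lambda_inverse_nonneg)
  have 2: "0 \<le> (\<Sum>i<n. Rinv i * l2_inner \<Omega> (v i) (v i))"
    using Rinv by (intro sum_nonneg mult_nonneg_nonneg l2_inner_self_nonneg) auto
  have eq: "V_norm \<Omega> n Rinv \<Lambda> v = sqrt ((\<Sum>i<n. Rinv i * l2_inner \<Omega> (v i) (v i)) + ?I)"
    using weighted_inner_eq[OF \<Omega> assms assms] by (simp add: V_norm_def)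
  then show "0 \<le> V_norm \<Omega> n Rinv \<Lambda> v" using 1 2 by simp
  have "(V_norm \<Omega> n Rinv \<Lambda> v)\<^sup>2 = (\<Sum>i<n. Rinv i * l2_inner \<Omega> (v i) (v i)) + ?I"
    unfolding eq using 1 2 by (intro real_sqrt_pow2) linarith
  then show "(\<Sum>i<n. Rinv i * l2_inner \<Omega> (v i) (v i)) \<le> (V_norm \<Omega> n Rinv \<Lambda> v)\<^sup>2"
    "?I \<le> (V_norm \<Omega> n Rinv \<Lambda> v)\<^sup>2" using 1 2 by linarith+
qed

text \<open>The duality between \<Lambda> and its inverse holds at every point of \<Omega> and is
  integrated; the sum over networks is never split.\<close>

lemma flux_divergence_bound:
  assumes p: "\<And>i. i < n \<Longrightarrow> square_integrable \<Omega> (p i)"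
    and z: "\<And>i. i < n \<Longrightarrow> square_integrable \<Omega> (divg (z i))"
  shows "\<bar>\<Sum>i<n. l2_inner \<Omega> (p i) (divg (z i))\<bar> \<le> P_norm \<Omega> n \<Lambda> p * V_norm \<Omega> n Rinv \<Lambda> z"
proof (rule abs_le_mult_of_square_le)
  let ?N = "the (mat_inverse \<Lambda>)"
  have "(\<Sum>i<n. l2_inner \<Omega> (p i) (divg (z i))) = (\<integral>x. (\<Sum>i<n. p i x * divg (z i) x) \<partial>lebesgue_on \<Omega>)"
    unfolding l2_inner_eq_lebesgue_on[OF \<Omega>] inner_real_def
    using square_integrable_product[OF p z] by (subst Bochner_Integration.integral_sum) auto
  then show "(\<Sum>i<n. l2_inner \<Omega> (p i) (divg (z i)))\<^sup>2
    \<le> (\<integral>x. bil n \<Lambda> (\<lambda>i. p i x) (\<lambda>i. p i x) \<partial>lebesgue_on \<Omega>)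
      * (\<integral>x. bil n ?N (\<lambda>i. divg (z i) x) (\<lambda>i. divg (z i) x) \<partial>lebesgue_on \<Omega>)"
    by (simp only:) (intro integral_square_le_mult bil_integrable p z Lambda_facts Lambda_inverse_nonneg Lambda_dual)
qed (use P_norm_sq[OF p] V_norm_sq[OF z] in \<open>auto intro!: Bochner_Integration.integral_nonneg
    Lambda_facts Lambda_inverse_nonneg\<close>)

text \<open>All networks are paired with the same g, so only the sum of the pressures matters, and
  Lambda_4 controls exactly its square divided by \<open>max 1 lam\<close>. That factor moves over
  to g, where B absorbs it.\<close>

lemma displacement_divergence_bound:
  assumes p: "\<And>i. i < n \<Longrightarrow> square_integrable \<Omega> (p i)"
    and g: "square_integrable \<Omega> g" and B: "l2_inner \<Omega> g g * max 1 lam \<le> B\<^sup>2" "0 \<le> B"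
  shows "\<bar>\<Sum>i<n. l2_inner \<Omega> (p i) g\<bar> \<le> P_norm \<Omega> n \<Lambda> p * B"
proof (rule abs_le_mult_of_square_le)
  have gg: "integrable (lebesgue_on \<Omega>) (\<lambda>x. (g x)\<^sup>2 * max 1 lam)"
    using square_integrable_product[OF g g] by (simp add: power2_eq_square)
  have "(\<Sum>i<n. l2_inner \<Omega> (p i) g) = (\<integral>x. (\<Sum>i<n. p i x * g x) \<partial>lebesgue_on \<Omega>)"
    unfolding l2_inner_eq_lebesgue_on[OF \<Omega>] inner_real_def
    using square_integrable_product[OF p g] by (subst Bochner_Integration.integral_sum) auto
  moreover have "(\<integral>x. (\<Sum>i<n. p i x * g x) \<partial>lebesgue_on \<Omega>)\<^sup>2
    \<le> (\<integral>x. bil n \<Lambda> (\<lambda>i. p i x) (\<lambda>i. p i x) \<partial>lebesgue_on \<Omega>) * (\<integral>x. (g x)\<^sup>2 * max 1 lam \<partial>lebesgue_on \<Omega>)"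
  proof (intro integral_square_le_mult bil_integrable p gg Lambda_facts)
    fix x
    have "(\<Sum>i<n. p i x * g x)\<^sup>2 = ((\<Sum>i<n. p i x)\<^sup>2 / max 1 lam) * ((g x)\<^sup>2 * max 1 lam)"
      by (simp add: power_mult_distrib flip: sum_distrib_right)
    also have "\<dots> \<le> bil n \<Lambda> (\<lambda>i. p i x) (\<lambda>i. p i x) * ((g x)\<^sup>2 * max 1 lam)"
      by (intro mult_right_mono Lambda_facts) auto
    finally show "(\<Sum>i<n. p i x * g x)\<^sup>2 \<le> bil n \<Lambda> (\<lambda>i. p i x) (\<lambda>i. p i x) * ((g x)\<^sup>2 * max 1 lam)" .
  qed auto
  moreover have gI: "(\<integral>x. (g x)\<^sup>2 * max 1 lam \<partial>lebesgue_on \<Omega>) = l2_inner \<Omega> g g * max 1 lam"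
    unfolding l2_inner_eq_lebesgue_on[OF \<Omega>] by (simp add: power2_eq_square)
  ultimately show "(\<Sum>i<n. l2_inner \<Omega> (p i) g)\<^sup>2
    \<le> (\<integral>x. bil n \<Lambda> (\<lambda>i. p i x) (\<lambda>i. p i x) \<partial>lebesgue_on \<Omega>) * (l2_inner \<Omega> g g * max 1 lam)"
    by (simp only:)
  show "0 \<le> l2_inner \<Omega> g g * max 1 lam" by (intro mult_nonneg_nonneg l2_inner_self_nonneg) simp
qed (use P_norm_sq[OF p] B in \<open>auto intro!: Bochner_Integration.integral_nonneg Lambda_facts\<close>)

lemma flux_mass_bound:
  assumes v: "\<And>i. i < n \<Longrightarrow> square_integrable \<Omega> (v i)" "\<And>i. i < n \<Longrightarrow> square_integrable \<Omega> (divg (v i))"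
    and z: "\<And>i. i < n \<Longrightarrow> square_integrable \<Omega> (z i)" "\<And>i. i < n \<Longrightarrow> square_integrable \<Omega> (divg (z i))"
  shows "\<bar>\<Sum>i<n. l2_inner \<Omega> (\<lambda>x. Rinv i *\<^sub>R v i x) (z i)\<bar> \<le> V_norm \<Omega> n Rinv \<Lambda> v * V_norm \<Omega> n Rinv \<Lambda> z"
proof (rule abs_le_mult_of_square_le)
  have nn: "0 \<le> Rinv i * l2_inner \<Omega> (f i) (f i)" if "i < n" for i and f :: "nat \<Rightarrow> real^'d \<Rightarrow> real^'d"
    using that Rinv l2_inner_self_nonneg by (intro mult_nonneg_nonneg) auto
  show "(\<Sum>i<n. l2_inner \<Omega> (\<lambda>x. Rinv i *\<^sub>R v i x) (z i))\<^sup>2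
    \<le> (\<Sum>i<n. Rinv i * l2_inner \<Omega> (v i) (v i)) * (\<Sum>i<n. Rinv i * l2_inner \<Omega> (z i) (z i))"
  proof (rule sum_square_le_mult)
    fix i assume "i \<in> {..<n}"
    then have i: "i < n" by simp
    then show "0 \<le> Rinv i * l2_inner \<Omega> (v i) (v i)" "0 \<le> Rinv i * l2_inner \<Omega> (z i) (z i)"
      by (rule nn)+
    have "(l2_inner \<Omega> (v i) (z i))\<^sup>2 \<le> l2_inner \<Omega> (v i) (v i) * l2_inner \<Omega> (z i) (z i)"
      unfolding l2_inner_eq_lebesgue_on[OF \<Omega>]
      by (intro integral_square_le_mult square_integrable_product v z i Cauchy_Schwarz_ineq inner_ge_zero)
    then have "(Rinv i)\<^sup>2 * (l2_inner \<Omega> (v i) (z i))\<^sup>2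
        \<le> (Rinv i)\<^sup>2 * (l2_inner \<Omega> (v i) (v i) * l2_inner \<Omega> (z i) (z i))"
      by (intro mult_left_mono) auto
    moreover have "l2_inner \<Omega> (\<lambda>x. Rinv i *\<^sub>R v i x) (z i) = Rinv i * l2_inner \<Omega> (v i) (z i)"
      unfolding l2_inner_eq_lebesgue_on[OF \<Omega>] by simp
    ultimately show "(l2_inner \<Omega> (\<lambda>x. Rinv i *\<^sub>R v i x) (z i))\<^sup>2
        \<le> (Rinv i * l2_inner \<Omega> (v i) (v i)) * (Rinv i * l2_inner \<Omega> (z i) (z i))"
      by (simp add: power_mult_distrib power2_eq_square mult_ac)
  qed
  show "0 \<le> (\<Sum>i<n. Rinv i * l2_inner \<Omega> (v i) (v i))" "0 \<le> (\<Sum>i<n. Rinv i * l2_inner \<Omega> (z i) (z i))"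
    by (intro sum_nonneg nn; simp)+
qed (intro V_norm_sq v z; assumption)+

text \<open>The expression is minus the integrated form of \<open>exchange_mat\<close>, so the
  diagonal and the coupling between networks are estimated together.\<close>

lemma exchange_bound:
  assumes p: "\<And>i. i < n \<Longrightarrow> square_integrable \<Omega> (p i)" and q: "\<And>i. i < n \<Longrightarrow> square_integrable \<Omega> (q i)"
  shows "\<bar>(\<Sum>i<n. (- \<alpha>p i - \<alpha> i i) * l2_inner \<Omega> (p i) (q i))
      + (\<Sum>i<n. \<Sum>j\<in>{..<n} - {i}. \<alpha> i j * l2_inner \<Omega> (p j) (q i))\<bar> \<le> P_norm \<Omega> n \<Lambda> p * P_norm \<Omega> n \<Lambda> q"
proof -
  let ?E = "exchange_mat n \<alpha>p \<alpha>"
  let ?I = "\<integral>x. bil n ?E (\<lambda>i. p i x) (\<lambda>i. q i x) \<partial>lebesgue_on \<Omega>"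
  have pq: "integrable (lebesgue_on \<Omega>) (\<lambda>x. p i x * q j x)" if "i < n" "j < n" for i j
    using square_integrable_product[OF p[OF that(1)] q[OF that(2)]] by simp
  have "?I = (\<integral>x. (\<Sum>i<n. (\<alpha>p i + \<alpha> i i) * (p i x * q i x)) \<partial>lebesgue_on \<Omega>)
    - (\<integral>x. (\<Sum>i<n. \<Sum>j\<in>{..<n} - {i}. \<alpha> i j * (p j x * q i x)) \<partial>lebesgue_on \<Omega>)"
    unfolding bil_exchange_mat
    by (intro Bochner_Integration.integral_diff Bochner_Integration.integrable_sum integrable_mult_right pq) auto
  also have "(\<integral>x. (\<Sum>i<n. (\<alpha>p i + \<alpha> i i) * (p i x * q i x)) \<partial>lebesgue_on \<Omega>)
      = (\<Sum>i<n. (\<alpha>p i + \<alpha> i i) * l2_inner \<Omega> (p i) (q i))"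
    using pq by (subst Bochner_Integration.integral_sum) (auto simp: l2_inner_eq_lebesgue_on[OF \<Omega>])
  also have "(\<integral>x. (\<Sum>i<n. \<Sum>j\<in>{..<n} - {i}. \<alpha> i j * (p j x * q i x)) \<partial>lebesgue_on \<Omega>)
      = (\<Sum>i<n. \<integral>x. (\<Sum>j\<in>{..<n} - {i}. \<alpha> i j * (p j x * q i x)) \<partial>lebesgue_on \<Omega>)"
    by (intro Bochner_Integration.integral_sum Bochner_Integration.integrable_sum integrable_mult_right pq) auto
  also have "\<dots> = (\<Sum>i<n. \<Sum>j\<in>{..<n} - {i}. \<alpha> i j * l2_inner \<Omega> (p j) (q i))"
  proof (intro sum.cong refl)
    fix i assume "i \<in> {..<n}"
    then show "(\<integral>x. (\<Sum>j\<in>{..<n} - {i}. \<alpha> i j * (p j x * q i x)) \<partial>lebesgue_on \<Omega>)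
        = (\<Sum>j\<in>{..<n} - {i}. \<alpha> i j * l2_inner \<Omega> (p j) (q i))"
      using pq by (subst Bochner_Integration.integral_sum) (auto simp: l2_inner_eq_lebesgue_on[OF \<Omega>])
  qed
  finally have "(\<Sum>i<n. (- \<alpha>p i - \<alpha> i i) * l2_inner \<Omega> (p i) (q i))
      + (\<Sum>i<n. \<Sum>j\<in>{..<n} - {i}. \<alpha> i j * l2_inner \<Omega> (p j) (q i)) = - ?I"
    by (simp add: algebra_simps sum.distrib sum_subtractf sum_negf)
  moreover have "\<bar>?I\<bar> \<le> P_norm \<Omega> n \<Lambda> p * P_norm \<Omega> n \<Lambda> q"
  proof (rule abs_le_mult_of_square_le)
    show "?I\<^sup>2 \<le> (\<integral>x. bil n \<Lambda> (\<lambda>i. p i x) (\<lambda>i. p i x) \<partial>lebesgue_on \<Omega>)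
        * (\<integral>x. bil n \<Lambda> (\<lambda>i. q i x) (\<lambda>i. q i x) \<partial>lebesgue_on \<Omega>)"
      by (intro integral_square_le_mult bil_integrable p q Lambda_facts Lambda_exchange)
  qed (use P_norm_sq[OF p] P_norm_sq[OF q] in \<open>auto intro!: Bochner_Integration.integral_nonneg Lambda_facts\<close>)
  ultimately show ?thesis by simp
qed

end

lemma eight_products_le:
  fixes u v p w z q :: real
  assumes "0 \<le> u" "0 \<le> v" "0 \<le> p" "0 \<le> w" "0 \<le> z" "0 \<le> q" "0 \<le> a" "0 \<le> c"
  shows "a * (u * w) + u * w + p * (c * w) + v * z + p * z + q * (c * u) + q * v + p * q
    \<le> (a + 2 * c + 5) * (u + v + p) * (w + z + q)"
proof -
  have m: "x * y \<le> (u + v + p) * (w + z + q)" if "x \<le> u + v + p" "y \<le> w + z + q" "0 \<le> x" "0 \<le> y" for x y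
    using that assms by (intro mult_mono) auto
  let ?S = "(u + v + p) * (w + z + q)"
  have "a * (u * w) \<le> a * ?S" "c * (p * w) \<le> c * ?S" "c * (u * q) \<le> c * ?S"
    using assms by (intro mult_left_mono m; simp)+
  moreover have "u * w \<le> ?S" "v * z \<le> ?S" "p * z \<le> ?S" "v * q \<le> ?S" "p * q \<le> ?S"
    using assms by (intro m; simp)+
  moreover have "(a + 2 * c + 5) * (u + v + p) * (w + z + q) = a * ?S + c * ?S + c * ?S + ?S + ?S + ?S + ?S + ?S"
    by (simp add: algebra_simps)
  ultimately show ?thesis by (simp only: mult.left_commute[of p c w] mult.left_commute[of q c u]
      mult.commute[of q u] mult.commute[of q v])
qed

section \<open>The boundedness theorem\<close>

lemma Hdiv_space_square_integrable: "u \<in> Hdiv_space \<Omega> \<T> loc \<Longrightarrow> square_integrable \<Omega> u"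
  by (simp add: Hdiv_space_def Hdiv_def)

lemma V_space_square_integrable:
  assumes v: "v \<in> V_space \<Omega> \<T> l n" and mesh: "simplicial_mesh \<Omega> \<T>" and \<Omega>: "open \<Omega>" and i: "i < n"
  shows "square_integrable \<Omega> (v i)" "square_integrable \<Omega> (divg (v i))"
proof -
  have vi: "v i \<in> Hdiv_space \<Omega> \<T> (RT (l - 1))" using v i by (simp add: V_space_def)
  then show "square_integrable \<Omega> (v i)" by (rule Hdiv_space_square_integrable)
  show "square_integrable \<Omega> (divg (v i))"
  proof (rule divg_square_integrable[OF mesh \<Omega>])
    fix K assume "K \<in> \<T>"
    then obtain f where "f \<in> RT (l - 1) K" "\<forall>x\<in>interior K. v i x = f x"
      using vi by (auto simp: Hdiv_space_def)
    then show "\<exists>f J. C1_field f J \<and> (\<forall>x\<in>interior K. v i x = f x)" using RT_C1 by blast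
  qed
qed

theorem theorem9:
  fixes \<Omega> :: "(real^'d) set"
    and \<TT> :: "(real^'d) set set set"
    and \<eta> :: real
    and l :: nat
    and Uloc :: "nat \<Rightarrow> (real^'d) set \<Rightarrow> (real^'d \<Rightarrow> real^'d) set"
  assumes "CARD('d) \<in> {2, 3}"
    and "polyhedral_lipschitz_domain \<Omega>"
    and "\<forall>\<T>\<in>\<TT>. simplicial_mesh \<Omega> \<T>"
    and "shape_regular \<TT>"
    and "l \<ge> 1"
    and "Uloc = BDM \<or> Uloc = BDFM"
  shows "\<exists>C::real. \<forall>\<T>\<in>\<TT>. \<forall>n::nat. \<forall>(lam::real) Rinv \<alpha>p \<tau> b \<beta> \<alpha> \<Lambda>.
    n \<ge> 1 \<longrightarrow> lam > 0 \<longrightarrow> (\<forall>i<n. Rinv i > 0) \<longrightarrow> (\<forall>i<n. \<alpha>p i \<ge> 0) \<longrightarrow>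
    \<tau> > 0 \<longrightarrow> (\<forall>i<n. b i > 0) \<longrightarrow>
    (\<forall>i<n. \<forall>j<n. i \<noteq> j \<longrightarrow> \<beta> i j = \<beta> j i \<and> \<beta> i j \<ge> 0) \<longrightarrow>
    (\<forall>i<n. \<beta> i i = (\<Sum>j\<in>{..<n} - {i}. \<beta> i j)) \<longrightarrow>
    \<alpha> = exchange \<tau> b \<beta> \<longrightarrow> \<Lambda> = Lambda n lam Rinv \<alpha>p \<alpha> \<longrightarrow>
    (\<forall>u\<in>U_space \<Omega> \<T> Uloc l. \<forall>v\<in>V_space \<Omega> \<T> l n. \<forall>p\<in>P_space \<Omega> \<T> l n.
     \<forall>w\<in>U_space \<Omega> \<T> Uloc l. \<forall>z\<in>V_space \<Omega> \<T> l n. \<forall>q\<in>P_space \<Omega> \<T> l n.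
       \<bar>A_form \<Omega> \<T> \<eta> n lam Rinv \<alpha>p \<alpha> (u, v, p) (w, z, q)\<bar>
       \<le> C * (U_norm \<Omega> \<T> lam u + V_norm \<Omega> n Rinv \<Lambda> v + P_norm \<Omega> n \<Lambda> p)
           * (U_norm \<Omega> \<T> lam w + V_norm \<Omega> n Rinv \<Lambda> z + P_norm \<Omega> n \<Lambda> q))"
proof -
  have dim: "CARD('d) \<ge> 2" using assms(1) by auto
  have \<Omega>: "open \<Omega>" "bounded \<Omega>" using assms(2) by (auto simp: polyhedral_lipschitz_domain_def)
  then have \<Omega>m: "\<Omega> \<in> sets lebesgue" by simp
  note Uloc = assms(6)
  obtain \<sigma> where \<sigma>: "\<forall>\<T>\<in>\<TT>. \<forall>K\<in>\<T>. diameter K \<le> \<sigma> * inball_diameter K"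
    using assms(4) by (auto simp: shape_regular_def)
  \<comment> \<open>The factor 4 is lost in the choice of an inscribed ball; the maximum provides
    \<rho> \<ge> 1, which \<open>gradient_sup_bound\<close> asks for.\<close>
  define \<rho> where "\<rho> = max 1 (4 * \<sigma>)"
  have \<rho>: "\<rho> \<ge> 1" "4 * \<sigma> \<le> \<rho>" by (simp_all add: \<rho>_def)
  obtain D where D: "0 \<le> D" and Dbound: "\<forall>(K :: (real^'d) set) c r f J u x.
    int CARD('d) simplex K \<longrightarrow> r > 0 \<longrightarrow> cball c r \<subseteq> K \<longrightarrow> diameter K \<le> \<rho> * r \<longrightarrow>
    f \<in> vec_polys l \<longrightarrow> C1_field f J \<longrightarrow> (\<forall>x\<in>interior K. u x = f x) \<longrightarrow> x \<in> K \<longrightarrow>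
    diameter K ^ CARD('d) * (norm (J x))\<^sup>2 \<le> D * l2_inner K (grad u) (grad u)"
    using gradient_sup_bound[OF \<rho>(1)] by blast
  \<comment> \<open>Every element lies in the closure of \<Omega>, so H bounds all diameters
    independently of the mesh.\<close>
  define H where "H = diameter (closure \<Omega>)"
  have bcl: "bounded (closure \<Omega>)" using \<Omega>(2) by (rule bounded_closure)
  have H: "0 \<le> H" unfolding H_def using bcl by (rule diameter_ge_0)
  define C where "C = (1 + 2 * H) * (unit_ball_vol CARD('d) * 2 ^ CARD('d)) * D"
  define A where "A = 1 + 2 * sqrt (C * 2 ^ (CARD('d) + 1)) + \<bar>\<eta>\<bar>"
  define d where "d = real CARD('d)"
  have d1: "1 \<le> d" using dim by (simp add: d_def)
  show ?thesis
  proof (intro exI[of _ "A + 2 * d + 5"] ballI allI impI)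
    fix \<T> n lam Rinv \<alpha>p \<tau> b \<beta> \<alpha> \<Lambda> u v p w z q
    assume \<T>: "\<T> \<in> \<TT>" and n: "(n::nat) \<ge> 1" and lam: "(lam::real) > 0" and Rinv: "\<forall>i<n. Rinv i > 0"
      and \<alpha>p: "\<forall>i<n. \<alpha>p i \<ge> 0" and \<tau>: "(\<tau>::real) > 0" and b: "\<forall>i<n. b i > 0"
      and \<beta>: "\<forall>i<n. \<forall>j<n. i \<noteq> j \<longrightarrow> \<beta> i j = \<beta> j i \<and> \<beta> i j \<ge> 0"
      and \<beta>_diag: "\<forall>i<n. \<beta> i i = (\<Sum>j\<in>{..<n} - {i}. \<beta> i j)"
      and \<alpha>: "\<alpha> = exchange \<tau> b \<beta>" and \<Lambda>: "\<Lambda> = Lambda n lam Rinv \<alpha>p \<alpha>"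
      and u: "u \<in> U_space \<Omega> \<T> Uloc l" and v: "v \<in> V_space \<Omega> \<T> l n" and p: "p \<in> P_space \<Omega> \<T> l n"
      and w: "w \<in> U_space \<Omega> \<T> Uloc l" and z: "z \<in> V_space \<Omega> \<T> l n" and q: "q \<in> P_space \<Omega> \<T> l n"
    have mesh: "simplicial_mesh \<Omega> \<T>" using assms(3) \<T> by blast
    have KH: "diameter K \<le> H" if K: "K \<in> \<T>" for K
    proof -
      have "K \<subseteq> closure \<Omega>" using mesh K by (auto simp: simplicial_mesh_def)
      then show ?thesis unfolding H_def using bcl by (rule diameter_subset)
    qed
    have simp: "int DIM(real^'d) simplex K" if "K \<in> \<T>" for K
      using mesh that by (simp add: simplicial_mesh_def)
    have gb: "gradient_bounded \<T> l D"
      unfolding gradient_bounded_def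
    proof (intro ballI allI impI)
      fix K f J u x
      assume K: "K \<in> \<T>" and f: "f \<in> vec_polys l" "C1_field f J" "\<forall>x\<in>interior K. u x = f x" and x: "x \<in> K"
      note basics = full_simplex_basics[OF simp[OF K]]
      \<comment> \<open>\<open>inball_of_shape_regular\<close> asks for a positive diameter; for
        diameter 0 any inner ball will do.\<close>
      have ball: "\<exists>c r. r > 0 \<and> cball c r \<subseteq> K \<and> diameter K \<le> \<rho> * r"
      proof (cases "diameter K = 0")
        case True
        obtain c e where e: "e > 0" "cball c e \<subseteq> K"
          using basics(4) by (metis all_not_in_conv mem_interior_cball)
        then show ?thesis using True \<rho>(1) by (intro exI[of _ c] exI[of _ e]) auto
      next
        case False
        then have "0 < diameter K"
          using diameter_ge_0[OF compact_imp_bounded[OF basics(1)]] by linarith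
        moreover have "K \<noteq> {}" using x by blast
        moreover have "diameter K \<le> \<sigma> * inball_diameter K" using \<sigma> \<T> K by blast
        ultimately obtain c r where cr: "r > 0" "cball c r \<subseteq> K" "diameter K \<le> 4 * \<sigma> * r"
          using inball_of_shape_regular[OF basics(1)] by blast
        have "4 * \<sigma> * r \<le> \<rho> * r" using cr(1) \<rho>(2) by (intro mult_right_mono) auto
        then show ?thesis using cr by (meson order_trans)
      qed
      have "int CARD('d) simplex K" using simp[OF K] by simp
      then show "diameter K ^ CARD('d) * (norm (J x))\<^sup>2 \<le> D * l2_inner K (grad u) (grad u)"
        using ball Dbound f x by blast
    qed
    note ctx = mesh dim Uloc D H KH gb
    note ctx2 = \<Omega>m n lam Rinv \<alpha>p \<tau> b \<beta> \<beta>_diag \<alpha> \<Lambda>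
    have DG: "0 \<le> DG_norm \<T> u" for u :: "real^'d \<Rightarrow> real^'d"
      by (rule DG_norm_sq(1)[OF ctx])
    have Usq: "(U_norm \<Omega> \<T> lam u)\<^sup>2 = (DG_norm \<T> u)\<^sup>2 + lam * l2_inner \<Omega> (divg u) (divg u)"
      and U0: "0 \<le> U_norm \<Omega> \<T> lam u" for u
      using lam l2_inner_self_nonneg[of \<Omega> "divg u"] by (simp_all add: U_norm_def)
    have DGU: "DG_norm \<T> u \<le> U_norm \<Omega> \<T> lam u" for u
    proof (rule power2_le_imp_le)
      have "0 \<le> lam * l2_inner \<Omega> (divg u) (divg u)"
        using lam l2_inner_self_nonneg by (intro mult_nonneg_nonneg) auto
      then show "(DG_norm \<T> u)\<^sup>2 \<le> (U_norm \<Omega> \<T> lam u)\<^sup>2" by (simp add: Usq)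
    qed (rule U0)
    have divU: "square_integrable \<Omega> (divg u)" if u: "u \<in> U_space \<Omega> \<T> Uloc l" for u
    proof (rule divg_square_integrable[OF mesh \<Omega>(1)])
      show "\<exists>f J. C1_field f J \<and> (\<forall>x\<in>interior K. u x = f x)" if "K \<in> \<T>" for K
        using U_space_local[OF u Uloc that] by metis
    qed
    have divB: "l2_inner \<Omega> (divg u) (divg u) * max 1 lam \<le> (d * U_norm \<Omega> \<T> lam u)\<^sup>2"
      if u: "u \<in> U_space \<Omega> \<T> Uloc l" for u
    proof -
      let ?I = "l2_inner \<Omega> (divg u) (divg u)"
      have I: "?I \<le> d * (DG_norm \<T> u)\<^sup>2" unfolding d_def by (rule divg_L2_le[OF ctx u \<Omega>(1)])
      \<comment> \<open>Since \<open>max 1 lam\<close> is at most 1 + lam, the summand 1 is paid by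
        the elementwise gradient and lam by the weighted divergence in the norm.\<close>
      have "?I * max 1 lam \<le> ?I + lam * ?I"
        using l2_inner_self_nonneg[of \<Omega> "divg u"] lam by (simp add: max_def)
      also have "\<dots> \<le> d * (DG_norm \<T> u)\<^sup>2 + d * (lam * ?I)"
      proof (rule add_mono[OF I])
        have "0 \<le> lam * ?I" using lam l2_inner_self_nonneg by (intro mult_nonneg_nonneg) auto
        then have "1 * (lam * ?I) \<le> d * (lam * ?I)" using d1 by (intro mult_right_mono)
        then show "lam * ?I \<le> d * (lam * ?I)" by simp
      qed
      also have "\<dots> = d * (U_norm \<Omega> \<T> lam u)\<^sup>2" by (simp add: Usq distrib_left)
      \<comment> \<open>Passing from d to its square makes the bound a perfect square, as
        \<open>displacement_divergence_bound\<close> expects.\<close>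
      also have "\<dots> \<le> d\<^sup>2 * (U_norm \<Omega> \<T> lam u)\<^sup>2"
        using d1 by (intro mult_right_mono) (auto simp: power2_eq_square)
      finally show ?thesis by (simp add: power_mult_distrib)
    qed
    have sp: "square_integrable \<Omega> (p i)" "square_integrable \<Omega> (q i)" if "i < n" for i
      using p q that by (simp_all add: P_space_def)
    note sv = V_space_square_integrable[OF v mesh \<Omega>(1)] and sz = V_space_square_integrable[OF z mesh \<Omega>(1)]
    have dU: "0 \<le> d * U_norm \<Omega> \<T> lam u" for u using d1 U0 by simp
    let ?U = "U_norm \<Omega> \<T> lam u" and ?V = "V_norm \<Omega> n Rinv \<Lambda> v" and ?P = "P_norm \<Omega> n \<Lambda> p"
    let ?W = "U_norm \<Omega> \<T> lam w" and ?Z = "V_norm \<Omega> n Rinv \<Lambda> z" and ?Q = "P_norm \<Omega> n \<Lambda> q"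
    define t where "t = (\<Sum>i<n. (- \<alpha>p i - \<alpha> i i) * l2_inner \<Omega> (p i) (q i))
      + (\<Sum>i<n. \<Sum>j\<in>{..<n} - {i}. \<alpha> i j * l2_inner \<Omega> (p j) (q i))"
    have C0: "0 \<le> C" using D H by (simp add: C_def)
    have A0: "0 \<le> A" using C0 by (simp add: A_def)
    have "\<bar>a_form \<T> \<eta> u w\<bar> \<le> A * (DG_norm \<T> u * DG_norm \<T> w)"
      unfolding A_def C_def by (rule a_form_bound[OF ctx u w])
    also have "\<dots> \<le> A * (?U * ?W)"
      using A0 DG DGU U0 by (intro mult_left_mono mult_mono) auto
    finally have 1: "\<bar>a_form \<T> \<eta> u w\<bar> \<le> A * (?U * ?W)" .
    have 2: "\<bar>lam * l2_inner \<Omega> (divg u) (divg w)\<bar> \<le> ?U * ?W"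
    proof (rule abs_le_mult_of_square_le)
      have "(l2_inner \<Omega> (divg u) (divg w))\<^sup>2 \<le> l2_inner \<Omega> (divg u) (divg u) * l2_inner \<Omega> (divg w) (divg w)"
        unfolding l2_inner_eq_lebesgue_on[OF \<Omega>m]
        by (intro integral_square_le_mult square_integrable_product divU u w Cauchy_Schwarz_ineq inner_ge_zero)
      then have "lam\<^sup>2 * (l2_inner \<Omega> (divg u) (divg w))\<^sup>2
          \<le> lam\<^sup>2 * (l2_inner \<Omega> (divg u) (divg u) * l2_inner \<Omega> (divg w) (divg w))"
        by (intro mult_left_mono) auto
      then show "(lam * l2_inner \<Omega> (divg u) (divg w))\<^sup>2
          \<le> (lam * l2_inner \<Omega> (divg u) (divg u)) * (lam * l2_inner \<Omega> (divg w) (divg w))"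
        by (simp add: power_mult_distrib power2_eq_square mult_ac)
    qed (use lam l2_inner_self_nonneg U0 in \<open>auto simp: Usq intro!: mult_nonneg_nonneg\<close>)
    have 3: "\<bar>\<Sum>i<n. l2_inner \<Omega> (p i) (divg w)\<bar> \<le> ?P * (d * ?W)"
      by (rule displacement_divergence_bound[OF ctx2 sp(1) divU[OF w] divB[OF w] dU])
    have 4: "\<bar>\<Sum>i<n. l2_inner \<Omega> (\<lambda>x. Rinv i *\<^sub>R v i x) (z i)\<bar> \<le> ?V * ?Z"
      by (rule flux_mass_bound[OF ctx2 sv sz])
    have 5: "\<bar>\<Sum>i<n. l2_inner \<Omega> (p i) (divg (z i))\<bar> \<le> ?P * ?Z"
      by (rule flux_divergence_bound[OF ctx2 sp(1) sz(2)])
    \<comment> \<open>The terms with the test pressures q mirror those with p; by symmetry the same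
      two bounds apply with the roles exchanged.\<close>
    have comm: "l2_inner \<Omega> f g = l2_inner \<Omega> g f" for f g :: "real^'d \<Rightarrow> real"
      by (simp add: l2_inner_def mult.commute)
    have 6: "\<bar>\<Sum>i<n. l2_inner \<Omega> (divg u) (q i)\<bar> \<le> ?Q * (d * ?U)"
      unfolding comm[of "divg u"]
      by (rule displacement_divergence_bound[OF ctx2 sp(2) divU[OF u] divB[OF u] dU])
    have 7: "\<bar>\<Sum>i<n. l2_inner \<Omega> (divg (v i)) (q i)\<bar> \<le> ?Q * ?V"
      unfolding comm[of "divg (v _)"]
      by (rule flux_divergence_bound[OF ctx2 sp(2) sv(2)])
    have 8: "\<bar>t\<bar> \<le> ?P * ?Q" unfolding t_def by (rule exchange_bound[OF ctx2 sp])
    have "A_form \<Omega> \<T> \<eta> n lam Rinv \<alpha>p \<alpha> (u, v, p) (w, z, q)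
      = a_form \<T> \<eta> u w + lam * l2_inner \<Omega> (divg u) (divg w) - (\<Sum>i<n. l2_inner \<Omega> (p i) (divg w))
        + (\<Sum>i<n. l2_inner \<Omega> (\<lambda>x. Rinv i *\<^sub>R v i x) (z i)) - (\<Sum>i<n. l2_inner \<Omega> (p i) (divg (z i)))
        - (\<Sum>i<n. l2_inner \<Omega> (divg u) (q i)) - (\<Sum>i<n. l2_inner \<Omega> (divg (v i)) (q i)) + t"
      by (simp add: A_form_def t_def)
    then have "\<bar>A_form \<Omega> \<T> \<eta> n lam Rinv \<alpha>p \<alpha> (u, v, p) (w, z, q)\<bar>
        \<le> A * (?U * ?W) + ?U * ?W + ?P * (d * ?W) + ?V * ?Z + ?P * ?Z + ?Q * (d * ?U) + ?Q * ?V + ?P * ?Q"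
      using 1 2 3 4 5 6 7 8 unfolding abs_le_iff by linarith
    also have "\<dots> \<le> (A + 2 * d + 5) * (?U + ?V + ?P) * (?W + ?Z + ?Q)"
      using U0 V_norm_sq(3)[OF ctx2 sv(2)] V_norm_sq(3)[OF ctx2 sz(2)] P_norm_sq(2)[OF ctx2 sp(1)]
        P_norm_sq(2)[OF ctx2 sp(2)] A0 d1
      by (intro eight_products_le) auto
    finally show "\<bar>A_form \<Omega> \<T> \<eta> n lam Rinv \<alpha>p \<alpha> (u, v, p) (w, z, q)\<bar>
        \<le> (A + 2 * d + 5) * (?U + ?V + ?P) * (?W + ?Z + ?Q)" .
  qed
qed

end
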